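(* Let $p\in\mathcal{S}_n$ and let $f:\mathbb{D}\to\mathcal{E}(p)$ be a holomorphic map, and let $m\ge 2$. Then (a) $f$ is a weak $m$-extremal if and only if it is an $m$-extremal; (b) if $f_j\not\equiv 0$ for $j=1,\ldots,n$, then $f$ is an $m$-extremal if and only if it is of the form $(\ast_m)$ (defined in the context). In particular, (a) and (b) hold in any symmetric convex and in any $\mathcal{C}^2$-smooth complex ellipsoid.
   Context: $\mathbb{D}$ is the open unit disc in $\mathbb{C}$. For $p=(p_1,\ldots,p_n)\in\mathbb{R}_{>0}^n$ the complex ellipsoid is $\mathcal{E}(p)=\{z\in\mathbb{C}^n:|z_1|^{2p_1}+\ldots+|z_n|^{2p_n}<1\}$; it is called symmetric if $p_1=\ldots=p_n$. The set $\mathcal{S}_n\subset[1/2,\infty)^n$ is the smallest set such that: $(1/2,\ldots,1/2)\in\mathcal{S}_n$; if $p\in\mathcal{S}_n$ and $c\ge 1$ then $cp\in\mathcal{S}_n$; if $p\in\mathcal{S}_n$ then $(p_1,\ldots,p_{j-1},1,p_{j+1},\ldots,p_n)\in\mathcal{S}_n$ for any $j$. For a domain $D\subset\mathbb{C}^n$, $\mathcal{O}(\overline{\mathbb{D}},D)$ denotes the set of mappings holomorphic in a neighborhood of $\overline{\mathbb{D}}$ with values in $D$. A holomorphic mapping $f:\mathbb{D}\to D$ is a weak $m$-extremal for pairwise distinct points $\lambda_1,\ldots,\lambda_m\in\mathbb{D}$ if there is no $h\in\mathcal{O}(\overline{\mathbb{D}},D)$ with $h(\lambda_j)=f(\lambda_j)$,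 $j=1,\ldots,m$. It is a weak $m$-extremal if this holds for some pairwise distinct $\lambda_1,\ldots,\lambda_m\in\mathbb{D}$, and an $m$-extremal if this holds for every choice of pairwise distinct $\lambda_1,\ldots,\lambda_m\in\mathbb{D}$. A map $f=(f_1,\ldots,f_n):\mathbb{D}\to\mathcal{E}(p)$ is of the form $(\ast_m)$ if $$f_j(\lambda)=a_j\prod_{k=1}^{m-1}\left(\frac{\lambda-\alpha_{kj}}{1-\overline{\alpha}_{kj}\lambda}\right)^{r_{kj}}\left(\frac{1-\overline{\alpha}_{kj}\lambda}{1-\overline{\alpha}_{k0}\lambda}\right)^{1/p_j},\quad j=1,\ldots,n,$$ where $a_j\in\mathbb{C}\setminus\{0\}$, $\alpha_{kj}\in\overline{\mathbb{D}}$, $\alpha_{k0}\in\mathbb{D}$, $r_{kj}\in\{0,1\}$, $$\sum_{j=1}^n|a_j|^{2p_j}\prod_{k=1}^{m-1}(\lambda-\alpha_{kj})(1-\overline{\alpha}_{kj}\lambda)=\prod_{k=1}^{m-1}(\lambda-\alpha_{k0})(1-\overline{\alpha}_{k0}\lambda),\quad\lambda\in\mathbb{C},$$ and $f$ is not constant. Here the powers $(\cdot)^{1/p_j}$ denote the holomorphic branch on $\mathbb{D}$ equal to $1$ at $\lambda=0$, and for $|\alpha_{kj}|=1$ the factor $\frac{\lambda-\alpha_{kj}}{1-\overline{\alpha}_{kj}\lambda}$ is understood as the unimodular constant $-\alpha_{kj}$. *)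

theory Defs
  imports "HOL-Complex_Analysis.Complex_Analysis"
begin

unbundle no fps_syntax

definition complex_ellipsoid :: "real ^ 'n \<Rightarrow> (complex ^ 'n) set" where
  "complex_ellipsoid p = {z. (\<Sum>j\<in>UNIV. cmod (z $ j) powr (2 * p $ j)) < 1}"

definition symmetric_exponent :: "real ^ 'n \<Rightarrow> bool" where
  "symmetric_exponent p \<longleftrightarrow> (\<forall>i j. p $ i = p $ j)"

inductive_set exponents_S :: "(real ^ 'n) set" where
  half: "(\<chi> j. 1 / 2) \<in> exponents_S"
| scale: "p \<in> exponents_S \<Longrightarrow> c \<ge> 1 \<Longrightarrow> c *\<^sub>R p \<in> exponents_S"
| set_one: "p \<in> exponents_S \<Longrightarrow> (\<chi> i. if i = j then 1 else p $ i) \<in> exponents_S"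

lemma exponents_S_ge_half:
  fixes p :: "real ^ 'n"
  assumes "p \<in> exponents_S"
  shows "p $ j \<ge> 1 / 2"
  using assms
proof (induction arbitrary: j)
  case (scale p c)
  have "1 * (1 / 2) \<le> c * (p $ j)"
    using scale by (intro mult_mono) auto
  then show ?case by simp
qed auto

definition C2_on :: "'a::real_normed_vector set \<Rightarrow> ('a \<Rightarrow> real) \<Rightarrow> bool" where
  "C2_on U \<rho> \<longleftrightarrow>
     (\<exists>(\<rho>' :: 'a \<Rightarrow> 'a \<Rightarrow>\<^sub>L real) (\<rho>'' :: 'a \<Rightarrow> 'a \<Rightarrow>\<^sub>L 'a \<Rightarrow>\<^sub>L real).
        (\<forall>x\<in>U. (\<rho> has_derivative blinfun_apply (\<rho>' x)) (at x)) \<and>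
        (\<forall>x\<in>U. (\<rho>' has_derivative blinfun_apply (\<rho>'' x)) (at x)) \<and>
        continuous_on U \<rho>'')"

text \<open>An open set is \<open>C\<^sup>2\<close>-smooth if near each boundary point it is a sublevel set of a
  real-valued \<open>C\<^sup>2\<close> function with nowhere vanishing (real) differential.\<close>

definition C2_smooth :: "'a::real_normed_vector set \<Rightarrow> bool" where
  "C2_smooth D \<longleftrightarrow> open D \<and>
     (\<forall>x\<in>frontier D. \<exists>U \<rho>. open U \<and> x \<in> U \<and> C2_on U \<rho> \<and>
        (\<forall>y\<in>U. \<not> (\<rho> has_derivative (\<lambda>_. 0)) (at y)) \<and>
        D \<inter> U = {y \<in> U. \<rho> y < 0})"

definition holomorphic_map_on :: "(complex \<Rightarrow> complex ^ 'n) \<Rightarrow> complex set \<Rightarrow> bool" where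
  "holomorphic_map_on f A \<longleftrightarrow> (\<forall>j. (\<lambda>z. f z $ j) holomorphic_on A)"

text \<open>Maps are total functions; only their values on the unit disc matter here.\<close>

definition holomorphic_disc :: "(complex \<Rightarrow> complex ^ 'n) \<Rightarrow> (complex ^ 'n) set \<Rightarrow> bool" where
  "holomorphic_disc f D \<longleftrightarrow> holomorphic_map_on f (ball 0 1) \<and> f \<in> ball 0 1 \<rightarrow> D"

definition holomorphic_closed_discs ::
    "(complex ^ 'n) set \<Rightarrow> (complex \<Rightarrow> complex ^ 'n) set" where
  "holomorphic_closed_discs D =
     {h. \<exists>U. open U \<and> cball 0 1 \<subseteq> U \<and> holomorphic_map_on h U \<and> h \<in> U \<rightarrow> D}"

definition distinct_disc_points :: "nat \<Rightarrow> (nat \<Rightarrow> complex) \<Rightarrow> bool" where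
  "distinct_disc_points m l \<longleftrightarrow> l \<in> {1..m} \<rightarrow> ball 0 1 \<and> inj_on l {1..m}"

definition weak_extremal_for ::
    "nat \<Rightarrow> (complex ^ 'n) set \<Rightarrow> (nat \<Rightarrow> complex) \<Rightarrow> (complex \<Rightarrow> complex ^ 'n) \<Rightarrow> bool" where
  "weak_extremal_for m D l f \<longleftrightarrow> holomorphic_disc f D \<and> distinct_disc_points m l \<and>
     \<not> (\<exists>h\<in>holomorphic_closed_discs D. \<forall>j\<in>{1..m}. h (l j) = f (l j))"

definition weak_extremal ::
    "nat \<Rightarrow> (complex ^ 'n) set \<Rightarrow> (complex \<Rightarrow> complex ^ 'n) \<Rightarrow> bool" where
  "weak_extremal m D f \<longleftrightarrow> (\<exists>l. distinct_disc_points m l \<and> weak_extremal_for m D l f)"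

definition extremal ::
    "nat \<Rightarrow> (complex ^ 'n) set \<Rightarrow> (complex \<Rightarrow> complex ^ 'n) \<Rightarrow> bool" where
  "extremal m D f \<longleftrightarrow> holomorphic_disc f D \<and>
     (\<forall>l. distinct_disc_points m l \<longrightarrow> weak_extremal_for m D l f)"

text \<open>In the next definition the powers are principal ones. For \<open>z\<close> in the disc both
  \<open>1 - cnj \<alpha> * z\<close> and \<open>1 - cnj \<beta> * z\<close> have positive real part, so their quotient avoids the
  branch cut, and the principal power is the holomorphic branch with value 1 at 0.\<close>

lemma quotient_not_nonpos_Reals:
  assumes "Re a > 0" "Re b > 0"
  shows "a / b \<notin> \<real>\<^sub>\<le>\<^sub>0"
proof
  assume "a / b \<in> \<real>\<^sub>\<le>\<^sub>0"
  then obtain r where r: "a / b = of_real r" "r \<le> 0"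
    by (auto elim: nonpos_Reals_cases)
  have "b \<noteq> 0" using assms by auto
  then have "a = of_real r * b" using r(1) by (simp add: field_simps)
  then have "Re a = r * Re b" by simp
  then show False using assms r(2) mult_nonpos_nonneg[of r "Re b"] by simp
qed

lemma Re_one_minus_pos:
  assumes "cmod \<alpha> \<le> 1" "cmod z < 1"
  shows "Re (1 - cnj \<alpha> * z) > 0"
proof -
  have "Re (cnj \<alpha> * z) \<le> cmod (cnj \<alpha> * z)" by (rule complex_Re_le_cmod)
  also have "\<dots> \<le> 1 * cmod z"
    unfolding norm_mult complex_mod_cnj using assms by (intro mult_right_mono) auto
  finally show ?thesis using assms by simp
qed

lemma principal_branch:
  fixes w :: complex
  assumes "cmod \<alpha> \<le> 1" "cmod \<beta> \<le> 1"
  defines "g \<equiv> \<lambda>z. ((1 - cnj \<alpha> * z) / (1 - cnj \<beta> * z)) powr w"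
  shows "g holomorphic_on ball 0 1" and "g 0 = 1"
proof -
  have *: "Re (1 - cnj \<alpha> * z) > 0" "Re (1 - cnj \<beta> * z) > 0" if "z \<in> ball 0 1" for z
    using that assms Re_one_minus_pos by auto
  show "g holomorphic_on ball 0 1"
    unfolding g_def using quotient_not_nonpos_Reals[OF *] *(2)
    by (intro holomorphic_intros) fastforce+
  show "g 0 = 1" by (simp add: g_def)
qed

text \<open>For \<open>\<bar>\<alpha>\<bar> = 1\<close> no separate case is needed in the definition.\<close>

lemma boundary_factor_constant:
  assumes "cmod \<alpha> = 1" "cmod z < 1"
  shows "(z - \<alpha>) / (1 - cnj \<alpha> * z) = - \<alpha>"
proof -
  have "1 - cnj \<alpha> * z \<noteq> 0"
    using Re_one_minus_pos[of \<alpha> z] assms by (metis less_irrefl order_refl zero_complex.sel(1))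
  moreover have "\<alpha> * cnj \<alpha> = 1"
    using assms complex_norm_square[of \<alpha>] by simp
  ultimately show ?thesis
    by (simp add: divide_eq_eq right_diff_distrib flip: mult.assoc)
qed

definition star_form ::
    "nat \<Rightarrow> real ^ 'n \<Rightarrow> (complex \<Rightarrow> complex ^ 'n) \<Rightarrow> bool" where
  "star_form m p f \<longleftrightarrow>
     holomorphic_disc f (complex_ellipsoid p) \<and> \<not> f constant_on ball 0 1 \<and>
     (\<exists>(a :: 'n \<Rightarrow> complex) (\<alpha> :: nat \<Rightarrow> 'n \<Rightarrow> complex) (\<alpha>0 :: nat \<Rightarrow> complex)
        (r :: nat \<Rightarrow> 'n \<Rightarrow> nat).
        (\<forall>j. a j \<noteq> 0) \<and>
        (\<forall>k\<in>{1..m-1}. \<alpha>0 k \<in> ball 0 1 \<and> (\<forall>j. \<alpha> k j \<in> cball 0 1 \<and> r k j \<in> {0, 1})) \<and>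
        (\<forall>z. (\<Sum>j\<in>UNIV. complex_of_real (cmod (a j) powr (2 * p $ j)) *
                   (\<Prod>k = 1..m-1. (z - \<alpha> k j) * (1 - cnj (\<alpha> k j) * z)))
              = (\<Prod>k = 1..m-1. (z - \<alpha>0 k) * (1 - cnj (\<alpha>0 k) * z))) \<and>
        (\<forall>z\<in>ball 0 1. \<forall>j. f z $ j =
           a j * (\<Prod>k = 1..m-1.
             ((z - \<alpha> k j) / (1 - cnj (\<alpha> k j) * z)) ^ r k j *
             ((1 - cnj (\<alpha> k j) * z) / (1 - cnj (\<alpha>0 k) * z)) powr complex_of_real (1 / p $ j))))"

end

theory Submission
  imports Defs "HOL-Computational_Algebra.Fundamental_Theorem_Algebra"
begin

text \<open>
  In each of the three classes either all exponents are at least \<open>1/2\<close> or there is only one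
  variable; in the latter case the exponent is immaterial. If all exponents are at least \<open>1/2\<close>,
  then the ellipsoid is convex, although possibly not smooth, and the argument works for any
  nonempty set of components that do not vanish identically.

  Weak extremality for \<open>l 1, \<dots>, l m\<close> means that the values \<open>f (l i)\<close> can be separated by a
  linear functional \<open>Re (\<Sum>i j. c i j * h j (l i))\<close> from those of all competitors. Comparing \<open>f\<close>
  with \<open>f j * exp (- \<epsilon> g)\<close>, \<open>Re g \<ge> 0\<close>, shows that \<open>\<Sum>i. c i j * f j (l i) * g (l i)\<close> is the
  integral of \<open>g\<close> over the circle against a nonnegative density, equal to
  \<open>p j * N j / \<Prod>i. |z - l i|\<^sup>2\<close> with a trigonometric polynomial \<open>N j\<close> of degree \<open>m - 1\<close>. Varying
  the moduli of the components of \<open>f (r z)\<close> and letting \<open>r \<rightarrow> 1\<close> identifies \<open>|f j|\<^bsup>2 p j\<^esup>\<close> on the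
  circle with \<open>N j / (\<Sum>k. N k)\<close>, in the sense of means and without using boundary values. The
  theorem of Fejer and Riesz factors these polynomials, which yields the outer parts of \<open>f\<close>.
  Varying the inner part \<open>q\<close> shows that the product of \<open>q\<close> with the factored numerator is a
  polynomial of degree at most \<open>2 m - 2\<close> of known modulus on the circle, and therefore \<open>q\<close> is a
  Blaschke product with zeros among the \<open>\<alpha> k j\<close>.

  Conversely, if \<open>f\<close> is of the form \<open>(\<ast>\<^sub>m)\<close> and \<open>h\<close> a competitor, then
  \<open>\<Sum>j. p j * E j * (h j - f j)\<close>, where \<open>E j\<close> extends \<open>|f j|\<^bsup>2 p j\<^esup> / f j\<close> from the circle and is
  multiplied by a suitable kernel vanishing at the nodes, has integral zero, whereas convexity
  makes its real part negative on the circle.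
\<close>

no_notation fps_nth (infixl \<open>$\<close> 75)

section \<open>Means over the unit circle\<close>

text \<open>The degree \<open>m - 1\<close>: on multiplicative variations the functional sees only
  the values of \<open>g\<close> at the nodes, so its density is the real part of a sum of
  \<open>m\<close> simple fractions; over the common denominator only degree \<open>m - 1\<close>
  survives, because the numerator is real on the circle. Two parameters: as \<open>F\<close> has no
  boundary values at the start, \<open>F (r z)\<close> is varied instead, which costs
  \<open>omega r\<close> in the functional. The first order inequality divides this cost by the size
  \<open>e\<close> of the variation. So \<open>e\<close> is fixed first and \<open>r\<close> is then
  taken so close to 1 that \<open>omega r < e^2\<close>. The variation is chosen so that its first
  order gain is a weighted mean of squares, which yields convergence and not merely an inequality.
  The constraint is tested on the circle only: \<open>2 * p j >= 1\<close> gives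
  \<open>|H|^(2 p j)\<close> the sub-mean property. A further obstacle: the
  \<open>\<alpha>0 k\<close> must lie in the open disc, but the sum of the trigonometric polynomials
  may vanish on the circle. Its circle zeros are common to all summands, so the factorizations are
  matched index by index and these factors cancel. Nodes do not occur in the resulting form; this is
  why one choice of nodes decides about all.\<close>

definition circ_avg :: "(complex \<Rightarrow> 'a::banach) \<Rightarrow> 'a" where
  "circ_avg u = integral {0..1} (\<lambda>t. u (circlepath 0 1 t))"

lemma circlepath_unit_mem [simp]: "circlepath 0 1 t \<in> sphere 0 1"
  by (simp add: circlepath)

lemma norm_circlepath_unit [simp]: "norm (circlepath 0 1 t) = 1"
  by (simp add: circlepath)

lemma circlepath_unit_onto:
  assumes "norm z = 1"
  obtains t where "t \<in> {0..1}" "z = circlepath 0 1 t"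
proof -
  have "z \<in> path_image (circlepath 0 1)"
    using assms by (simp add: path_image_circlepath)
  then show ?thesis using that unfolding path_image_def by blast
qed

lemma continuous_on_circlepath_unit:
  assumes "continuous_on (sphere 0 1) u"
  shows "continuous_on {0..1} (\<lambda>t. u (circlepath 0 1 t))"
proof (rule continuous_on_compose2[OF assms])
  show "continuous_on {0..1} (circlepath 0 1)"
    using path_circlepath[of 0 1] by (simp add: path_def)
qed auto

lemma circ_avg_integrable:
  fixes u :: "complex \<Rightarrow> 'a::banach"
  assumes "continuous_on (sphere 0 1) u"
  shows "(\<lambda>t. u (circlepath 0 1 t)) integrable_on {0..1}"
  using integrable_continuous_interval continuous_on_circlepath_unit[OF assms] by blast

lemma circ_avg_cong:
  assumes "\<And>z. norm z = 1 \<Longrightarrow> u z = v z"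
  shows "circ_avg u = circ_avg v"
  unfolding circ_avg_def by (rule integral_cong) (simp add: assms)

lemma circ_avg_const [simp]: "circ_avg (\<lambda>_. c) = c"
  by (simp add: circ_avg_def)

lemma circ_avg_add:
  assumes "continuous_on (sphere 0 1) u" "continuous_on (sphere 0 1) v"
  shows "circ_avg (\<lambda>z. u z + v z) = circ_avg u + circ_avg v"
  unfolding circ_avg_def by (intro integral_add circ_avg_integrable assms)

lemma circ_avg_diff:
  assumes "continuous_on (sphere 0 1) u" "continuous_on (sphere 0 1) v"
  shows "circ_avg (\<lambda>z. u z - v z) = circ_avg u - circ_avg v"
  unfolding circ_avg_def by (intro integral_diff circ_avg_integrable assms)

lemma circ_avg_sum:
  assumes "finite A" "\<And>i. i \<in> A \<Longrightarrow> continuous_on (sphere 0 1) (u i)"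
  shows "circ_avg (\<lambda>z. \<Sum>i\<in>A. u i z) = (\<Sum>i\<in>A. circ_avg (u i))"
  unfolding circ_avg_def by (intro integral_sum circ_avg_integrable assms)

lemma circ_avg_mult_left:
  fixes c :: "'a::{banach, real_normed_field}"
  shows "circ_avg (\<lambda>z. c * u z) = c * circ_avg u"
  unfolding circ_avg_def by (rule integral_mult_right)

lemma circ_avg_linear:
  assumes "continuous_on (sphere 0 1) u" "bounded_linear h"
  shows "circ_avg (\<lambda>z. h (u z)) = h (circ_avg u)"
  unfolding circ_avg_def
  using integral_linear[OF circ_avg_integrable[OF assms(1)] assms(2)] by (simp add: o_def)

lemma circ_avg_mono:
  fixes u v :: "complex \<Rightarrow> real"
  assumes "continuous_on (sphere 0 1) u" "continuous_on (sphere 0 1) v"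
    and "\<And>z. norm z = 1 \<Longrightarrow> u z \<le> v z"
  shows "circ_avg u \<le> circ_avg v"
  unfolding circ_avg_def by (intro integral_le circ_avg_integrable assms) simp

lemma circ_avg_norm_le:
  fixes u :: "complex \<Rightarrow> 'a::banach"
  assumes "continuous_on (sphere 0 1) u" "continuous_on (sphere 0 1) v"
    and "\<And>z. norm z = 1 \<Longrightarrow> norm (u z) \<le> v z"
  shows "norm (circ_avg u) \<le> circ_avg v"
  unfolding circ_avg_def by (intro integral_norm_bound_integral circ_avg_integrable assms) simp

lemma circ_avg_eq_0D:
  fixes u :: "complex \<Rightarrow> real"
  assumes cont: "continuous_on (sphere 0 1) u" and nonneg: "\<And>z. norm z = 1 \<Longrightarrow> u z \<ge> 0"
    and avg: "circ_avg u = 0" and z: "norm z = 1"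
  shows "u z = 0"
proof -
  obtain t where t: "t \<in> {0..1}" "z = circlepath 0 1 t"
    using circlepath_unit_onto[OF z] .
  have "integral {0..1} (\<lambda>t. u (circlepath 0 1 t)) = 0
          \<longleftrightarrow> (\<forall>x\<in>{0..1}. u (circlepath 0 1 x) = 0)"
    by (rule integral_eq_0_iff) (use continuous_on_circlepath_unit[OF cont] nonneg in auto)
  then show ?thesis using avg t by (simp add: circ_avg_def)
qed

text \<open>On the path \<open>exp (2 pi i t)\<close> one has \<open>dz = 2 pi i z dt\<close>; this
  supplies the factor \<open>z\<close> and cancels the \<open>2 pi i\<close> of the contour
  formula.\<close>

lemma circ_avg_Cauchy:
  assumes "continuous_on (cball 0 1) F" "F holomorphic_on ball 0 1" "norm w < 1"
  shows "circ_avg (\<lambda>z. F z * z / (z - w)) = F w"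
proof -
  have "((\<lambda>u. F u / (u - w)) has_contour_integral (2 * of_real pi * \<i> * F w)) (circlepath 0 1)"
    using Cauchy_integral_circlepath[OF assms(1,2), of w] assms(3) by simp
  then have "((\<lambda>x. F (circlepath 0 1 x) / (circlepath 0 1 x - w) *
       (2 * pi * \<i> * exp (2 * of_real pi * \<i> * x))) has_integral (2 * of_real pi * \<i> * F w)) {0..1}"
    unfolding has_contour_integral by (simp add: vector_derivative_circlepath)
  then have "((\<lambda>x. (1 / (2 * of_real pi * \<i>)) * (F (circlepath 0 1 x) / (circlepath 0 1 x - w) *
       (2 * pi * \<i> * exp (2 * of_real pi * \<i> * x))))
       has_integral (1 / (2 * of_real pi * \<i>)) * (2 * of_real pi * \<i> * F w)) {0..1}"
    by (rule has_integral_mult_right)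
  then have "((\<lambda>x. F (circlepath 0 1 x) * circlepath 0 1 x / (circlepath 0 1 x - w))
       has_integral F w) {0..1}"
    by (simp add: circlepath mult_ac)
  then show ?thesis unfolding circ_avg_def by (rule integral_unique)
qed

lemma circ_avg_at_0:
  assumes "continuous_on (cball 0 1) F" "F holomorphic_on ball 0 1"
  shows "circ_avg F = F 0"
proof -
  have "circ_avg F = circ_avg (\<lambda>z. F z * z / (z - 0))"
    by (rule circ_avg_cong) auto
  then show ?thesis using circ_avg_Cauchy[OF assms, of 0] by simp
qed

lemma unit_mult_cnj: "norm (z::complex) = 1 \<Longrightarrow> z * cnj z = 1"
  using complex_norm_square[of z] by simp

text \<open>On the unit circle \<open>(z - a) (1 - cnj a z) = z |z - a|^2\<close>: this turns squared moduli into
  polynomials and back.\<close>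

lemma circle_factor:
  assumes "norm z = 1"
  shows "(z - a) * (1 - cnj a * z) = z * of_real ((norm (z - a))\<^sup>2)"
proof -
  have "z * of_real ((norm (z - a))\<^sup>2) = (z - a) * (z * cnj (z - a))"
    unfolding complex_norm_square by (simp add: mult_ac)
  also have "z * cnj (z - a) = 1 - cnj a * z"
    using unit_mult_cnj[OF assms] by (simp add: algebra_simps)
  finally show ?thesis by simp
qed

lemma circle_norm_reflect:
  assumes "norm z = 1"
  shows "norm (1 - cnj a * z) = norm (z - a)"
proof -
  have "1 - cnj a * z = z * cnj (z - a)"
    using unit_mult_cnj[OF assms] by (simp add: algebra_simps)
  then show ?thesis using assms by (simp add: norm_mult flip: complex_cnj_diff)
qed

lemma one_minus_cnj_mult_neq_0:
  assumes "norm a \<le> 1" "norm z \<le> 1" "norm a < 1 \<or> norm z < 1"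
  shows "1 - cnj a * z \<noteq> 0"
proof
  assume "1 - cnj a * z = 0"
  then have "norm (cnj a * z) = 1" by (metis eq_iff_diff_eq_0 norm_one)
  then have "norm a * norm z = 1" by (simp add: norm_mult)
  moreover have "norm a * norm z \<le> norm a" "norm a * norm z \<le> norm z"
    using assms by (auto intro: mult_left_le mult_left_le_one_le)
  ultimately show False using assms(3) by linarith
qed

definition poisson :: "complex \<Rightarrow> complex \<Rightarrow> real" where
  "poisson w z = (1 - (norm w)\<^sup>2) / (norm (z - w))\<^sup>2"

lemma poisson_nonneg: "norm w < 1 \<Longrightarrow> poisson w z \<ge> 0"
  by (auto simp: poisson_def abs_square_le_1 intro!: divide_nonneg_nonneg)

lemma continuous_on_poisson [continuous_intros]:
  assumes "norm w < 1" shows "continuous_on (sphere 0 1) (poisson w)"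
  unfolding poisson_def using assms by (intro continuous_intros) auto

text \<open>On the circle the Poisson kernel equals
  \<open>z (1 - |w|^2) / ((z - w) (1 - cnj w z))\<close>. Putting all but \<open>z / (z - w)\<close>
  into \<open>F\<close> reduces the claim to Cauchy's formula, and at \<open>w\<close> the
  denominator of \<open>F\<close> cancels \<open>1 - |w|^2\<close>.\<close>

lemma circ_avg_poisson:
  assumes "continuous_on (cball 0 1) H" "H holomorphic_on ball 0 1" and w: "norm w < 1"
  shows "circ_avg (\<lambda>z. of_real (poisson w z) * H z) = H w"
proof -
  define F where "F = (\<lambda>z. H z * of_real (1 - (norm w)\<^sup>2) / (1 - cnj w * z))"
  have nz: "1 - cnj w * z \<noteq> 0" if "norm z \<le> 1" for z
    using one_minus_cnj_mult_neq_0 w that by auto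
  have "circ_avg (\<lambda>z. of_real (poisson w z) * H z) = circ_avg (\<lambda>z. F z * z / (z - w))"
  proof (rule circ_avg_cong)
    fix z :: complex assume z: "norm z = 1"
    have "z \<noteq> w" "z \<noteq> 0" using z w by auto
    moreover have "of_real ((norm (z - w))\<^sup>2) = (z - w) * (1 - cnj w * z) / z"
      using circle_factor[OF z, of w] \<open>z \<noteq> 0\<close> by (simp add: field_simps)
    ultimately show "of_real (poisson w z) * H z = F z * z / (z - w)"
      using nz z unfolding F_def poisson_def of_real_divide by (simp add: mult_ac)
  qed
  also have "\<dots> = F w"
  proof (rule circ_avg_Cauchy[OF _ _ w])
    show "continuous_on (cball 0 1) F" unfolding F_def
      by (intro continuous_intros assms) (use nz in auto)
    show "F holomorphic_on ball 0 1" unfolding F_def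
      by (intro holomorphic_intros assms) (use nz in auto)
  qed
  also have "F w = H w"
    using nz[of w] w complex_norm_square[of w] by (simp add: F_def mult.commute[of w])
  finally show ?thesis .
qed

lemma circ_avg_poisson_one: "norm w < 1 \<Longrightarrow> circ_avg (poisson w) = 1"
proof -
  assume w: "norm w < 1"
  have "of_real (circ_avg (poisson w)) = (circ_avg (\<lambda>z. of_real (poisson w z)) :: complex)"
    using circ_avg_linear[OF continuous_on_poisson[OF w] bounded_linear_of_real] by (rule sym)
  then show ?thesis using circ_avg_poisson[of "\<lambda>_. 1", OF _ _ w] by simp
qed

text \<open>A convex function lies above its tangents. The criterion is applied on the open
  half-line, hence the separate case \<open>y = 0\<close>. Jensen's inequality below and the final
  estimate against competitors both rest on this bound.\<close>

lemma powr_ge_tangent: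
  fixes x y s :: real
  assumes "s \<ge> 1" "x > 0" "y \<ge> 0"
  shows "y powr s \<ge> x powr s + s * x powr (s - 1) * (y - x)"
proof (cases "y = 0")
  case True
  have "x powr s = x powr (s - 1) * x" using assms by (simp flip: powr_add add: powr_mult_base mult.commute)
  moreover have "(s - 1) * (x powr (s - 1) * x) \<ge> 0" using assms by auto
  ultimately show ?thesis using True assms by (simp add: algebra_simps)
next
  case False
  have "convex_on {0<..} (\<lambda>x::real. x powr s)"
    by (rule convex_on_subset[OF powr_convex]) (use assms in auto)
  moreover have "((\<lambda>x. x powr s) has_field_derivative s * x powr (s - 1)) (at x within {0<..})"
    using assms by (auto intro!: derivative_eq_intros simp: powr_diff)
  ultimately have "y powr s - x powr s \<ge> s * x powr (s - 1) * (y - x)"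
    using assms False
    by (intro convex_on_imp_above_tangent[where A = "{0<..}"]) (auto simp: interior_open)
  then show ?thesis by simp
qed

text \<open>Jensen's inequality for the Poisson mean: the tangent to \<open>t powr s\<close> at
  \<open>norm (H w)\<close> is averaged, and its linear term helps because \<open>norm (H w)\<close>
  is at most the Poisson mean of \<open>norm (H z)\<close>.\<close>

lemma submean_powr:
  assumes H: "continuous_on (cball 0 1) H" "H holomorphic_on ball 0 1"
    and w: "norm w < 1" and s: "s \<ge> 1"
  shows "norm (H w) powr s \<le> circ_avg (\<lambda>z. poisson w z * norm (H z) powr s)"
proof (cases "H w = 0")
  have cH: "continuous_on (sphere 0 1) H" by (rule continuous_on_subset[OF H(1)]) auto
  have cs: "continuous_on (sphere 0 1) (\<lambda>z. poisson w z * norm (H z) powr s)"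
    using s by (intro continuous_intros cH w continuous_on_powr') auto
  {
    case True
    have "circ_avg (\<lambda>z::complex. 0::real) \<le> circ_avg (\<lambda>z. poisson w z * norm (H z) powr s)"
      by (rule circ_avg_mono[OF _ cs]) (use poisson_nonneg[OF w] in auto)
    then show ?thesis using True by simp
  next
    case False
    define x where "x = norm (H w)"
    have x: "x > 0" using False by (simp add: x_def)
    have "x \<le> circ_avg (\<lambda>z. poisson w z * norm (H z))"
      unfolding x_def circ_avg_poisson[OF H w, symmetric]
      by (rule circ_avg_norm_le)
         (use poisson_nonneg[OF w] in \<open>auto intro!: continuous_intros cH w simp: norm_mult\<close>)
    then have "x powr s \<le> x powr s + s * x powr (s - 1) *
        (circ_avg (\<lambda>z. poisson w z * norm (H z)) - x)"
      using s by simp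
    also have "\<dots> = circ_avg (\<lambda>z. (x powr s - s * x powr (s - 1) * x) * poisson w z +
         s * x powr (s - 1) * (poisson w z * norm (H z)))"
      by (subst circ_avg_add, intro continuous_intros w, intro continuous_intros w cH)
         (simp only: circ_avg_mult_left circ_avg_poisson_one[OF w], simp add: algebra_simps)
    also have "\<dots> \<le> circ_avg (\<lambda>z. poisson w z * norm (H z) powr s)"
    proof (rule circ_avg_mono[OF _ cs])
      fix z :: complex
      have "poisson w z * (x powr s + s * x powr (s - 1) * (norm (H z) - x))
              \<le> poisson w z * norm (H z) powr s"
        by (intro mult_left_mono powr_ge_tangent s x poisson_nonneg w) auto
      then show "(x powr s - s * x powr (s - 1) * x) * poisson w z +
         s * x powr (s - 1) * (poisson w z * norm (H z)) \<le> poisson w z * norm (H z) powr s"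
        by (simp add: algebra_simps)
    qed (intro continuous_intros w cH)
    finally show ?thesis by (simp add: x_def)
  }
qed

section \<open>Nonnegative trigonometric polynomials\<close>

text \<open>A connected set with more than one point has no isolated points. Identities obtained
  after division by \<open>z - b\<close> are carried over the exceptional points in this
  way.\<close>

lemma circle_closure_diff:
  assumes "finite F" shows "closure (sphere (0::complex) 1 - F) = sphere 0 1"
proof
  show "closure (sphere (0::complex) 1 - F) \<subseteq> sphere 0 1"
    by (rule closure_minimal) auto
  show "sphere (0::complex) 1 \<subseteq> closure (sphere 0 1 - F)"
  proof
    fix z :: complex assume z: "z \<in> sphere 0 1"
    have "connected (sphere (0::complex) 1)" by (rule connected_sphere) simp
    moreover have "\<not> (\<exists>x. sphere (0::complex) 1 = {x})"
    proof
      assume "\<exists>x. sphere (0::complex) 1 = {x}"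
      then obtain x where x: "sphere (0::complex) 1 = {x}" ..
      have "1 \<in> sphere (0::complex) 1" "-1 \<in> sphere (0::complex) 1" by auto
      then have "(1::complex) = -1" unfolding x by simp
      then show False by simp
    qed
    ultimately have "z islimpt sphere 0 1" using z by (intro connected_imp_perfect) auto
    then have "z islimpt ((sphere 0 1 - F) \<union> F)"
      by (rule islimpt_subset) auto
    then have "z islimpt (sphere 0 1 - F)"
      using islimpt_Un islimpt_finite[OF assms] by blast
    then show "z \<in> closure (sphere 0 1 - F)" by (simp add: closure_def)
  qed
qed

lemma circle_closed_extend:
  fixes u :: "complex \<Rightarrow> 'a::topological_space"
  assumes "continuous_on (sphere 0 1) u" "closed C" "finite F"
    and "\<And>z. norm z = 1 \<Longrightarrow> z \<notin> F \<Longrightarrow> u z \<in> C" and "norm z = 1"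
  shows "u z \<in> C"
proof -
  have "u ` closure (sphere 0 1 - F) \<subseteq> C"
    by (rule image_closure_subset) (use assms circle_closure_diff[OF assms(3)] in auto)
  then show ?thesis using assms(5) unfolding circle_closure_diff[OF assms(3)] by auto
qed

lemma circle_eq_extend:
  fixes u v :: "complex \<Rightarrow> 'a::real_normed_vector"
  assumes "continuous_on (sphere 0 1) u" "continuous_on (sphere 0 1) v" "finite F"
    and "\<And>z. norm z = 1 \<Longrightarrow> z \<notin> F \<Longrightarrow> u z = v z" and "norm z = 1"
  shows "u z = v z"
proof -
  have "u z - v z \<in> {0}"
    by (rule circle_closed_extend[where u = "\<lambda>z. u z - v z" and F = F])
       (use assms in \<open>auto intro!: continuous_intros\<close>)
  then show ?thesis by simp
qed

lemma poly_eq_circle: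
  fixes A B :: "complex poly"
  assumes "\<And>z. norm z = 1 \<Longrightarrow> poly A z = poly B z"
  shows "A = B"
proof (rule ccontr)
  assume "A \<noteq> B"
  then have "finite {z. poly (A - B) z = 0}" by (intro poly_roots_finite) simp
  moreover have "sphere 0 1 \<subseteq> {z. poly (A - B) z = 0}" using assms by auto
  ultimately have F: "finite (sphere (0::complex) 1)" using finite_subset by blast
  have "(1::complex) \<in> sphere 0 1" by simp
  then show False using circle_closure_diff[OF F] by (metis Diff_cancel closure_empty empty_iff)
qed

text \<open>This is the reflection \<open>z ^ M * cnj (A (1 / cnj z))\<close>. The length
  \<open>M\<close> is a parameter and not the degree, so that a drop in degree is mirrored by a zero
  at the origin.\<close>

definition sharp :: "nat \<Rightarrow> complex poly \<Rightarrow> complex poly" where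
  "sharp M A = (\<Sum>k\<le>M. monom (cnj (coeff A (M - k))) k)"

lemma coeff_sharp: "coeff (sharp M A) k = (if k \<le> M then cnj (coeff A (M - k)) else 0)"
  unfolding sharp_def coeff_sum coeff_monom by (simp add: sum.delta)

lemma degree_sharp: "degree (sharp M A) \<le> M"
  by (rule degree_le) (simp add: coeff_sharp)

lemma sharp_sharp: "degree A \<le> M \<Longrightarrow> sharp M (sharp M A) = A"
  by (rule poly_eqI) (simp add: coeff_sharp coeff_eq_0)

lemma poly_sharp:
  assumes "degree A \<le> M" "z \<noteq> 0"
  shows "poly (sharp M A) z = z ^ M * cnj (poly A (1 / cnj z))"
proof -
  have "poly (sharp M A) z = (\<Sum>k\<le>M. cnj (coeff A (M - k)) * z ^ k)"
    by (simp add: sharp_def poly_sum poly_monom)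
  also have "\<dots> = (\<Sum>k\<le>M. cnj (coeff A k) * z ^ (M - k))"
    by (rule sum.reindex_bij_witness[where i = "\<lambda>k. M - k" and j = "\<lambda>k. M - k"]) auto
  also have "\<dots> = (\<Sum>k\<le>M. z ^ M * (cnj (coeff A k) * (1 / z) ^ k))"
    by (rule sum.cong) (use assms in \<open>auto simp: power_diff power_divide\<close>)
  also have "\<dots> = z ^ M * cnj (\<Sum>k\<le>M. coeff A k * (1 / cnj z) ^ k)"
    by (simp add: sum_distrib_left)
  also have "(\<Sum>k\<le>M. coeff A k * (1 / cnj z) ^ k) = poly A (1 / cnj z)"
    unfolding poly_altdef using assms(1)
    by (intro sum.mono_neutral_right) (auto simp: coeff_eq_0)
  finally show ?thesis .
qed

lemma poly_sharp_circle:
  assumes "degree A \<le> M" "norm z = 1"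
  shows "poly (sharp M A) z = z ^ M * cnj (poly A z)"
proof -
  have "cnj z \<noteq> 0" using assms by auto
  then have "1 / cnj z = z" using unit_mult_cnj[OF assms(2)] by (simp add: field_simps)
  then show ?thesis using poly_sharp[OF assms(1), of z] assms(2) by force
qed

text \<open>A trigonometric polynomial of degree \<open>M\<close> is stored as the algebraic
  polynomial \<open>z ^ M\<close> times it. \<open>Re\<close> makes the value real by type; that
  nothing is lost is part of \<open>nonneg_trig\<close>.\<close>

definition trig_val :: "nat \<Rightarrow> complex poly \<Rightarrow> complex \<Rightarrow> real" where
  "trig_val M N z = Re (cnj z ^ M * poly N z)"

definition nonneg_trig :: "nat \<Rightarrow> complex poly \<Rightarrow> bool" where
  "nonneg_trig M N \<longleftrightarrow> degree N \<le> 2 * M \<and>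
     (\<forall>z. norm z = 1 \<longrightarrow> trig_val M N z \<ge> 0 \<and> poly N z = z ^ M * of_real (trig_val M N z))"

lemma trig_val_eqI:
  assumes "norm z = 1" "poly N z = z ^ M * of_real x"
  shows "trig_val M N z = x"
proof -
  have "cnj z ^ M * z ^ M = 1"
    using unit_mult_cnj[OF assms(1)] by (metis mult.commute power_mult_distrib power_one)
  then have "cnj z ^ M * poly N z = of_real x"
    using assms(2) by (metis mult.assoc mult.left_neutral)
  then show ?thesis by (simp add: trig_val_def)
qed

lemma continuous_on_trig_val [continuous_intros]: "continuous_on S (trig_val M N)"
  unfolding trig_val_def by (intro continuous_intros)

abbreviation qfac :: "complex \<Rightarrow> complex poly" where
  "qfac b \<equiv> [:-b, 1:] * [:1, -cnj b:]"

lemma poly_qfac: "poly (qfac b) z = (z - b) * (1 - cnj b * z)"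
  by (simp add: algebra_simps)

lemma degree_linear_mult:
  fixes A :: "'a::idom poly"
  assumes "A \<noteq> 0"
  shows "[:b, 1:] * A \<noteq> 0" "degree ([:b, 1:] * A) = Suc (degree A)"
proof -
  have "[:b, 1:] \<noteq> 0" by simp
  then show "[:b, 1:] * A \<noteq> 0" using assms by (metis mult_eq_0_iff)
  show "degree ([:b, 1:] * A) = Suc (degree A)"
    using degree_mult_eq[OF \<open>[:b, 1:] \<noteq> 0\<close> assms] by simp
qed

text \<open>Off \<open>b\<close> one divides by \<open>|z - b|^2 > 0\<close>, and continuity settles
  \<open>b\<close> itself. The degree of \<open>N'\<close> cannot be read off from that of the
  product, because \<open>qfac 0\<close> has degree 1 only.\<close>

lemma nonneg_trig_divide:
  assumes N: "nonneg_trig (Suc M) (qfac b * N')" and deg: "degree N' \<le> 2 * M"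
  shows "nonneg_trig M N'"
proof -
  have "poly N' z - z ^ M * of_real (trig_val M N' z) \<in> {0} \<and> trig_val M N' z \<in> {0..}"
    if z: "norm z = 1" "z \<noteq> b" for z
  proof -
    define x where "x = trig_val (Suc M) (qfac b * N') z"
    have x: "x \<ge> 0" "poly (qfac b * N') z = z ^ Suc M * of_real x"
      using N z unfolding nonneg_trig_def x_def by blast+
    have "z * of_real ((norm (z - b))\<^sup>2) * poly N' z = z ^ Suc M * of_real x"
      using x(2) unfolding poly_mult[of "qfac b"] poly_qfac circle_factor[OF z(1)] .
    then have "of_real ((norm (z - b))\<^sup>2) * poly N' z = z ^ M * of_real x"
      using z by (auto simp: mult_ac)
    then have *: "poly N' z = z ^ M * of_real (x / (norm (z - b))\<^sup>2)"
      using z by (simp add: field_simps)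
    then have "trig_val M N' z = x / (norm (z - b))\<^sup>2" by (rule trig_val_eqI[OF z(1)])
    then show ?thesis using * x by simp
  qed
  note * = this
  have "poly N' z - z ^ M * of_real (trig_val M N' z) \<in> {0} \<and> trig_val M N' z \<in> {0..}"
    if z: "norm z = 1" for z
  proof
    show "poly N' z - z ^ M * of_real (trig_val M N' z) \<in> {0}"
      by (rule circle_closed_extend[where F = "{b}" and u = "\<lambda>z. poly N' z - z ^ M * of_real (trig_val M N' z)"])
         (use * z in \<open>auto intro!: continuous_intros\<close>)
    show "trig_val M N' z \<in> {0..}"
      by (rule circle_closed_extend[where F = "{b}" and u = "trig_val M N'"])
         (use * z in \<open>auto intro!: continuous_intros\<close>)
  qed
  then show ?thesis using deg unfolding nonneg_trig_def by auto
qed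

text \<open>A nonnegative function on the circle has a minimum at each zero, so the zero is double.
  The function is differentiated along the arc \<open>b * exp (\<i> * w)\<close>.\<close>

lemma nonneg_trig_circle_root:
  assumes N: "nonneg_trig (Suc M) N" and b: "norm b = 1" and root: "poly N b = 0"
  obtains N' where "N = qfac b * N'" "nonneg_trig M N'"
proof -
  have b0: "b \<noteq> 0" using b by auto
  define G where "G = (\<lambda>w. poly N (b * exp (\<i> * w)) / (b * exp (\<i> * w)) ^ Suc M)"
  \<comment> \<open>The derivative of the denominator does not contribute, since
    \<open>poly N b = 0\<close>.\<close>
  define D where "D = poly (pderiv N) b * (b * \<i>) / b ^ Suc M"
  have "(G has_field_derivative D) (at 0)"
    unfolding G_def D_def using b0 root
    by (auto intro!: derivative_eq_intros poly_DERIV[THEN DERIV_chain2] simp: field_simps)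
  then have "((\<lambda>t. G (of_real t)) has_vector_derivative D) (at 0)"
    by (intro has_vector_derivative_real_field) simp
  moreover have Gval: "G (of_real t) = of_real (trig_val (Suc M) N (b * exp (\<i> * of_real t)))" for t
  proof -
    have n: "norm (b * exp (\<i> * of_real t)) = 1" using b by (simp add: norm_mult)
    then have "poly N (b * exp (\<i> * of_real t)) = (b * exp (\<i> * of_real t)) ^ Suc M *
        of_real (trig_val (Suc M) N (b * exp (\<i> * of_real t)))"
      using N unfolding nonneg_trig_def by blast
    then show ?thesis unfolding G_def using b0 by simp
  qed
  ultimately have vd: "((\<lambda>t. of_real (trig_val (Suc M) N (b * exp (\<i> * of_real t))))
      has_vector_derivative D) (at 0)" by simp
  have "((\<lambda>t. Re (of_real (trig_val (Suc M) N (b * exp (\<i> * of_real t))))) has_vector_derivative Re D) (at 0)"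
    by (rule bounded_linear.has_vector_derivative[OF bounded_linear_Re vd])
  then have der: "((\<lambda>t. trig_val (Suc M) N (b * exp (\<i> * of_real t))) has_field_derivative Re D) (at 0)"
    by (simp add: has_real_derivative_iff_has_vector_derivative)
  have nn: "trig_val (Suc M) N (b * exp (\<i> * of_real t)) \<ge> 0" for t
    using N b unfolding nonneg_trig_def by (simp add: norm_mult)
  have "trig_val (Suc M) N (b * exp (\<i> * of_real 0)) = 0" using root by (simp add: trig_val_def)
  \<comment> \<open>The minimum kills the real part; the imaginary part vanishes because the
    function is real along the arc.\<close>
  then have "Re D = 0"
    using DERIV_local_min[OF der zero_less_one] nn by simp
  moreover have "((\<lambda>t. Im (of_real (trig_val (Suc M) N (b * exp (\<i> * of_real t))))) has_vector_derivative Im D) (at 0)"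
    by (rule bounded_linear.has_vector_derivative[OF bounded_linear_Im vd])
  then have "((\<lambda>t::real. 0::real) has_vector_derivative Im D) (at 0)" by simp
  then have "Im D = 0"
    using vector_derivative_unique_at has_vector_derivative_const by blast
  ultimately have "D = 0" by (simp add: complex_eq_iff)
  then have pd: "poly (pderiv N) b = 0" using b0 by (simp add: D_def)
  obtain N1 where N1: "N = [:-b, 1:] * N1" using root poly_eq_0_iff_dvd by blast
  have "pderiv N = [:-b, 1:] * pderiv N1 + N1"
    unfolding N1 pderiv_mult by (simp add: pderiv_pCons)
  then have "poly N1 b = 0" using pd by simp
  then obtain N2 where N2: "N1 = [:-b, 1:] * N2" using poly_eq_0_iff_dvd by blast
  \<comment> \<open>For \<open>|b| = 1\<close> the two linear factors of \<open>qfac b\<close> are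
    proportional, so a double root is a factor \<open>qfac b\<close> up to the constant
    \<open>-b\<close>.\<close>
  have lin: "[:1, -cnj b:] = smult (-cnj b) [:-b, 1:]"
    using unit_mult_cnj[OF b] by (simp add: mult.commute)
  have eq: "N = qfac b * smult (-b) N2"
    unfolding N1 N2 lin using unit_mult_cnj[OF b]
    by (simp only: mult_smult_left mult_smult_right smult_smult mult_minus_left mult_minus_right
        minus_minus mult.assoc mult.commute[of "cnj b"] smult_1_left)
  have "degree (smult (-b) N2) \<le> 2 * M"
  proof (cases "N2 = 0")
    case False
    then have "degree N = degree N2 + 2" unfolding N1 N2 by (simp only: degree_linear_mult not_False_eq_True)
    then show ?thesis using N unfolding nonneg_trig_def by simp
  qed simp
  then have "nonneg_trig M (smult (-b) N2)"
    by (rule nonneg_trig_divide[rotated]) (rule N[unfolded eq])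
  then show ?thesis using eq that by blast
qed

text \<open>Being real on the circle means being invariant under reflection; this pairs a root
  \<open>c\<close> with \<open>1 / cnj c\<close>.\<close>

lemma nonneg_trig_self_sharp:
  assumes "nonneg_trig M N" shows "sharp (2 * M) N = N"
proof (rule poly_eq_circle)
  fix z :: complex assume z: "norm z = 1"
  have zz: "z ^ M * cnj z ^ M = 1"
    using unit_mult_cnj[OF z] by (metis power_mult_distrib power_one)
  have "poly (sharp (2 * M) N) z = z ^ (2 * M) * cnj (z ^ M * of_real (trig_val M N z))"
    using assms z unfolding nonneg_trig_def by (metis poly_sharp_circle)
  also have "\<dots> = z ^ M * (z ^ M * cnj z ^ M) * of_real (trig_val M N z)"
    unfolding mult_2 power_add by simp
  also have "\<dots> = poly N z" unfolding zz using assms z unfolding nonneg_trig_def by simp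
  finally show "poly (sharp (2 * M) N) z = poly N z" .
qed

text \<open>Roots come in pairs symmetric in the circle: \<open>0\<close> with a drop in degree, a
  circle point with itself, \<open>c\<close> with \<open>1 / cnj c\<close>. Each pair makes one
  factor \<open>qfac\<close>, named after its member in the closed disc, and the induction removes
  one pair at a time.\<close>

theorem Fejer_Riesz:
  assumes "nonneg_trig M N" "N \<noteq> 0"
  shows "\<exists>r b. r > 0 \<and> (\<forall>k. norm (b k) \<le> 1) \<and>
           N = smult (of_real r) (\<Prod>k=1..M. qfac (b k))"
  using assms
proof (induction M arbitrary: N)
  case 0
  then obtain c where c: "N = [:c:]"
    unfolding nonneg_trig_def using degree_eq_zeroE by auto
  have "trig_val 0 N 1 \<ge> 0 \<and> poly N 1 = 1 ^ 0 * of_real (trig_val 0 N 1)"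
    using 0(1) norm_one unfolding nonneg_trig_def by blast
  moreover have "poly N 1 = c" by (simp add: c)
  ultimately obtain x where x: "x \<ge> 0" "c = of_real x" by auto
  have "c \<noteq> 0" using 0(2) c by simp
  then show ?case using x
    by (intro exI[of _ x] exI[of _ "\<lambda>_. 0"]) (auto simp: c less_le)
next
  case (Suc M)
  have "\<exists>b N'. norm b \<le> 1 \<and> N = qfac b * N' \<and> nonneg_trig M N'"
  proof (cases "poly N 0 = 0")
    case True
    then obtain N' where N': "N = pCons 0 N'" by (metis pCons_cases poly_pCons add.right_neutral mult_zero_left)
    \<comment> \<open>A root at \<open>0\<close> makes the top coefficient vanish; without this the
      quotient could have degree \<open>2 * M + 1\<close>.\<close>
    have "coeff N (2 * Suc M) = cnj (coeff N 0)"
      using nonneg_trig_self_sharp[OF Suc.prems(1)] coeff_sharp[of "2 * Suc M" N "2 * Suc M"] by simp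
    then have "coeff N (2 * Suc M) = 0" unfolding N' by simp
    then have "degree N \<noteq> 2 * Suc M" using Suc.prems(2) leading_coeff_0_iff by metis
    then have "degree N' \<le> 2 * M"
      using Suc.prems unfolding nonneg_trig_def N' by (auto split: if_splits)
    moreover have "N = qfac 0 * N'" by (simp add: N')
    ultimately show ?thesis using nonneg_trig_divide[of M 0 N'] Suc.prems(1)
      by (intro exI[of _ 0] exI[of _ N']) simp
  next
    case False
    have "coeff N (2 * Suc M) = cnj (coeff N 0)"
      using nonneg_trig_self_sharp[OF Suc.prems(1)] coeff_sharp[of "2 * Suc M" N "2 * Suc M"] by simp
    then have "coeff N (2 * Suc M) \<noteq> 0" using False by (simp add: poly_0_coeff_0)
    then have degN: "degree N = 2 * Suc M"
      using Suc.prems(1) le_degree unfolding nonneg_trig_def by (metis order_antisym)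
    then have "\<not> constant (poly N)" by (simp add: constant_degree)
    then obtain b where b: "poly N b = 0" using fundamental_theorem_of_algebra by blast
    have b0: "b \<noteq> 0" using b False by auto
    have refl: "poly N (1 / cnj c) = 0" if "poly N c = 0" "c \<noteq> 0" for c
    proof -
      have "poly N c = c ^ (2 * Suc M) * cnj (poly N (1 / cnj c))"
        using poly_sharp[of N "2 * Suc M" c] that degN nonneg_trig_self_sharp[OF Suc.prems(1)] by simp
      then show ?thesis using that by simp
    qed
    show ?thesis
    proof (cases "norm b = 1")
      case True
      then show ?thesis using nonneg_trig_circle_root[OF Suc.prems(1) True b] by (metis order_refl)
    next
      case False
      obtain c where c: "poly N c = 0" "c \<noteq> 0" "norm c < 1"
      proof (cases "norm b < 1")
        case True then show ?thesis using that b b0 by blast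
      next
        case F: False
        have "norm (1 / cnj b) < 1" using F False b0 by (simp add: norm_divide)
        then show ?thesis using that[of "1 / cnj b"] refl[OF b b0] b0 by simp
      qed
      obtain N1 where N1: "N = [:-c, 1:] * N1" using c poly_eq_0_iff_dvd by blast
      \<comment> \<open>Being different from \<open>c\<close>, the reflected point remains a root
        after division by \<open>z - c\<close>.\<close>
      have "1 / cnj c \<noteq> c"
      proof
        assume "1 / cnj c = c"
        then have "norm (1 / cnj c) = norm c" by simp
        then have "norm c * norm c = 1" using c(2) by (simp add: norm_divide field_simps)
        then show False using c(3) mult_strict_mono[of "norm c" 1 "norm c" 1] by simp
      qed
      moreover have "(1 / cnj c - c) * poly N1 (1 / cnj c) = 0"
        using refl[OF c(1,2)] unfolding N1 by (simp add: algebra_simps)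
      ultimately have "poly N1 (1 / cnj c) = 0" by simp
      then obtain N2 where N2: "N1 = [:-(1 / cnj c), 1:] * N2" using poly_eq_0_iff_dvd by blast
      have lin: "[:1, -cnj c:] = smult (-cnj c) [:-(1 / cnj c), 1:]" using c(2) by simp
      have "qfac c * smult (- 1 / cnj c) N2
          = smult ((- 1 / cnj c) * (- cnj c)) ([:-c, 1:] * ([:-(1 / cnj c), 1:] * N2))"
        unfolding lin by (simp only: mult_smult_left mult_smult_right smult_smult mult.assoc)
      also have "(- 1 / cnj c) * (- cnj c) = 1" using c(2) by simp
      finally have eq: "N = qfac c * smult (- 1 / cnj c) N2"
        unfolding N1 N2 by (simp only: smult_1_left)
      have "N2 \<noteq> 0" using Suc.prems(2) N1 N2 by auto
      then have "degree N = degree N2 + 2" unfolding N1 N2 by (simp only: degree_linear_mult not_False_eq_True)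
      then have "degree (smult (- 1 / cnj c) N2) \<le> 2 * M" using degN by simp
      then have "nonneg_trig M (smult (- 1 / cnj c) N2)"
        by (rule nonneg_trig_divide[rotated]) (rule Suc.prems(1)[unfolded eq])
      then show ?thesis using eq less_imp_le[OF c(3)] by blast
    qed
  qed
  then obtain b N' where bN: "norm b \<le> 1" "N = qfac b * N'" "nonneg_trig M N'" by blast
  then have "N' \<noteq> 0" using Suc.prems(2) by auto
  then obtain r b' where rb: "r > 0" "\<forall>k. norm (b' k) \<le> 1"
     "N' = smult (of_real r) (\<Prod>k=1..M. qfac (b' k))"
    using Suc.IH bN(3) by blast
  show ?case
  proof (intro exI conjI)
    show "r > 0" by fact
    show "\<forall>k. norm ((b'(Suc M := b)) k) \<le> 1" using rb bN by simp
    have "(\<Prod>k=1..M. qfac ((b'(Suc M := b)) k)) = (\<Prod>k=1..M. qfac (b' k))"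
      by (intro prod.cong) auto
    moreover have "(\<Prod>k=1..Suc M. qfac ((b'(Suc M := b)) k)) = qfac b * (\<Prod>k=1..M. qfac ((b'(Suc M := b)) k))"
      by (subst prod.nat_ivl_Suc', simp, simp only: fun_upd_same)
    ultimately show "N = smult (of_real r) (\<Prod>k=1..Suc M. qfac ((b'(Suc M := b)) k))"
      unfolding bN(2) rb(3) by (simp only: mult_smult_right)
  qed
qed

lemma trig_val_sum: "trig_val M (\<Sum>j\<in>A. N j) z = (\<Sum>j\<in>A. trig_val M (N j) z)"
  by (simp add: trig_val_def poly_sum sum_distrib_left Re_sum)

lemma nonneg_trig_sum:
  assumes "\<And>j. j \<in> A \<Longrightarrow> nonneg_trig M (N j)"
  shows "nonneg_trig M (\<Sum>j\<in>A. N j)"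
  unfolding nonneg_trig_def
proof (intro conjI allI impI)
  show "degree (\<Sum>j\<in>A. N j) \<le> 2 * M"
    by (cases "finite A", rule degree_sum_le) (use assms in \<open>auto simp: nonneg_trig_def\<close>)
  fix z :: complex assume z: "norm z = 1"
  show "trig_val M (\<Sum>j\<in>A. N j) z \<ge> 0"
    unfolding trig_val_sum by (rule sum_nonneg) (use assms z in \<open>auto simp: nonneg_trig_def\<close>)
  have "poly (\<Sum>j\<in>A. N j) z = (\<Sum>j\<in>A. z ^ M * of_real (trig_val M (N j) z))"
    unfolding poly_sum by (rule sum.cong) (use assms z in \<open>auto simp: nonneg_trig_def\<close>)
  then show "poly (\<Sum>j\<in>A. N j) z = z ^ M * of_real (trig_val M (\<Sum>j\<in>A. N j) z)"
    by (simp add: trig_val_sum sum_distrib_left)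
qed

lemma prod_qfac_upd:
  "(\<Prod>k=1..Suc M. qfac ((b(Suc M := c)) k)) = qfac c * (\<Prod>k=1..M. qfac (b k))"
proof -
  have "(\<Prod>k=1..M. qfac ((b(Suc M := c)) k)) = (\<Prod>k=1..M. qfac (b k))"
    by (intro prod.cong) auto
  moreover have "(\<Prod>k=1..Suc M. qfac ((b(Suc M := c)) k)) = qfac c * (\<Prod>k=1..M. qfac ((b(Suc M := c)) k))"
    by (subst prod.nat_ivl_Suc', simp, simp only: fun_upd_same)
  ultimately show ?thesis by (simp only:)
qed

text \<open>A circle zero of the sum is a zero of every nonnegative summand, so such zeros are split
  off first and under a common index \<open>k\<close>. Once the sum has none left, the factors may
  be chosen independently. The matching lets these factors cancel later in the quotients.\<close>

lemma Fejer_Riesz_family: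
  fixes N :: "'j::finite \<Rightarrow> complex poly"
  assumes "\<And>j. nonneg_trig M (N j)" "(\<Sum>j\<in>UNIV. N j) \<noteq> 0"
  shows "\<exists>r r0 b b0. r0 > 0 \<and> (\<forall>j. r j \<ge> 0) \<and>
    (\<forall>k\<in>{1..M}. norm (b0 k) \<le> 1 \<and> (\<forall>j. norm (b j k) \<le> 1) \<and>
       (norm (b0 k) = 1 \<longrightarrow> (\<forall>j. b j k = b0 k))) \<and>
    (\<forall>j. N j = smult (of_real (r j)) (\<Prod>k=1..M. qfac (b j k))) \<and>
    (\<Sum>j\<in>UNIV. N j) = smult (of_real r0) (\<Prod>k=1..M. qfac (b0 k))"
  using assms
proof (induction M arbitrary: N)
  case (Suc M)
  define N0 where "N0 = (\<Sum>j\<in>UNIV. N j)"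
  have N0: "nonneg_trig (Suc M) N0" unfolding N0_def using Suc.prems by (intro nonneg_trig_sum)
  show ?case
  proof (cases "\<exists>c. norm c = 1 \<and> poly N0 c = 0")
    case True
    then obtain c where c: "norm c = 1" "poly N0 c = 0" by blast
    have "poly (N j) c = 0" for j
    proof -
      have "(\<Sum>j\<in>UNIV. trig_val (Suc M) (N j) c) = 0"
        using c unfolding N0_def trig_val_sum[symmetric] by (simp add: trig_val_def)
      then have "trig_val (Suc M) (N j) c = 0"
        by (subst (asm) sum_nonneg_eq_0_iff) (use Suc.prems(1) c in \<open>auto simp: nonneg_trig_def\<close>)
      then show ?thesis using Suc.prems(1)[of j] c unfolding nonneg_trig_def by force
    qed
    then have "\<forall>j. \<exists>N'. N j = qfac c * N' \<and> nonneg_trig M N'"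
      using nonneg_trig_circle_root[OF Suc.prems(1) c(1)] by metis
    then obtain N' where N': "\<And>j. N j = qfac c * N' j" "\<And>j. nonneg_trig M (N' j)" by metis
    have sum: "N0 = qfac c * (\<Sum>j\<in>UNIV. N' j)"
      unfolding N0_def sum_distrib_left by (rule sum.cong[OF refl]) (rule N'(1))
    then have nz: "(\<Sum>j\<in>UNIV. N' j) \<noteq> 0"
      using Suc.prems(2) unfolding N0_def[symmetric] by (metis mult_zero_right)
    obtain r r0 b b0 where *: "r0 > 0" "\<forall>j. r j \<ge> 0"
      "\<forall>k\<in>{1..M}. norm (b0 k) \<le> 1 \<and> (\<forall>j. norm (b j k) \<le> 1) \<and>
        (norm (b0 k) = 1 \<longrightarrow> (\<forall>j. b j k = b0 k))"
      "\<forall>j. N' j = smult (of_real (r j)) (\<Prod>k=1..M. qfac (b j k))"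
      "(\<Sum>j\<in>UNIV. N' j) = smult (of_real r0) (\<Prod>k=1..M. qfac (b0 k))"
      using Suc.IH[OF N'(2) nz] by blast
    show ?thesis
    proof (intro exI conjI allI)
      show "\<forall>k\<in>{1..Suc M}. norm ((b0(Suc M := c)) k) \<le> 1 \<and>
           (\<forall>j. norm (((\<lambda>j. (b j)(Suc M := c)) j) k) \<le> 1) \<and>
           (norm ((b0(Suc M := c)) k) = 1 \<longrightarrow> (\<forall>j. ((\<lambda>j. (b j)(Suc M := c)) j) k = (b0(Suc M := c)) k))"
        using *(3) c by (auto simp: le_Suc_eq)
      show "N j = smult (of_real (r j)) (\<Prod>k=1..Suc M. qfac (((\<lambda>j. (b j)(Suc M := c)) j) k))" for j
        unfolding prod_qfac_upd N'(1)[of j] *(4)[rule_format, of j] by (simp only: mult_smult_right)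
      show "(\<Sum>j\<in>UNIV. N j) = smult (of_real r0) (\<Prod>k=1..Suc M. qfac ((b0(Suc M := c)) k))"
        unfolding prod_qfac_upd N0_def[symmetric] sum *(5) by (simp only: mult_smult_right)
    qed (use * in auto)
  next
    case False
    have "\<forall>j. \<exists>r b. r \<ge> 0 \<and> (\<forall>k. norm (b k) \<le> 1) \<and>
           N j = smult (of_real r) (\<Prod>k=1..Suc M. qfac (b k))"
    proof
      fix j show "\<exists>r b. r \<ge> 0 \<and> (\<forall>k. norm (b k) \<le> 1) \<and>
           N j = smult (of_real r) (\<Prod>k=1..Suc M. qfac (b k))"
    proof (cases "N j = 0")
      case True
      then show ?thesis
        by (intro exI[of _ 0] exI[of _ "\<lambda>_. 0"] conjI allI) (simp_all only: of_real_0 smult_0_left, simp_all)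
    next
      case False
      then show ?thesis using Fejer_Riesz[OF Suc.prems(1) False] less_imp_le by blast
    qed
    qed
    from choice[OF this] obtain r where "\<forall>j. \<exists>b. r j \<ge> 0 \<and> (\<forall>k. norm (b k) \<le> 1) \<and>
           N j = smult (of_real (r j)) (\<Prod>k=1..Suc M. qfac (b k))" by (rule exE)
    from choice[OF this] obtain b where "\<forall>j. r j \<ge> 0 \<and> (\<forall>k. norm (b j k) \<le> 1) \<and>
           N j = smult (of_real (r j)) (\<Prod>k=1..Suc M. qfac (b j k))" by (rule exE)
    then have rb: "\<And>j. r j \<ge> 0" "\<And>j k. norm (b j k) \<le> 1"
      "\<And>j. N j = smult (of_real (r j)) (\<Prod>k=1..Suc M. qfac (b j k))" by blast+
    obtain r0 b0 where b0: "r0 > 0" "\<And>k. norm (b0 k) \<le> 1"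
      "N0 = smult (of_real r0) (\<Prod>k=1..Suc M. qfac (b0 k))"
      using Fejer_Riesz[OF N0] Suc.prems(2) unfolding N0_def[symmetric] by blast
    \<comment> \<open>No \<open>b0 k\<close> lies on the circle in this case, so the matching clause
      holds vacuously.\<close>
    have "norm (b0 k) \<noteq> 1" if "k \<in> {1..Suc M}" for k
    proof
      assume "norm (b0 k) = 1"
      moreover have "poly N0 (b0 k) = 0"
        unfolding b0(3) poly_smult poly_prod using that
        by (intro mult_eq_0_iff[THEN iffD2] disjI2 prod_zero bexI[of _ k]) auto
      ultimately show False using False by blast
    qed
    show ?thesis
    proof (intro exI conjI ballI allI impI)
      show "N j = smult (of_real (r j)) (\<Prod>k=1..Suc M. qfac (b j k))" for j by (rule rb(3))
      show "(\<Sum>j\<in>UNIV. N j) = smult (of_real r0) (\<Prod>k=1..Suc M. qfac (b0 k))"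
        using b0(3) unfolding N0_def .
      show "b j k = b0 k" if "k \<in> {1..Suc M}" "norm (b0 k) = 1" for j k
        using \<open>\<And>k. k \<in> {1..Suc M} \<Longrightarrow> norm (b0 k) \<noteq> 1\<close> that by blast
    qed (use rb b0 in auto)
  qed
next
  case 0
  define N0 where "N0 = (\<Sum>j\<in>UNIV. N j)"
  have N0: "nonneg_trig 0 N0" unfolding N0_def using 0 by (intro nonneg_trig_sum)
  have "\<exists>r. r \<ge> 0 \<and> N j = smult (of_real r) 1" for j
  proof (cases "N j = 0")
    case False
    then show ?thesis using Fejer_Riesz[OF 0(1) False] by (auto intro: less_imp_le)
  qed auto
  then obtain r where r: "\<And>j. r j \<ge> 0" "\<And>j. N j = smult (of_real (r j)) 1" by metis
  obtain r0 where "r0 > 0" "N0 = smult (of_real r0) 1"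
    using Fejer_Riesz[OF N0] 0(2) unfolding N0_def[symmetric] by auto
  then show ?case using r unfolding N0_def
    by (intro exI[of _ r] exI[of _ r0] exI[of _ "\<lambda>_ _. 0"] exI[of _ "\<lambda>_. 0"]) simp
qed

text \<open>A polynomial with the modulus of \<open>\<Prod>(z - b k)\<close> on the circle satisfies
  \<open>A * sharp M A = \<Prod>(z - b k) (1 - cnj (b k) z)\<close>, so each \<open>b k\<close> is a root of \<open>A\<close> or of \<open>sharp M A\<close>.\<close>

lemma circle_modulus_factor:
  assumes "degree A \<le> M" "\<And>k. k \<in> {1..M} \<Longrightarrow> norm (b k) \<le> 1"
    and "\<And>z. norm z = 1 \<Longrightarrow> norm (poly A z) = (\<Prod>k=1..M. norm (z - b k))"
  shows "\<exists>u r. norm u = 1 \<and> (\<forall>k. r k \<in> {0, 1::nat}) \<and>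
     A = smult u (\<Prod>k=1..M. [:-b k, 1:] ^ r k * [:1, -cnj (b k):] ^ (1 - r k))"
  using assms
proof (induction M arbitrary: A)
  case 0
  then obtain c where c: "A = [:c:]" using degree_eq_zeroE by auto
  then have "norm c = 1" using 0(3)[of 1] by simp
  then show ?case using c by (intro exI[of _ c] exI[of _ "\<lambda>_. 0"]) simp
next
  case (Suc M)
  define c where "c = b (Suc M)"
  have c1: "norm c \<le> 1" using Suc.prems(2)[of "Suc M"] by (simp add: c_def)
  have prodS: "(\<Prod>k=1..Suc M. f k) = f (Suc M) * (\<Prod>k=1..M. f k)" for f :: "nat \<Rightarrow> 'b::comm_monoid_mult"
    by (subst prod.nat_ivl_Suc') simp_all
  \<comment> \<open>Dividing the modulus identity by \<open>|z - c|\<close> is possible off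
    \<open>c\<close>; the value at \<open>c\<close> follows by continuity.\<close>
  have peel: "norm (poly B z) = (\<Prod>k=1..M. norm (z - b k))"
    if "\<And>z. norm z = 1 \<Longrightarrow> norm (z - c) * norm (poly B z) = (\<Prod>k=1..Suc M. norm (z - b k))"
      and "norm z = 1" for B z
  proof (rule circle_eq_extend[where F = "{c}" and z = z])
    fix z :: complex assume z: "norm z = 1" "z \<notin> {c}"
    have "norm (z - c) * norm (poly B z) = norm (z - c) * (\<Prod>k=1..M. norm (z - b k))"
      using that(1)[OF z(1)] unfolding prodS c_def .
    then show "norm (poly B z) = (\<Prod>k=1..M. norm (z - b k))" using z by simp
  qed (use that in \<open>auto intro!: continuous_intros\<close>)
  \<comment> \<open>The exponent \<open>s\<close> records whether the last factor enters as
    \<open>z - c\<close> or in the reflected form \<open>1 - cnj c * z\<close>.\<close>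
  have fin: ?case if u: "norm u = 1" "\<forall>k. r k \<in> {0, 1::nat}" and s: "s \<in> {0, 1::nat}"
    and "A = [:-c, 1:] ^ s * [:1, -cnj c:] ^ (1 - s) *
       smult u (\<Prod>k=1..M. [:-b k, 1:] ^ r k * [:1, -cnj (b k):] ^ (1 - r k))" for u r s
  proof (intro exI conjI)
    have "(\<Prod>k=1..M. [:-b k, 1:] ^ (r(Suc M := s)) k * [:1, -cnj (b k):] ^ (1 - (r(Suc M := s)) k))
        = (\<Prod>k=1..M. [:-b k, 1:] ^ r k * [:1, -cnj (b k):] ^ (1 - r k))"
      by (intro prod.cong) auto
    then show "A = smult u (\<Prod>k=1..Suc M. [:-b k, 1:] ^ (r(Suc M := s)) k *
        [:1, -cnj (b k):] ^ (1 - (r(Suc M := s)) k))"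
      unfolding prodS fun_upd_same that(4) c_def by (simp only: mult_smult_right)
  qed (use u s in auto)
  have "poly A c * poly (sharp (Suc M) A) c = 0"
  proof -
    have "A * sharp (Suc M) A = (\<Prod>k=1..Suc M. qfac (b k))"
    proof (rule poly_eq_circle)
      fix z :: complex assume z: "norm z = 1"
      have "poly (A * sharp (Suc M) A) z = z ^ Suc M * of_real ((norm (poly A z))\<^sup>2)"
        using poly_sharp_circle[OF Suc.prems(1) z] complex_norm_square[of "poly A z"] by simp
      also have "\<dots> = (\<Prod>k=1..Suc M. z * of_real ((norm (z - b k))\<^sup>2))"
        unfolding Suc.prems(3)[OF z] prod.distrib prod_power_distrib of_real_prod prod_constant card_atLeastAtMost
        by simp
      also have "\<dots> = poly (\<Prod>k=1..Suc M. qfac (b k)) z"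
        unfolding poly_prod poly_qfac circle_factor[OF z] ..
      finally show "poly (A * sharp (Suc M) A) z = poly (\<Prod>k=1..Suc M. qfac (b k)) z" .
    qed
    then have "poly A c * poly (sharp (Suc M) A) c = poly (\<Prod>k=1..Suc M. qfac (b k)) c"
      by (metis poly_mult)
    also have "\<dots> = 0" unfolding poly_prod poly_qfac unfolding prodS c_def by simp
    finally show ?thesis .
  qed
  then consider "poly A c = 0" | "poly (sharp (Suc M) A) c = 0" by auto
  then show ?case
  proof cases
    case 1
    then obtain B where B: "A = [:-c, 1:] * B" using poly_eq_0_iff_dvd by blast
    have "degree B \<le> M"
      by (cases "B = 0") (use Suc.prems(1) degree_linear_mult(2)[of B "-c"] B in auto)
    moreover have "norm (poly B z) = (\<Prod>k=1..M. norm (z - b k))" if "norm z = 1" for z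
    proof (rule peel[OF _ that])
      fix z :: complex assume z: "norm z = 1"
      have "poly A z = (z - c) * poly B z" by (simp add: B algebra_simps)
      then show "norm (z - c) * norm (poly B z) = (\<Prod>k=1..Suc M. norm (z - b k))"
        using Suc.prems(3)[OF z] by (simp only: norm_mult)
    qed
    ultimately obtain u r where ur: "norm u = 1" "\<forall>k. r k \<in> {0, 1::nat}"
       "B = smult u (\<Prod>k=1..M. [:-b k, 1:] ^ r k * [:1, -cnj (b k):] ^ (1 - r k))"
      using Suc.IH[of B] Suc.prems(2) by auto
    show ?thesis by (rule fin[OF ur(1,2), of 1]) (simp_all only: B ur(3), simp_all)
  next
    case 2
    then obtain C where C: "sharp (Suc M) A = [:-c, 1:] * C" using poly_eq_0_iff_dvd by blast
    define B where "B = sharp M C"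
    have dC: "degree C \<le> M"
    proof (cases "C = 0")
      case False
      have "Suc (degree C) = degree (sharp (Suc M) A)"
        unfolding C by (simp only: degree_linear_mult[OF False])
      then show ?thesis using degree_sharp[of "Suc M" A] by simp
    qed simp
    \<comment> \<open>Reflecting twice gives back \<open>A\<close> and turns the root factor
      \<open>z - c\<close> of \<open>sharp (Suc M) A\<close> into
      \<open>1 - cnj c * z\<close>.\<close>
    have A: "A = [:1, -cnj c:] * B"
    proof (rule poly_eq_circle)
      fix z :: complex assume z: "norm z = 1"
      have "poly A z = poly (sharp (Suc M) (sharp (Suc M) A)) z"
        using sharp_sharp[OF Suc.prems(1)] by simp
      also have "\<dots> = z ^ Suc M * cnj ((z - c) * poly C z)"
        by (subst poly_sharp_circle[OF degree_sharp z]) (simp add: C algebra_simps)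
      also have "\<dots> = (z * cnj (z - c)) * (z ^ M * cnj (poly C z))" by simp
      also have "z * cnj (z - c) = 1 - cnj c * z"
        using unit_mult_cnj[OF z] by (simp add: algebra_simps)
      also have "z ^ M * cnj (poly C z) = poly B z"
        unfolding B_def by (rule poly_sharp_circle[OF dC z, symmetric])
      finally show "poly A z = poly ([:1, -cnj c:] * B) z" by (simp add: algebra_simps)
    qed
    have "degree B \<le> M" unfolding B_def by (rule degree_sharp)
    moreover have "norm (poly B z) = (\<Prod>k=1..M. norm (z - b k))" if "norm z = 1" for z
    proof (rule peel[OF _ that])
      fix z :: complex assume z: "norm z = 1"
      have "poly A z = (1 - cnj c * z) * poly B z" by (simp add: A algebra_simps)
      then show "norm (z - c) * norm (poly B z) = (\<Prod>k=1..Suc M. norm (z - b k))"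
        using Suc.prems(3)[OF z] circle_norm_reflect[OF z, of c] by (simp only: norm_mult)
    qed
    ultimately obtain u r where ur: "norm u = 1" "\<forall>k. r k \<in> {0, 1::nat}"
       "B = smult u (\<Prod>k=1..M. [:-b k, 1:] ^ r k * [:1, -cnj (b k):] ^ (1 - r k))"
      using Suc.IH[of B] Suc.prems(2) by auto
    show ?thesis by (rule fin[OF ur(1,2), of 0]) (simp_all only: A ur(3), simp_all)
  qed
qed

section \<open>Blaschke products from polynomial identities in the disc\<close>

lemma ball_diff_closure:
  assumes "finite F" shows "closure (ball (0::complex) 1 - F) = cball 0 1"
proof -
  have "ball (0::complex) 1 \<subseteq> closure (ball 0 1 - F)"
  proof
    fix z :: complex assume "z \<in> ball 0 1"
    then have "z islimpt ball 0 1" by (intro interior_limit_point) (simp add: interior_open)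
    then have "z islimpt ((ball 0 1 - F) \<union> F)" by (rule islimpt_subset) auto
    then show "z \<in> closure (ball 0 1 - F)"
      using islimpt_Un islimpt_finite[OF assms] unfolding closure_def by blast
  qed
  then have "closure (ball (0::complex) 1) \<subseteq> closure (ball 0 1 - F)"
    by (rule closure_minimal) simp
  moreover have "closure (ball (0::complex) 1 - F) \<subseteq> closure (ball 0 1)" by (rule closure_mono) auto
  ultimately show ?thesis by simp
qed

text \<open>Each \<open>b k\<close> is a root of \<open>Q\<close>: inside the disc by evaluating the
  identity, on the circle, where \<open>q\<close> has no value, by the modulus condition. So the
  factors \<open>z - b k\<close> can be cancelled one by one.\<close>

lemma divide_common_roots:
  fixes q :: "complex \<Rightarrow> complex"
  assumes "finite K" "\<And>k. k \<in> K \<Longrightarrow> norm (b k) \<le> 1" "continuous_on (ball 0 1) q" "continuous_on (sphere 0 1) E"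
    and "\<And>z. norm z < 1 \<Longrightarrow> q z * (\<Prod>k\<in>K. z - b k) * poly C z = poly Q z"
    and "\<And>z. norm z = 1 \<Longrightarrow> norm (poly Q z) = (\<Prod>k\<in>K. norm (z - b k)) * E z"
  shows "\<exists>A. Q = (\<Prod>k\<in>K. [:-b k, 1:]) * A \<and> (\<forall>z. norm z < 1 \<longrightarrow> q z * poly C z = poly A z) \<and>
     (\<forall>z. norm z = 1 \<longrightarrow> norm (poly A z) = E z)"
  using assms
proof (induction K arbitrary: Q rule: finite_induct)
  case empty
  then show ?case by (intro exI[of _ Q]) simp
next
  case (insert k K)
  have bk: "norm (b k) \<le> 1" using insert.prems by simp
  have "poly Q (b k) = 0"
  proof (cases "norm (b k) = 1")
    case True
    then have "norm (poly Q (b k)) = 0" using insert.prems(5)[OF True] insert.hyps by simp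
    then show ?thesis by simp
  next
    case False
    then show ?thesis using insert.prems(4)[of "b k"] insert.hyps bk by simp
  qed
  then obtain Q' where Q': "Q = [:-b k, 1:] * Q'" using poly_eq_0_iff_dvd by blast
  have "q z * (\<Prod>k\<in>K. z - b k) * poly C z = poly Q' z" if "norm z < 1" for z
  proof -
    have *: "q z * (\<Prod>k\<in>K. z - b k) * poly C z - poly Q' z \<in> {0}" if "z \<in> ball 0 1 - {b k}" for z
    proof -
      have "(z - b k) * (q z * (\<Prod>k\<in>K. z - b k) * poly C z) = (z - b k) * poly Q' z"
        using insert.prems(4)[of z] insert.hyps that by (simp add: Q' algebra_simps)
      then show ?thesis using that by simp
    qed
    have "isCont (\<lambda>z. q z * (\<Prod>k\<in>K. z - b k) * poly C z - poly Q' z) z" if "norm z < 1" for z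
      using that insert.prems(2) continuous_on_interior[of "ball 0 1" q z]
      by (intro continuous_intros) (auto simp: interior_open)
    then have cont: "((\<lambda>z. q z * (\<Prod>k\<in>K. z - b k) * poly C z - poly Q' z) \<longlongrightarrow>
        (q z * (\<Prod>k\<in>K. z - b k) * poly C z - poly Q' z)) (at z)"
      using that by (simp add: isCont_def)
    have "eventually (\<lambda>w. w \<in> ball 0 1 - {b k}) (at z)"
    proof -
      have "eventually (\<lambda>w. w \<in> ball 0 1) (at z)"
        using that by (intro eventually_at_in_open') auto
      moreover have "eventually (\<lambda>w. w \<noteq> b k) (at z)"
        by (metis eventually_neq_at_within)
      ultimately show ?thesis by eventually_elim auto
    qed
    then have "eventually (\<lambda>w. q w * (\<Prod>k\<in>K. w - b k) * poly C w - poly Q' w = 0) (at z)"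
      by eventually_elim (use * in auto)
    then have "((\<lambda>z. q z * (\<Prod>k\<in>K. z - b k) * poly C z - poly Q' z) \<longlongrightarrow> 0) (at z)"
      by (rule tendsto_eventually)
    then show ?thesis using tendsto_unique[OF _ cont] by force
  qed
  moreover have "norm (poly Q' z) = (\<Prod>k\<in>K. norm (z - b k)) * E z" if "norm z = 1" for z
  proof (rule circle_eq_extend[where F = "{b k}" and z = z])
    fix z :: complex assume z: "norm z = 1" "z \<notin> {b k}"
    have "poly Q z = (z - b k) * poly Q' z" by (simp add: Q' algebra_simps)
    then have "norm (z - b k) * norm (poly Q' z) = norm (poly Q z)" by (simp only: norm_mult)
    then show "norm (poly Q' z) = (\<Prod>k\<in>K. norm (z - b k)) * E z"
      using insert.prems(5)[OF z(1)] insert.hyps z by simp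
  qed (use that insert.prems in \<open>auto intro!: continuous_intros\<close>)
  ultimately obtain A where A: "Q' = (\<Prod>k\<in>K. [:-b k, 1:]) * A"
     "\<forall>z. norm z < 1 \<longrightarrow> q z * poly C z = poly A z" "\<forall>z. norm z = 1 \<longrightarrow> norm (poly A z) = E z"
    using insert.IH[of Q'] insert.prems by auto
  show ?case
    using A(2,3)
    by (intro exI[of _ A] conjI) (simp_all only: Q' A(1) prod.insert[OF insert.hyps] mult.assoc)
qed

text \<open>After cancelling all \<open>z - b k\<close> there remains
  \<open>A = q * \<Prod>(1 - cnj (b k) * z)\<close>, of degree at most \<open>M\<close> and with
  modulus \<open>\<Prod>|z - b k|\<close> on the circle. The list of such polynomials shows that
  \<open>q\<close> keeps a Moebius factor exactly for the indices with
  \<open>r k = 1\<close>.\<close>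

theorem blaschke_from_quotient:
  fixes q :: "complex \<Rightarrow> complex"
  assumes "continuous_on (ball 0 1) q" "degree Q \<le> 2 * M" "\<And>k. k \<in> {1..M} \<Longrightarrow> norm (b k) \<le> 1"
    and eq: "\<And>z. norm z < 1 \<Longrightarrow> q z * (\<Prod>k=1..M. (z - b k) * (1 - cnj (b k) * z)) = poly Q z"
    and mod: "\<And>z. norm z = 1 \<Longrightarrow> norm (poly Q z) = (\<Prod>k=1..M. (norm (z - b k))\<^sup>2)"
  shows "\<exists>u r. norm u = 1 \<and> (\<forall>k. r k \<in> {0, 1::nat}) \<and>
     (\<forall>z. norm z < 1 \<longrightarrow> q z = u * (\<Prod>k=1..M. ((z - b k) / (1 - cnj (b k) * z)) ^ r k))"
proof -
  define C where "C = (\<Prod>k=1..M. [:1, -cnj (b k):])"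
  have pC: "poly C z = (\<Prod>k=1..M. 1 - cnj (b k) * z)" for z
    by (simp add: C_def poly_prod mult.commute)
  have "\<exists>A. Q = (\<Prod>k=1..M. [:-b k, 1:]) * A \<and> (\<forall>z. norm z < 1 \<longrightarrow> q z * poly C z = poly A z) \<and>
     (\<forall>z. norm z = 1 \<longrightarrow> norm (poly A z) = (\<Prod>k=1..M. norm (z - b k)))"
  proof (rule divide_common_roots)
    show "q z * (\<Prod>k=1..M. z - b k) * poly C z = poly Q z" if "norm z < 1" for z
      using eq[OF that] unfolding pC prod.distrib mult.assoc .
    show "norm (poly Q z) = (\<Prod>k=1..M. norm (z - b k)) * (\<Prod>k=1..M. norm (z - b k))"
      if "norm z = 1" for z
      using mod[OF that] unfolding power2_eq_square prod.distrib .
  qed (use assms in \<open>auto intro!: continuous_intros\<close>)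
  then obtain A where A: "Q = (\<Prod>k=1..M. [:-b k, 1:]) * A" "\<And>z. norm z < 1 \<Longrightarrow> q z * poly C z = poly A z"
     "\<And>z. norm z = 1 \<Longrightarrow> norm (poly A z) = (\<Prod>k=1..M. norm (z - b k))"
    by blast
  have "degree A \<le> M"
  proof (cases "A = 0")
    case False
    have nz: "(\<Prod>k=1..M. [:-b k, 1:]) \<noteq> 0" by (simp add: prod_zero_iff)
    have "degree Q = degree (\<Prod>k=1..M. [:-b k, 1:]) + degree A"
      unfolding A(1) by (rule degree_mult_eq[OF nz False])
    moreover have "degree (\<Prod>k=1..M. [:-b k, 1:]) = M"
      by (subst degree_prod_eq_sum_degree) auto
    ultimately show ?thesis using assms(2) by simp
  qed simp
  from circle_modulus_factor[OF this assms(3) A(3)]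
  obtain u r where ur: "norm u = 1" "\<forall>k. r k \<in> {0, 1::nat}"
    "A = smult u (\<Prod>k=1..M. [:-b k, 1:] ^ r k * [:1, -cnj (b k):] ^ (1 - r k))" by blast
  have "q z = u * (\<Prod>k=1..M. ((z - b k) / (1 - cnj (b k) * z)) ^ r k)" if z: "norm z < 1" for z
  proof -
    have nz: "1 - cnj (b k) * z \<noteq> 0" if "k \<in> {1..M}" for k
      using one_minus_cnj_mult_neq_0[of "b k" z] assms(3)[OF that] z by auto
    then have C0: "poly C z \<noteq> 0" by (auto simp: pC prod_zero_iff)
    have "poly A z = u * (\<Prod>k=1..M. (z - b k) ^ r k * (1 - cnj (b k) * z) ^ (1 - r k))"
      unfolding ur(3) by (simp add: poly_prod poly_power mult.commute)
    also have "(\<Prod>k=1..M. (z - b k) ^ r k * (1 - cnj (b k) * z) ^ (1 - r k))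
       = (\<Prod>k=1..M. ((z - b k) / (1 - cnj (b k) * z)) ^ r k * (1 - cnj (b k) * z))"
    proof (rule prod.cong[OF refl])
      fix k assume k: "k \<in> {1..M}"
      have "r k = 0 \<or> r k = 1" using ur(2) by auto
      then show "(z - b k) ^ r k * (1 - cnj (b k) * z) ^ (1 - r k)
         = ((z - b k) / (1 - cnj (b k) * z)) ^ r k * (1 - cnj (b k) * z)"
        using nz[OF k] by auto
    qed
    also have "u * \<dots> = u * (\<Prod>k=1..M. ((z - b k) / (1 - cnj (b k) * z)) ^ r k) * poly C z"
      by (simp add: prod.distrib pC)
    finally show ?thesis using A(2)[OF z] C0 by simp
  qed
  then show ?thesis using ur by blast
qed

section \<open>Approximation and variation\<close>

text \<open>Since \<open>cnj z = 1 / z\<close>, only negative powers are in the way, and conjugation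
  inside \<open>Re\<close> makes them positive:
  \<open>Re (a * cnj z ^ n) = Re (cnj a * z ^ n)\<close>.\<close>

lemma Re_poly_shift_circle:
  "\<exists>C. \<forall>z. norm z = 1 \<longrightarrow> Re (poly P z * cnj z ^ n) = Re (poly C z)"
proof (induction P arbitrary: n)
  case 0
  then show ?case by (intro exI[of _ 0]) simp
next
  case (pCons a P)
  show ?case
  proof (cases n)
    case 0
    then show ?thesis by (intro exI[of _ "pCons a P"]) simp
  next
    case (Suc k)
    obtain C where C: "\<And>z. norm z = 1 \<Longrightarrow> Re (poly P z * cnj z ^ k) = Re (poly C z)"
      using pCons.IH by blast
    have "Re (poly (pCons a P) z * cnj z ^ n) = Re (poly (monom (cnj a) n + C) z)"
      if z: "norm z = 1" for z
    proof -
      have "poly (pCons a P) z * cnj z ^ n = cnj (cnj a * z ^ n) + (z * cnj z) * (poly P z * cnj z ^ k)"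
        by (simp add: Suc algebra_simps)
      also have "\<dots> = cnj (cnj a * z ^ n) + poly P z * cnj z ^ k"
        using unit_mult_cnj[OF z] by simp
      finally have "Re (poly (pCons a P) z * cnj z ^ n) = Re (cnj a * z ^ n) + Re (poly P z * cnj z ^ k)"
        by (simp only: plus_complex.sel cnj.sel)
      then show ?thesis unfolding C[OF z] by (simp add: poly_monom)
    qed
    then show ?thesis by blast
  qed
qed

text \<open>Products obey \<open>Re A * Re B = Re (A * B + A * cnj B) / 2\<close>, where on the
  circle \<open>cnj B\<close> is \<open>sharp n B\<close> divided by \<open>z ^ n\<close>. Through
  this the Stone-Weierstrass theorem yields real parts of polynomials, which can serve as exponents
  of variations.\<close>

lemma real_polynomial_function_circle:
  assumes "real_polynomial_function (g :: complex \<Rightarrow> real)"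
  shows "\<exists>A. \<forall>z. norm z = 1 \<longrightarrow> g z = Re (poly A z)"
  using assms
proof (induction rule: real_polynomial_function.induct)
  case (linear f)
  interpret bounded_linear f by (rule linear)
  have "f z = Re (poly [:0, Complex (f 1) (- f \<i>):] z)" for z
  proof -
    have "z = Re z *\<^sub>R 1 + Im z *\<^sub>R \<i>" by (simp add: complex_eq_iff)
    then have "f z = Re z * f 1 + Im z * f \<i>" by (metis add scaleR real_scaleR_def)
    then show ?thesis by simp
  qed
  then show ?case by blast
next
  case (const c)
  then show ?case by (intro exI[of _ "[:of_real c:]"]) simp
next
  case (add f g)
  then obtain A B where "\<And>z. norm z = 1 \<Longrightarrow> f z = Re (poly A z)" "\<And>z. norm z = 1 \<Longrightarrow> g z = Re (poly B z)"
    by blast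
  then show ?case by (intro exI[of _ "A + B"]) simp
next
  case (mult f g)
  then obtain A B where AB: "\<And>z. norm z = 1 \<Longrightarrow> f z = Re (poly A z)" "\<And>z. norm z = 1 \<Longrightarrow> g z = Re (poly B z)"
    by blast
  define n where "n = degree B"
  obtain C where C: "\<And>z. norm z = 1 \<Longrightarrow> Re (poly (A * sharp n B) z * cnj z ^ n) = Re (poly C z)"
    using Re_poly_shift_circle by blast
  have "f z * g z = Re (poly (smult (1 / 2) (A * B + C)) z)" if z: "norm z = 1" for z
  proof -
    have "z ^ n * cnj z ^ n = 1"
      using unit_mult_cnj[OF z] by (metis power_mult_distrib power_one)
    then have "poly (A * sharp n B) z * cnj z ^ n = poly A z * cnj (poly B z)"
      using poly_sharp_circle[of B n z] z by (simp add: n_def algebra_simps)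
    then have "Re (poly C z) = Re (poly A z * cnj (poly B z))" using C[OF z] by (simp only:)
    then show ?thesis using AB[OF z] by (simp add: field_simps)
  qed
  then show ?case by blast
qed

lemma circle_poly_approx:
  assumes "continuous_on (sphere 0 1) w" "e > 0"
  obtains g where "\<And>z. norm z = 1 \<Longrightarrow> \<bar>Re (poly g z) - w z\<bar> < e"
proof -
  obtain h where h: "real_polynomial_function h" "\<And>z. z \<in> sphere 0 1 \<Longrightarrow> \<bar>w z - h z\<bar> < e"
    using Stone_Weierstrass_real_polynomial_function[OF compact_sphere assms] by blast
  obtain A where "\<And>z. norm z = 1 \<Longrightarrow> h z = Re (poly A z)"
    using real_polynomial_function_circle[OF h(1)] by blast
  then have "\<bar>Re (poly A z) - w z\<bar> < e" if "norm z = 1" for z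
    using h(2)[of z] that by (simp add: abs_minus_commute)
  then show ?thesis using that by blast
qed

text \<open>Schwarz's formula: of \<open>2 * Re g = g + cnj g\<close> the first part is reproduced
  by Cauchy's formula, while the second is the conjugate of the mean of a holomorphic function and
  contributes its value at \<open>0\<close>.\<close>

lemma poly_eq_schwarz_integral:
  fixes g :: "complex poly"
  assumes z: "norm z < 1"
  shows "circ_avg (\<lambda>w. of_real (2 * Re (poly g w)) * (w / (w - z))) = poly g z + cnj (poly g 0)"
proof -
  have nz: "w - z \<noteq> 0" if "norm w = 1" for w using that z by auto
  have nz2: "1 - cnj z * w \<noteq> 0" if "norm w \<le> 1" for w
    using one_minus_cnj_mult_neq_0[of z w] z that by auto
  have c1: "continuous_on (sphere 0 1) (\<lambda>w. poly g w * w / (w - z))"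
    by (intro continuous_intros) (use nz in auto)
  have c2: "continuous_on (sphere 0 1) (\<lambda>w. poly g w / (1 - cnj z * w))"
    by (intro continuous_intros) (use nz2 in auto)
  have "circ_avg (\<lambda>w. of_real (2 * Re (poly g w)) * (w / (w - z)))
      = circ_avg (\<lambda>w. poly g w * w / (w - z) + cnj (poly g w / (1 - cnj z * w)))"
  proof (rule circ_avg_cong)
    fix w :: complex assume w: "norm w = 1"
    have "w \<noteq> 0" using w by auto
    then have "cnj w = 1 / w" using unit_mult_cnj[OF w] by (simp add: eq_divide_eq mult.commute)
    then have "cnj (1 - cnj z * w) = (w - z) / w" using \<open>w \<noteq> 0\<close> by (simp add: diff_divide_distrib)
    then have "cnj (poly g w / (1 - cnj z * w)) = cnj (poly g w) * (w / (w - z))"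
      by (simp only: complex_cnj_divide divide_divide_eq_right times_divide_eq_right)
    moreover have "of_real (2 * Re (poly g w)) = poly g w + cnj (poly g w)"
      by (rule complex_add_cnj[symmetric])
    ultimately show "of_real (2 * Re (poly g w)) * (w / (w - z))
        = poly g w * w / (w - z) + cnj (poly g w / (1 - cnj z * w))"
      by (simp add: algebra_simps)
  qed
  also have "\<dots> = circ_avg (\<lambda>w. poly g w * w / (w - z)) + circ_avg (\<lambda>w. cnj (poly g w / (1 - cnj z * w)))"
    by (rule circ_avg_add[OF c1]) (intro continuous_on_cnj c2)
  also have "circ_avg (\<lambda>w. poly g w * w / (w - z)) = poly g z"
    by (rule circ_avg_Cauchy[OF _ _ z]) (intro continuous_intros holomorphic_intros)+
  also have "circ_avg (\<lambda>w. cnj (poly g w / (1 - cnj z * w)))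
     = cnj (circ_avg (\<lambda>w. poly g w / (1 - cnj z * w)))"
    by (rule circ_avg_linear[OF c2 bounded_linear_cnj])
  also have "circ_avg (\<lambda>w. poly g w / (1 - cnj z * w)) = poly g 0 / (1 - cnj z * 0)"
    by (rule circ_avg_at_0) (use nz2 in \<open>auto intro!: continuous_intros holomorphic_intros\<close>)
  finally show ?thesis by simp
qed

text \<open>The bound on \<open>g\<close> inside the disc depends only on the bound for its real part on the circle;
  it is what makes the second order terms of the variations below uniform.\<close>

lemma circle_poly_approx_bound:
  assumes w: "continuous_on (sphere 0 1) w" "\<And>z. norm z = 1 \<Longrightarrow> \<bar>w z\<bar> \<le> C"
    and e: "0 < e" "e \<le> 1"
  obtains g where "\<And>z. norm z = 1 \<Longrightarrow> \<bar>Re (poly g z) - w z\<bar> < e"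
    and "\<And>z. norm z < 1 \<Longrightarrow> norm (poly g z) \<le> 3 * (C + 1) / (1 - norm z)"
proof -
  obtain g0 where g0: "\<And>z. norm z = 1 \<Longrightarrow> \<bar>Re (poly g0 z) - w z\<bar> < e"
    using circle_poly_approx[OF w(1) e(1)] by blast
  \<comment> \<open>An imaginary constant is invisible in \<open>Re g\<close> but would spoil the
    bound. Subtracting it makes \<open>g 0\<close> real, so that Schwarz's formula at
    \<open>0\<close> controls \<open>2 * g 0\<close>.\<close>
  define g where "g = g0 - [:\<i> * of_real (Im (poly g0 0)):]"
  have Re_g: "Re (poly g z) = Re (poly g0 z)" for z by (simp add: g_def)
  have Im_g: "Im (poly g 0) = 0" by (simp add: g_def)
  have bd: "\<bar>Re (poly g z)\<bar> \<le> C + 1" if "norm z = 1" for z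
    using g0[OF that] w(2)[OF that] e unfolding Re_g by linarith
  have C0: "C + 1 \<ge> 0" using bd[of 1] by simp
  have le: "norm (poly g z + cnj (poly g 0)) \<le> 2 * (C + 1) / (1 - norm z)" if z: "norm z < 1" for z
  proof -
    have "norm (poly g z + cnj (poly g 0)) \<le> circ_avg (\<lambda>w. 2 * (C + 1) / (1 - norm z))"
      unfolding poly_eq_schwarz_integral[OF z, symmetric]
    proof (rule circ_avg_norm_le)
      show "continuous_on (sphere 0 1) (\<lambda>w. of_real (2 * Re (poly g w)) * (w / (w - z)))"
        by (intro continuous_intros) (use z in auto)
      fix w :: complex assume w: "norm w = 1"
      have "1 - norm z \<le> norm (w - z)" using w norm_triangle_ineq2[of w z] by simp
      then have "1 / norm (w - z) \<le> 1 / (1 - norm z)" using z by (intro divide_left_mono mult_pos_pos) auto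
      then have "(2 * \<bar>Re (poly g w)\<bar>) * (1 / norm (w - z)) \<le> (2 * (C + 1)) * (1 / (1 - norm z))"
        using bd[OF w] C0 by (intro mult_mono) auto
      then show "norm (of_real (2 * Re (poly g w)) * (w / (w - z))) \<le> 2 * (C + 1) / (1 - norm z)"
        using w by (simp add: norm_mult norm_divide)
    qed auto
    then show ?thesis by simp
  qed
  have "norm (poly g 0) \<le> C + 1"
  proof -
    have "norm (2 * poly g 0) \<le> 2 * (C + 1)"
      using le[of 0] Im_g by (simp add: complex_eq_iff cmod_def)
    then show ?thesis by (simp add: norm_mult)
  qed
  moreover have "C + 1 \<le> (C + 1) / (1 - norm z)" if "norm z < 1" for z :: complex
    using that C0 mult_left_mono[of "1 - norm z" 1 "C + 1"] by (simp add: field_simps)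
  moreover have "norm (poly g z) \<le> norm (poly g z + cnj (poly g 0)) + norm (poly g 0)" for z
    using norm_triangle_ineq4[of "poly g z + cnj (poly g 0)" "cnj (poly g 0)"] by simp
  \<comment> \<open>The constant 3 is 2 from Schwarz's integral plus 1 for removing
    \<open>cnj (g 0)\<close>.\<close>
  ultimately have "norm (poly g z) \<le> 2 * (C + 1) / (1 - norm z) + (C + 1) / (1 - norm z)"
    if "norm z < 1" for z
    using le[OF that] that by (meson add_mono order_trans)
  then have "norm (poly g z) \<le> 3 * (C + 1) / (1 - norm z)" if "norm z < 1" for z
    using that by (simp flip: add_divide_distrib add: algebra_simps)
  then show ?thesis using that[of g] g0 Re_g by auto
qed

section \<open>First order variations with uniform remainders\<close>

lemma norm_exp_minus_linear_le:
  fixes x :: complex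
  assumes "norm x \<le> 1"
  shows "norm (exp x - 1 - x) \<le> 3 * (norm x)\<^sup>2"
proof -
  have "norm (exp x - (\<Sum>k\<le>1. x ^ k / fact k)) \<le> exp \<bar>Re x\<bar> * norm x ^ Suc 1 / fact 1"
    by (rule Taylor_exp)
  moreover have "exp \<bar>Re x\<bar> \<le> 3"
    using abs_Re_le_cmod[of x] assms exp_le by (meson exp_le_cancel_iff order_trans)
  then have "exp \<bar>Re x\<bar> * norm x ^ Suc 1 / fact 1 \<le> 3 * (norm x)\<^sup>2"
    by (simp add: power2_eq_square mult_right_mono)
  ultimately show ?thesis by (simp add: algebra_simps)
qed

lemma exp_le_quadratic:
  fixes y :: real
  assumes "\<bar>y\<bar> \<le> 1"
  shows "exp y \<le> 1 + y + 3 * y\<^sup>2"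
proof -
  have "norm (of_real (exp y - 1 - y) :: complex) \<le> 3 * y\<^sup>2"
    using norm_exp_minus_linear_le[of "of_real y"] assms by (simp add: exp_of_real)
  then show ?thesis unfolding norm_of_real by linarith
qed

text \<open>In the applications \<open>d\<close> holds the coefficients of the functional at the
  given map and \<open>D\<close> those at its dilation. The difference \<open>D - d\<close> does not
  shrink with \<open>e\<close> and is therefore divided by \<open>e\<close>. The factor 5 bounds
  \<open>norm (exp y)\<close>: at most 3 for the remainder and 2 for \<open>1 + y\<close>.\<close>

lemma first_order_variation:
  fixes x :: "'a \<Rightarrow> complex"
  assumes "\<And>a. a \<in> A \<Longrightarrow> norm (x a) \<le> X" "0 < e" "e * X \<le> 1"
    and "Re (\<Sum>a\<in>A. D a * exp (of_real e * x a)) \<le> Re (\<Sum>a\<in>A. d a)"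
  shows "Re (\<Sum>a\<in>A. d a * x a) \<le> 5 * (\<Sum>a\<in>A. norm (D a - d a)) / e + 3 * e * X\<^sup>2 * (\<Sum>a\<in>A. norm (d a))"
proof -
  have le: "Re (d a) + e * Re (d a * x a) - (5 * norm (D a - d a) + 3 * (e * X)\<^sup>2 * norm (d a))
      \<le> Re (D a * exp (of_real e * x a))" if "a \<in> A" for a
  proof -
    define y where "y = of_real e * x a"
    have y: "norm y \<le> e * X" using assms(1)[OF that] assms(2) by (simp add: y_def norm_mult)
    then have y1: "norm y \<le> 1" using assms(3) by linarith
    have y2: "(norm y)\<^sup>2 \<le> (e * X)\<^sup>2" using y by (intro power_mono) auto
    have r: "norm (exp y - 1 - y) \<le> 3 * (norm y)\<^sup>2" by (rule norm_exp_minus_linear_le[OF y1])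
    have r3: "norm (exp y - 1 - y) \<le> 3" using r y1 power_le_one[of "norm y" 2] by simp
    have "norm (exp y) \<le> norm (exp y - 1 - y) + norm (1 + y)"
      using norm_triangle_ineq[of "exp y - 1 - y" "1 + y"] by (simp add: algebra_simps)
    also have "\<dots> \<le> 5" using r3 y1 norm_triangle_ineq[of 1 y] by simp
    finally have e5: "norm (exp y) \<le> 5" .
    have "d a + d a * y - D a * exp y = - (D a - d a) * exp y - d a * (exp y - 1 - y)"
      by (simp add: algebra_simps)
    then have "norm (d a + d a * y - D a * exp y)
        \<le> norm (D a - d a) * norm (exp y) + norm (d a) * norm (exp y - 1 - y)"
      using norm_triangle_ineq4[of "- (D a - d a) * exp y" "d a * (exp y - 1 - y)"]
      by (simp add: norm_mult norm_minus_commute)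
    also have "\<dots> \<le> norm (D a - d a) * 5 + norm (d a) * (3 * (e * X)\<^sup>2)"
      using e5 r y2 by (intro add_mono mult_left_mono) auto
    finally have "Re (d a + d a * y - D a * exp y) \<le> norm (D a - d a) * 5 + norm (d a) * (3 * (e * X)\<^sup>2)"
      using complex_Re_le_cmod order_trans by blast
    moreover have "Re (d a * y) = e * Re (d a * x a)" by (simp add: y_def algebra_simps)
    ultimately show ?thesis by (simp add: y_def algebra_simps)
  qed
  have "(\<Sum>a\<in>A. Re (d a) + e * Re (d a * x a) - (5 * norm (D a - d a) + 3 * (e * X)\<^sup>2 * norm (d a)))
     \<le> (\<Sum>a\<in>A. Re (D a * exp (of_real e * x a)))"
    by (rule sum_mono) (rule le)
  also have "\<dots> \<le> (\<Sum>a\<in>A. Re (d a))" using assms(4) by (simp add: Re_sum)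
  finally have "e * Re (\<Sum>a\<in>A. d a * x a) \<le> 5 * (\<Sum>a\<in>A. norm (D a - d a)) + 3 * (e * X)\<^sup>2 * (\<Sum>a\<in>A. norm (d a))"
    unfolding Re_sum sum_distrib_left sum.distrib sum_subtractf by linarith
  then have "Re (\<Sum>a\<in>A. d a * x a) \<le> (5 * (\<Sum>a\<in>A. norm (D a - d a)) + 3 * (e * X)\<^sup>2 * (\<Sum>a\<in>A. norm (d a))) / e"
    using assms(2) by (simp add: pos_le_divide_eq mult.commute)
  also have "\<dots> = 5 * (\<Sum>a\<in>A. norm (D a - d a)) / e + 3 * e * X\<^sup>2 * (\<Sum>a\<in>A. norm (d a))"
    using assms(2) by (simp add: field_simps power2_eq_square)
  finally show ?thesis .
qed

text \<open>Each summand has the sub-mean property because \<open>s j >= 1\<close>. Thus a variation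
  that is continuous on the closed disc has to be checked on the circle only.\<close>

lemma sum_powr_maximum_principle:
  fixes H :: "'n::finite \<Rightarrow> complex \<Rightarrow> complex"
  assumes H: "\<And>j. continuous_on (cball 0 1) (H j)" "\<And>j. H j holomorphic_on ball 0 1"
    and s: "\<And>j. s j \<ge> 1"
    and le: "\<And>z. norm z = 1 \<Longrightarrow> (\<Sum>j\<in>UNIV. norm (H j z) powr s j) \<le> 1"
    and w: "norm w < 1"
  shows "(\<Sum>j\<in>UNIV. norm (H j w) powr s j) \<le> 1"
proof -
  have cH: "continuous_on (sphere 0 1) (H j)" for j by (rule continuous_on_subset[OF H(1)]) auto
  have s0: "s j > 0" for j using s[of j] by simp
  have cont: "continuous_on (sphere 0 1) (\<lambda>z. poisson w z * norm (H j z) powr s j)" for j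
    using s0 by (intro continuous_intros cH w continuous_on_powr') (auto simp: less_imp_le)
  have "(\<Sum>j\<in>UNIV. norm (H j w) powr s j) \<le> (\<Sum>j\<in>UNIV. circ_avg (\<lambda>z. poisson w z * norm (H j z) powr s j))"
    by (intro sum_mono submean_powr H w s)
  also have "\<dots> = circ_avg (\<lambda>z. \<Sum>j\<in>UNIV. poisson w z * norm (H j z) powr s j)"
    by (rule circ_avg_sum[symmetric]) (auto intro: cont)
  also have "\<dots> \<le> circ_avg (poisson w)"
  proof (rule circ_avg_mono)
    show "continuous_on (sphere 0 1) (\<lambda>z. \<Sum>j\<in>UNIV. poisson w z * norm (H j z) powr s j)"
      by (intro continuous_on_sum cont)
    fix z :: complex assume z: "norm z = 1"
    show "(\<Sum>j\<in>UNIV. poisson w z * norm (H j z) powr s j) \<le> poisson w z"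
      using mult_left_mono[OF le[OF z] poisson_nonneg[OF w, of z]] by (simp add: sum_distrib_left)
  qed (intro continuous_on_poisson w)
  also have "\<dots> = 1" by (rule circ_avg_poisson_one[OF w])
  finally show ?thesis .
qed

text \<open>Realness centres the frequencies at \<open>M\<close>: the reflection of length
  \<open>2 * M + 1\<close> turns \<open>N\<close> into \<open>z * N\<close>, and a reflection of
  that length has degree at most \<open>2 * M + 1\<close>.\<close>

lemma degree_le_of_real_trig:
  fixes N :: "complex poly"
  assumes deg: "degree N \<le> Suc (2 * M)"
    and val: "\<And>z. norm z = 1 \<Longrightarrow> poly N z = z ^ M * of_real (x z)"
  shows "degree N \<le> 2 * M"
proof -
  have "sharp (Suc (2 * M)) N = pCons 0 N"
  proof (rule poly_eq_circle)
    fix z :: complex assume z: "norm z = 1"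
    have zz: "z ^ M * cnj z ^ M = 1"
      using unit_mult_cnj[OF z] by (metis power_mult_distrib power_one)
    have "poly (sharp (Suc (2 * M)) N) z = z * (z ^ M * z ^ M) * (cnj z ^ M * of_real (x z))"
      unfolding poly_sharp_circle[OF deg z] val[OF z] by (simp add: mult_2 power_add)
    also have "\<dots> = z * (z ^ M * cnj z ^ M) * (z ^ M * of_real (x z))" by (simp only: mult_ac)
    finally show "poly (sharp (Suc (2 * M)) N) z = poly (pCons 0 N) z"
      unfolding zz by (simp add: val[OF z])
  qed
  then have "degree (pCons 0 N) \<le> Suc (2 * M)" using degree_sharp[of "Suc (2 * M)" N] by simp
  then show ?thesis by (auto split: if_splits)
qed

lemma nonpos_of_le_small:
  fixes a K :: real
  assumes "\<And>e. 0 < e \<Longrightarrow> e \<le> e0 \<Longrightarrow> a \<le> K * e" "e0 > 0"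
  shows "a \<le> 0"
proof (rule ccontr)
  assume "\<not> a \<le> 0"
  then have a: "a > 0" by simp
  define e where "e = min e0 (a / (2 * (\<bar>K\<bar> + 1)))"
  have e: "e > 0" "e \<le> e0" using a assms(2) by (auto simp: e_def)
  have "a \<le> K * e" using assms(1)[OF e] .
  also have "\<dots> \<le> (\<bar>K\<bar> + 1) * e" using e by (intro mult_right_mono) auto
  also have "\<dots> \<le> (\<bar>K\<bar> + 1) * (a / (2 * (\<bar>K\<bar> + 1)))" by (intro mult_left_mono) (auto simp: e_def)
  also have "\<dots> = a / 2" by (simp add: field_simps add_eq_0_iff)
  finally show False using a by simp
qed

section \<open>Maximizers of a linear functional\<close>

text \<open>Competitors range over the closed ellipsoid, since the maximum principle delivers only
  \<open><= 1\<close> for the variations. \<open>value_pos\<close> excludes the degenerate case in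
  which all densities vanish.\<close>

locale extremal_functional =
  fixes p :: "'n::finite \<Rightarrow> real" and m :: nat and l :: "nat \<Rightarrow> complex"
    and F :: "'n \<Rightarrow> complex \<Rightarrow> complex" and c :: "nat \<Rightarrow> 'n \<Rightarrow> complex"
  assumes p_ge: "p j \<ge> 1 / 2"
    and m_pos: "m \<ge> 1"
    and l_disc: "i \<in> {1..m} \<Longrightarrow> norm (l i) < 1"
    and F_hol: "F j holomorphic_on ball 0 1"
    and F_le: "norm z < 1 \<Longrightarrow> (\<Sum>j\<in>UNIV. norm (F j z) powr (2 * p j)) \<le> 1"
    and optimal: "(\<And>j. h j holomorphic_on ball 0 1) \<Longrightarrow>
       (\<And>z. norm z < 1 \<Longrightarrow> (\<Sum>j\<in>UNIV. norm (h j z) powr (2 * p j)) \<le> 1) \<Longrightarrow>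
       Re (\<Sum>i=1..m. \<Sum>j\<in>UNIV. c i j * h j (l i)) \<le> Re (\<Sum>i=1..m. \<Sum>j\<in>UNIV. c i j * F j (l i))"
    and value_pos: "Re (\<Sum>i=1..m. \<Sum>j\<in>UNIV. c i j * F j (l i)) > 0"
begin

definition d :: "nat \<Rightarrow> 'n \<Rightarrow> complex" where "d i j = c i j * F j (l i)"

text \<open>The functional on multipliers applied to the Herglotz kernel with pole at the boundary
  point \<open>z\<close>. Positivity of the functional on multipliers with nonnegative real part
  thereby becomes positivity of a density.\<close>

definition density :: "'n \<Rightarrow> complex \<Rightarrow> real" where
  "density j z = Re (\<Sum>i=1..m. d i j * ((z + l i) / (z - l i)))"

lemma p_pos: "p j > 0" using p_ge[of j] by simp

lemma optimal_component:
  assumes "h holomorphic_on ball 0 1" "\<And>z. norm z < 1 \<Longrightarrow> norm (h z) powr (2 * p j) +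
     (\<Sum>k\<in>UNIV - {j}. norm (F k z) powr (2 * p k)) \<le> 1"
  shows "Re (\<Sum>i=1..m. c i j * h (l i)) \<le> Re (\<Sum>i=1..m. d i j)"
proof -
  have split: "sum f UNIV = f j + sum f (UNIV - {j})" for f :: "'n \<Rightarrow> 'b::comm_monoid_add"
    by (rule sum.remove) auto
  have "Re (\<Sum>i=1..m. \<Sum>k\<in>UNIV. c i k * (F(j := h)) k (l i))
      \<le> Re (\<Sum>i=1..m. \<Sum>k\<in>UNIV. c i k * F k (l i))"
  proof (rule optimal)
    show "(F(j := h)) k holomorphic_on ball 0 1" for k using F_hol assms(1) by (cases "k = j") auto
    fix z :: complex assume z: "norm z < 1"
    have "(\<Sum>k\<in>UNIV. norm ((F(j := h)) k z) powr (2 * p k)) =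
       norm (h z) powr (2 * p j) + (\<Sum>k\<in>UNIV - {j}. norm (F k z) powr (2 * p k))"
      by (subst split) (auto intro!: sum.cong)
    then show "(\<Sum>k\<in>UNIV. norm ((F(j := h)) k z) powr (2 * p k)) \<le> 1" using assms(2)[OF z] by simp
  qed
  moreover have "(\<Sum>i=1..m. \<Sum>k\<in>UNIV. c i k * (F(j := h)) k (l i)) =
      (\<Sum>i=1..m. c i j * h (l i)) + (\<Sum>i=1..m. \<Sum>k\<in>UNIV - {j}. c i k * F k (l i))"
    unfolding sum.distrib[symmetric] by (subst split) (auto intro!: sum.cong)
  moreover have "(\<Sum>i=1..m. \<Sum>k\<in>UNIV. c i k * F k (l i)) =
      (\<Sum>i=1..m. d i j) + (\<Sum>i=1..m. \<Sum>k\<in>UNIV - {j}. c i k * F k (l i))"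
    unfolding sum.distrib[symmetric] by (subst split) (auto intro!: sum.cong simp: d_def)
  ultimately show ?thesis by (simp only: plus_complex.sel add_le_cancel_right)
qed

lemma multiplicative_variation:
  assumes g: "g holomorphic_on ball 0 1" "\<And>z. norm z < 1 \<Longrightarrow> Re (g z) \<ge> 0"
  shows "Re (\<Sum>i=1..m. d i j * g (l i)) \<ge> 0"
proof -
  define X where "X = (\<Sum>i=1..m. norm (g (l i))) + 1"
  have X: "norm (- g (l i)) \<le> X" if "i \<in> {1..m}" for i
    using member_le_sum[OF that, of "\<lambda>i. norm (g (l i))"] by (simp add: X_def)
  have X1: "X \<ge> 1" unfolding X_def by (simp add: sum_nonneg)
  have "Re (\<Sum>i=1..m. d i j * (- g (l i))) \<le> 0"
  proof (rule nonpos_of_le_small)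
    show "1 / X > 0" using X1 by simp
    fix e :: real assume e: "0 < e" "e \<le> 1 / X"
    have "Re (\<Sum>i=1..m. c i j * (F j (l i) * exp (of_real e * (- g (l i))))) \<le> Re (\<Sum>i=1..m. d i j)"
    proof (rule optimal_component[where h = "\<lambda>z. F j z * exp (of_real e * (- g z))"])
      show "(\<lambda>z. F j z * exp (of_real e * (- g z))) holomorphic_on ball 0 1"
        by (intro holomorphic_intros F_hol g)
      fix z :: complex assume z: "norm z < 1"
      have "norm (F j z * exp (of_real e * (- g z))) \<le> norm (F j z)"
        using e g(2)[OF z] by (auto simp: norm_mult intro!: mult_left_le)
      then have "norm (F j z * exp (of_real e * (- g z))) powr (2 * p j) \<le> norm (F j z) powr (2 * p j)"
        using p_pos[of j] by (intro powr_mono2) auto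
      moreover have "(\<Sum>k\<in>UNIV. norm (F k z) powr (2 * p k)) =
          norm (F j z) powr (2 * p j) + (\<Sum>k\<in>UNIV - {j}. norm (F k z) powr (2 * p k))"
        by (rule sum.remove) auto
      ultimately show "norm (F j z * exp (of_real e * (- g z))) powr (2 * p j) +
         (\<Sum>k\<in>UNIV - {j}. norm (F k z) powr (2 * p k)) \<le> 1"
        using F_le[OF z] by linarith
    qed
    then have le: "Re (\<Sum>i=1..m. d i j * exp (of_real e * (- g (l i)))) \<le> Re (\<Sum>i=1..m. d i j)"
      by (simp add: d_def mult.assoc)
    have eX: "e * X \<le> 1" using e X1 by (simp add: field_simps)
    have "Re (\<Sum>i=1..m. d i j * (- g (l i))) \<le> 5 * (\<Sum>i=1..m. norm (d i j - d i j)) / e +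
        3 * e * X\<^sup>2 * (\<Sum>i=1..m. norm (d i j))"
      by (rule first_order_variation[where x = "\<lambda>i. - g (l i)", OF X e(1) eX le])
    then show "Re (\<Sum>i=1..m. d i j * (- g (l i))) \<le> (3 * X\<^sup>2 * (\<Sum>i=1..m. norm (d i j))) * e"
      by (simp add: mult_ac)
  qed
  then show ?thesis by (simp add: sum_negf)
qed

text \<open>Both \<open>\<i>\<close> and \<open>- \<i>\<close> are admissible multipliers.\<close>

lemma sum_d_real: "Im (\<Sum>i=1..m. d i j) = 0"
proof -
  have "Re (\<Sum>i=1..m. d i j * \<i>) \<ge> 0" "Re (\<Sum>i=1..m. d i j * (- \<i>)) \<ge> 0"
    by (rule multiplicative_variation; simp)+
  then show ?thesis by (simp add: Im_sum sum_negf)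
qed

lemma density_nonneg:
  assumes z: "norm z = 1"
  shows "density j z \<ge> 0"
  unfolding density_def
proof (rule multiplicative_variation)
  have nz: "z - w \<noteq> 0" if "norm w < 1" for w using that z by auto
  show "(\<lambda>w. (z + w) / (z - w)) holomorphic_on ball 0 1"
    by (intro holomorphic_intros) (use nz in auto)
  fix w :: complex assume w: "norm w < 1"
  have "Re ((z + w) / (z - w)) = Re ((z + w) * cnj (z - w)) / (norm (z - w))\<^sup>2"
    by (subst complex_div_cnj) (simp add: Re_divide_of_real)
  also have "Re ((z + w) * cnj (z - w)) = (norm z)\<^sup>2 - (norm w)\<^sup>2"
    by (simp add: cmod_def power2_eq_square algebra_simps)
  finally show "Re ((z + w) / (z - w)) \<ge> 0" using z w by (simp add: abs_square_le_1)
qed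

text \<open>An extension of \<open>density j z / z\<close> off the circle: the first summands have
  their poles at the nodes, the second ones are holomorphic on the closed disc and make
  \<open>z * kern j z\<close> real on the circle.\<close>

definition kern :: "'n \<Rightarrow> complex \<Rightarrow> complex" where
  "kern j z = (\<Sum>i=1..m. d i j / (z - l i) + cnj (d i j) * cnj (l i) / (1 - cnj (l i) * z))"

lemma circle_neq_l: "norm z = 1 \<Longrightarrow> i \<in> {1..m} \<Longrightarrow> z - l i \<noteq> 0"
  using l_disc[of i] by auto

lemma cdisc_neq_l: "norm z \<le> 1 \<Longrightarrow> i \<in> {1..m} \<Longrightarrow> 1 - cnj (l i) * z \<noteq> 0"
  using one_minus_cnj_mult_neq_0[of "l i" z] l_disc[of i] by auto

lemma kern_density:
  assumes z: "norm z = 1"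
  shows "z * kern j z = of_real (density j z)"
proof -
  define A where "A = (\<Sum>i=1..m. d i j * (z / (z - l i)))"
  define D where "D = (\<Sum>i=1..m. d i j)"
  have z0: "z \<noteq> 0" using z by auto
  have "Im D = 0" unfolding D_def by (rule sum_d_real)
  then have Dr: "cnj D = D" by (simp add: complex_eq_iff)
  have 1: "cnj (z / (z - l i)) = 1 / (1 - cnj (l i) * z)" if "i \<in> {1..m}" for i
  proof -
    have "cnj z = 1 / z" using unit_mult_cnj[OF z] z0 by (simp add: eq_divide_eq mult.commute)
    then have "cnj (z - l i) = (1 - cnj (l i) * z) / z" using z0 by (simp add: diff_divide_distrib)
    then have "cnj (z / (z - l i)) = (1 / z) / ((1 - cnj (l i) * z) / z)"
      using \<open>cnj z = 1 / z\<close> by (simp only: complex_cnj_divide)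
    then show ?thesis using z0 by simp
  qed
  have "z * kern j z = (\<Sum>i=1..m. d i j * (z / (z - l i)) + cnj (d i j) * (cnj (z / (z - l i)) - 1))"
    unfolding kern_def sum_distrib_left
  proof (rule sum.cong[OF refl])
    fix i assume i: "i \<in> {1..m}"
    have "cnj (l i) * z / (1 - cnj (l i) * z) = 1 / (1 - cnj (l i) * z) - 1"
      using cdisc_neq_l[of z i] z i by (simp add: field_simps)
    then have eq: "cnj (l i) * z / (1 - cnj (l i) * z) = cnj (z / (z - l i)) - 1" unfolding 1[OF i] .
    have "z * (d i j / (z - l i) + cnj (d i j) * cnj (l i) / (1 - cnj (l i) * z)) =
      d i j * (z / (z - l i)) + cnj (d i j) * (cnj (l i) * z / (1 - cnj (l i) * z))"
      by (simp add: distrib_left mult_ac)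
    then show "z * (d i j / (z - l i) + cnj (d i j) * cnj (l i) / (1 - cnj (l i) * z)) =
      d i j * (z / (z - l i)) + cnj (d i j) * (cnj (z / (z - l i)) - 1)"
      unfolding eq .
  qed
  also have "\<dots> = A + cnj A - cnj D"
    unfolding A_def D_def cnj_sum complex_cnj_mult sum.distrib[symmetric] sum_subtractf[symmetric]
    by (rule sum.cong) (auto simp: algebra_simps)
  \<comment> \<open>Here \<open>D\<close> has to be real. The result is the density because
    \<open>(z + l i) / (z - l i) = 2 * z / (z - l i) - 1\<close>.\<close>
  also have "\<dots> = of_real (2 * Re A - Re D)"
    unfolding Dr complex_add_cnj using Dr by (simp add: complex_eq_iff)
  also have "2 * Re A - Re D = density j z"
  proof -
    have "density j z = Re (2 * A - D)"
      unfolding density_def A_def D_def sum_distrib_left sum_subtractf[symmetric]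
    proof (intro arg_cong[where f = Re] sum.cong refl)
      fix i assume i: "i \<in> {1..m}"
      have "(z + l i) / (z - l i) = 2 * (z / (z - l i)) - 1"
        using circle_neq_l[OF z i] by (simp add: field_simps)
      show "d i j * ((z + l i) / (z - l i)) = 2 * (d i j * (z / (z - l i))) - d i j"
        unfolding \<open>(z + l i) / (z - l i) = 2 * (z / (z - l i)) - 1\<close>
        by (simp only: right_diff_distrib mult_1_right mult.left_commute)
    qed
    then show ?thesis by simp
  qed
  finally show ?thesis .
qed

lemma continuous_on_density [continuous_intros]: "continuous_on (sphere 0 1) (density j)"
  unfolding density_def by (intro continuous_intros) (use circle_neq_l in auto)

text \<open>The polar part of \<open>kern\<close> gives the node values by Cauchy's formula; the
  other part carries a factor \<open>z\<close> and so has mean zero.\<close>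

lemma density_reproducing:
  assumes g: "continuous_on (cball 0 1) g" "g holomorphic_on ball 0 1"
  shows "circ_avg (\<lambda>z. of_real (density j z) * g z) = (\<Sum>i=1..m. d i j * g (l i))"
proof -
  have cg: "continuous_on (sphere 0 1) g" by (rule continuous_on_subset[OF g(1)]) auto
  have "circ_avg (\<lambda>z. of_real (density j z) * g z) = circ_avg (\<lambda>z. \<Sum>i=1..m.
      (d i j * (g z * z / (z - l i))) + (cnj (d i j) * cnj (l i)) * (z * g z / (1 - cnj (l i) * z)))"
  proof (rule circ_avg_cong)
    fix z :: complex assume z: "norm z = 1"
    show "of_real (density j z) * g z = (\<Sum>i=1..m.
      (d i j * (g z * z / (z - l i))) + (cnj (d i j) * cnj (l i)) * (z * g z / (1 - cnj (l i) * z)))"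
      unfolding kern_density[OF z, symmetric] kern_def sum_distrib_left sum_distrib_right
      by (rule sum.cong) (simp_all add: algebra_simps)
  qed
  also have "\<dots> = (\<Sum>i=1..m. circ_avg (\<lambda>z.
      (d i j * (g z * z / (z - l i))) + (cnj (d i j) * cnj (l i)) * (z * g z / (1 - cnj (l i) * z))))"
    by (rule circ_avg_sum) (use circle_neq_l cdisc_neq_l in \<open>auto intro!: continuous_intros cg\<close>)
  also have "\<dots> = (\<Sum>i=1..m. d i j * g (l i))"
  proof (rule sum.cong[OF refl])
    fix i assume i: "i \<in> {1..m}"
    have "circ_avg (\<lambda>z.
      (d i j * (g z * z / (z - l i))) + (cnj (d i j) * cnj (l i)) * (z * g z / (1 - cnj (l i) * z)))
      = d i j * circ_avg (\<lambda>z. g z * z / (z - l i)) +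
        (cnj (d i j) * cnj (l i)) * circ_avg (\<lambda>z. z * g z / (1 - cnj (l i) * z))"
      unfolding circ_avg_mult_left[symmetric]
      by (rule circ_avg_add) (use i circle_neq_l cdisc_neq_l in \<open>auto intro!: continuous_intros cg\<close>)
    also have "circ_avg (\<lambda>z. g z * z / (z - l i)) = g (l i)"
      by (rule circ_avg_Cauchy[OF g l_disc[OF i]])
    also have "circ_avg (\<lambda>z. z * g z / (1 - cnj (l i) * z)) = 0 * g 0 / (1 - cnj (l i) * 0)"
      by (rule circ_avg_at_0) (use i cdisc_neq_l in \<open>auto intro!: continuous_intros holomorphic_intros g\<close>)
    finally show "circ_avg (\<lambda>z.
      (d i j * (g z * z / (z - l i))) + (cnj (d i j) * cnj (l i)) * (z * g z / (1 - cnj (l i) * z)))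
      = d i j * g (l i)" by simp
  qed
  finally show ?thesis .
qed

lemma density_reproducing_Re:
  assumes g: "continuous_on (cball 0 1) g" "g holomorphic_on ball 0 1"
  shows "circ_avg (\<lambda>z. density j z * Re (g z)) = Re (\<Sum>i=1..m. d i j * g (l i))"
proof -
  have cg: "continuous_on (sphere 0 1) g" by (rule continuous_on_subset[OF g(1)]) auto
  have "circ_avg (\<lambda>z. Re (of_real (density j z) * g z)) = Re (circ_avg (\<lambda>z. of_real (density j z) * g z))"
    by (rule circ_avg_linear) (auto intro!: continuous_intros cg bounded_linear_Re)
  then show ?thesis unfolding density_reproducing[OF g] by simp
qed

end

text \<open>The step \<open>e\<close> is fixed first, small against \<open>\<epsilon>\<close>; then
  \<open>r\<close> approaches 1 until \<open>\<omega> r < e^2\<close>, so that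
  \<open>\<omega> r / e\<close> is again at most \<open>e\<close>.\<close>

lemma eventually_small_of_variation:
  fixes Q \<omega> :: "real \<Rightarrow> real"
  assumes "\<And>e r. 0 < e \<Longrightarrow> e \<le> e0 \<Longrightarrow> 0 < r \<Longrightarrow> r < 1 \<Longrightarrow> Q r \<le> C * (e + \<omega> r / e)"
    and "e0 > 0" "(\<omega> \<longlongrightarrow> 0) (at_left 1)" "\<epsilon> > 0" "C \<ge> 0"
  shows "eventually (\<lambda>r. Q r \<le> \<epsilon>) (at_left 1)"
proof -
  define e where "e = min e0 (\<epsilon> / (2 * (C + 1)))"
  have e: "0 < e" "e \<le> e0" "e \<le> \<epsilon> / (2 * (C + 1))" using assms by (auto simp: e_def)
  have "eventually (\<lambda>r. \<omega> r < e\<^sup>2) (at_left 1)"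
    using order_tendstoD(2)[OF assms(3), of "e\<^sup>2"] e by simp
  moreover have "eventually (\<lambda>r. r \<in> {0<..<1}) (at_left (1::real))"
    by (rule eventually_at_left_real) simp
  ultimately show ?thesis
  proof eventually_elim
    case (elim r)
    then have "\<omega> r / e \<le> e" using e by (simp add: pos_divide_le_eq power2_eq_square)
    then have "C * (e + \<omega> r / e) \<le> C * (2 * e)" using assms(5) by (intro mult_left_mono) auto
    also have "\<dots> \<le> (C + 1) * (2 * e)" using e by (intro mult_right_mono) auto
    also have "\<dots> \<le> (C + 1) * (2 * (\<epsilon> / (2 * (C + 1))))" using e assms(5) by (intro mult_left_mono) auto
    also have "\<dots> = \<epsilon>" using assms(5) by (simp add: field_simps)
    finally show ?case using assms(1)[OF e(1,2), of r] elim by auto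
  qed
qed

lemma sphere_bounded:
  fixes u :: "complex \<Rightarrow> real"
  assumes "continuous_on (sphere 0 1) u"
  obtains B where "B \<ge> 1" "\<And>z. norm z = 1 \<Longrightarrow> \<bar>u z\<bar> \<le> B"
proof -
  have "compact (u ` sphere 0 1)" by (intro compact_continuous_image assms compact_sphere)
  then obtain B where B: "\<And>y. y \<in> u ` sphere 0 1 \<Longrightarrow> norm y \<le> B"
    using compact_imp_bounded bounded_iff by metis
  show ?thesis
    by (rule that[of "max B 1"]) (use B in \<open>fastforce simp: le_max_iff_disj\<close>)+
qed

lemma continuous_on_dilate:
  assumes "f holomorphic_on ball 0 1" "0 < r" "r < 1"
  shows "continuous_on (cball 0 1) (\<lambda>z. f (of_real r * z))" (is ?A)
    and "(\<lambda>z. f (of_real r * z)) holomorphic_on ball 0 1" (is ?B)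
proof -
  have mem: "of_real r * z \<in> ball (0::complex) 1" if "norm z \<le> 1" for z
  proof -
    have "r * norm z \<le> r" using assms that by (intro mult_left_le) auto
    moreover have "norm (of_real r * z) = r * norm z" using assms by (simp add: norm_mult)
    ultimately have "norm (of_real r * z) < 1" using assms by linarith
    then show ?thesis by simp
  qed
  show ?A
    by (rule continuous_on_compose2[OF holomorphic_on_imp_continuous_on[OF assms(1)]])
       (use mem in \<open>auto intro!: continuous_intros\<close>)
  have "(f \<circ> (\<lambda>z. of_real r * z)) holomorphic_on ball 0 1"
    by (rule holomorphic_on_compose_gen[OF _ assms(1)])
       (use mem in \<open>auto intro!: holomorphic_intros\<close>)
  then show ?B by (simp add: o_def)
qed

section \<open>Numerators of the densities and mean convergence of the moduli\<close>

context extremal_functional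
begin

definition lprod :: "complex \<Rightarrow> real" where "lprod z = (\<Prod>i=1..m. (norm (z - l i))\<^sup>2)"

text \<open>This is \<open>kern j\<close> with its denominators cleared. The weight
  \<open>1 / p j\<close> compensates the exponent: a change of \<open>log |F j|\<close> by
  \<open>x\<close> changes \<open>|F j|^(2 p j)\<close> at the relative rate
  \<open>2 * p j * x\<close>.\<close>

definition numer :: "'n \<Rightarrow> complex poly" where
  "numer j = smult (of_real (1 / p j)) (\<Sum>i=1..m. (smult (d i j) [:1, -cnj (l i):] +
      smult (cnj (d i j) * cnj (l i)) [:-l i, 1:]) * (\<Prod>k\<in>{1..m}-{i}. qfac (l k)))"

lemma lprod_pos: "norm z = 1 \<Longrightarrow> lprod z > 0"
  unfolding lprod_def using circle_neq_l by (intro prod_pos) auto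

lemma lprod_le: "norm z = 1 \<Longrightarrow> lprod z \<le> 4 ^ m"
proof -
  assume z: "norm z = 1"
  have "lprod z \<le> (\<Prod>i=1..m. 4)" unfolding lprod_def
  proof (rule prod_mono)
    fix i assume i: "i \<in> {1..m}"
    have "norm (z - l i) \<le> 2" using norm_triangle_ineq4[of z "l i"] z l_disc[OF i] by simp
    then have "(norm (z - l i))\<^sup>2 \<le> 2\<^sup>2" by (intro power_mono) auto
    then show "0 \<le> (norm (z - l i))\<^sup>2 \<and> (norm (z - l i))\<^sup>2 \<le> 4" by simp
  qed
  then show ?thesis by simp
qed

lemma numer_val:
  assumes z: "norm z = 1"
  shows "poly (numer j) z = z ^ (m - 1) * of_real (density j z / p j * lprod z)"
proof -
  define f where "f = (\<lambda>i. (z - l i) * (1 - cnj (l i) * z))"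
  have z0: "z \<noteq> 0" using z by auto
  have "poly (numer j) z = of_real (1 / p j) * (\<Sum>i=1..m. (d i j * (1 - cnj (l i) * z) +
      cnj (d i j) * cnj (l i) * (z - l i)) * (\<Prod>k\<in>{1..m}-{i}. f k))"
    unfolding numer_def f_def poly_smult poly_sum poly_mult[of _ "prod _ _"] poly_prod poly_qfac poly_add
    by (simp add: algebra_simps)
  also have "\<dots> = of_real (1 / p j) * (\<Sum>i=1..m. (d i j / (z - l i) +
      cnj (d i j) * cnj (l i) / (1 - cnj (l i) * z)) * (\<Prod>k=1..m. f k))"
  proof (rule arg_cong2[where f = "(*)", OF refl sum.cong[OF refl]])
    fix i assume i: "i \<in> {1..m}"
    have "(\<Prod>k=1..m. f k) = f i * (\<Prod>k\<in>{1..m}-{i}. f k)" by (rule prod.remove) (use i in auto)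
    moreover have "(d i j / (z - l i) + cnj (d i j) * cnj (l i) / (1 - cnj (l i) * z)) * f i =
      d i j * (1 - cnj (l i) * z) + cnj (d i j) * cnj (l i) * (z - l i)"
      using circle_neq_l[OF z i] cdisc_neq_l[of z i] i z by (simp add: f_def distrib_right)
    ultimately show "(d i j * (1 - cnj (l i) * z) +
      cnj (d i j) * cnj (l i) * (z - l i)) * (\<Prod>k\<in>{1..m}-{i}. f k) = (d i j / (z - l i) +
      cnj (d i j) * cnj (l i) / (1 - cnj (l i) * z)) * (\<Prod>k=1..m. f k)"
      by (metis mult.assoc)
  qed
  also have "\<dots> = of_real (1 / p j) * (kern j z * (\<Prod>k=1..m. f k))"
    by (simp add: kern_def sum_distrib_right)
  also have "(\<Prod>k=1..m. f k) = z ^ m * of_real (lprod z)"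
    unfolding f_def circle_factor[OF z] prod.distrib lprod_def of_real_prod by simp
  also have "z ^ m = z ^ (m - 1) * z" using m_pos by (metis Suc_diff_1 less_eq_Suc_le One_nat_def power_Suc2)
  also have "of_real (1 / p j) * (kern j z * (z ^ (m - 1) * z * of_real (lprod z)))
     = of_real (1 / p j) * (z ^ (m - 1) * (z * kern j z) * of_real (lprod z))" by (simp add: mult_ac)
  also have "\<dots> = z ^ (m - 1) * of_real (density j z / p j * lprod z)"
    unfolding kern_density[OF z] by simp
  finally show ?thesis .
qed

lemma numer_nonneg: "nonneg_trig (m - 1) (numer j)"
  and numer_trig_val: "norm z = 1 \<Longrightarrow> trig_val (m - 1) (numer j) z = density j z / p j * lprod z"
proof -
  have tv: "trig_val (m - 1) (numer j) z = density j z / p j * lprod z" if "norm z = 1" for z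
    by (rule trig_val_eqI[OF that numer_val[OF that]])
  \<comment> \<open>Counting gives one degree too many; realness on the circle removes it.\<close>
  have "degree (numer j) \<le> Suc (2 * (m - 1))"
    unfolding numer_def
  proof (rule order_trans[OF degree_smult_le degree_sum_le])
    fix i assume i: "i \<in> {1..m}"
    have "degree (smult (d i j) [:1, -cnj (l i):] + smult (cnj (d i j) * cnj (l i)) [:-l i, 1:]) \<le> 1"
      by (intro degree_add_le order_trans[OF degree_smult_le]) auto
    moreover have "degree (\<Prod>k\<in>{1..m}-{i}. qfac (l k)) \<le> (\<Sum>k\<in>{1..m}-{i}. 2)"
    proof (rule order_trans[OF degree_prod_sum_le])
      show "sum (degree \<circ> (\<lambda>k. qfac (l k))) ({1..m}-{i}) \<le> (\<Sum>k\<in>{1..m}-{i}. 2)"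
        unfolding o_def by (intro sum_mono order_trans[OF degree_mult_le]) auto
    qed simp
    moreover have "(\<Sum>k\<in>{1..m}-{i}. (2::nat)) = 2 * (m - 1)" using i by (simp add: card_Diff_singleton)
    ultimately show "degree ((smult (d i j) [:1, -cnj (l i):] + smult (cnj (d i j) * cnj (l i)) [:-l i, 1:]) *
       (\<Prod>k\<in>{1..m}-{i}. qfac (l k))) \<le> Suc (2 * (m - 1))"
      by (intro order_trans[OF degree_mult_le]) linarith
  qed simp
  then have "degree (numer j) \<le> 2 * (m - 1)" by (rule degree_le_of_real_trig[OF _ numer_val])
  then show "nonneg_trig (m - 1) (numer j)"
    unfolding nonneg_trig_def
    using tv numer_val density_nonneg lprod_pos p_pos by (auto simp: less_imp_le)
  show "norm z = 1 \<Longrightarrow> trig_val (m - 1) (numer j) z = density j z / p j * lprod z" by (rule tv)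
qed

text \<open>The aim is that \<open>tval r j\<close> tends to \<open>nval j / ntot\<close> as
  \<open>r\<close> tends to 1. It is expressed as smallness of
  \<open>nval j - ntot * tval r j\<close>, since \<open>ntot\<close> may vanish on the
  circle.\<close>

definition nval :: "'n \<Rightarrow> complex \<Rightarrow> real" where "nval j z = trig_val (m - 1) (numer j) z"
definition ntot :: "complex \<Rightarrow> real" where "ntot z = (\<Sum>j\<in>UNIV. nval j z)"
definition tval :: "real \<Rightarrow> 'n \<Rightarrow> complex \<Rightarrow> real" where
  "tval r j z = norm (F j (of_real r * z)) powr (2 * p j)"

lemma nval_nonneg: "norm z = 1 \<Longrightarrow> nval j z \<ge> 0"
  using numer_nonneg[of j] by (auto simp: nval_def nonneg_trig_def)

lemma continuous_on_nval [continuous_intros]: "continuous_on S (nval j)"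
  unfolding nval_def by (intro continuous_intros)

lemma continuous_on_ntot [continuous_intros]: "continuous_on S ntot"
  unfolding ntot_def by (intro continuous_intros)

lemma continuous_on_tval [continuous_intros]:
  assumes "0 < r" "r < 1" shows "continuous_on (sphere 0 1) (tval r j)"
proof -
  have "continuous_on (sphere 0 1) (\<lambda>z. F j (of_real r * z))"
    by (rule continuous_on_subset[OF continuous_on_dilate(1)[OF F_hol assms]]) auto
  then show ?thesis unfolding tval_def using p_pos[of j]
    by (intro continuous_on_powr' continuous_intros) auto
qed

lemma tval_nonneg: "tval r j z \<ge> 0" by (simp add: tval_def)

lemma tval_sum_le:
  assumes "0 < r" "r < 1" "norm z \<le> 1"
  shows "(\<Sum>j\<in>UNIV. tval r j z) \<le> 1"
proof -
  have "r * norm z < 1" using assms mult_left_le[of "norm z" r] by linarith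
  then show ?thesis unfolding tval_def by (intro F_le) (use assms in \<open>simp add: norm_mult\<close>)
qed

lemma nval_le_ntot: "norm z = 1 \<Longrightarrow> nval j z \<le> ntot z"
  unfolding ntot_def by (rule member_le_sum) (auto simp: nval_nonneg)

definition omega :: "real \<Rightarrow> real" where
  "omega r = (\<Sum>(i, j)\<in>{1..m} \<times> UNIV. norm (c i j * F j (of_real r * l i) - d i j))"

lemma omega_tendsto: "(omega \<longlongrightarrow> 0) (at_left 1)"
  unfolding omega_def
proof (rule tendsto_null_sum)
  fix a assume a: "a \<in> {1..m} \<times> (UNIV :: 'n set)"
  obtain i j where ij: "a = (i, j)" by force
  have i: "i \<in> {1..m}" using a ij by auto
  have "isCont (F j) (of_real 1 * l i)"
    using F_hol[of j] l_disc[OF i]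
    by (metis continuous_on_eq_continuous_at dist_0_norm holomorphic_on_imp_continuous_on mem_ball mult_1 of_real_1 open_ball)
  then have "((\<lambda>r. F j (of_real r * l i)) \<longlongrightarrow> F j (of_real 1 * l i)) (at_left (1::real))"
    by (rule isCont_tendsto_compose) (intro tendsto_intros)
  then have "((\<lambda>r. norm (c i j * F j (of_real r * l i) - d i j)) \<longlongrightarrow>
      norm (c i j * F j (of_real 1 * l i) - d i j)) (at_left (1::real))"
    by (intro tendsto_intros)
  then show "((\<lambda>r. case a of (i, j) \<Rightarrow> norm (c i j * F j (of_real r * l i) - d i j)) \<longlongrightarrow> 0) (at_left (1::real))"
    by (simp add: ij d_def)
qed

text \<open>Subtracting the \<open>t\<close>-mean \<open>S\<close> of \<open>a\<close> makes the
  first order term \<open>(1 - T) * S\<close>, where \<open>T\<close> is the sum of the weights; as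
  \<open>e * S <= 1\<close>, the slack \<open>1 - T\<close> absorbs it. In \<open>K\<close>, the 1
  pays for the error of \<open>y\<close> and \<open>3 * (2 * B + 1)\<^sup>2\<close> for the
  quadratic term of the exponential.\<close>

lemma exponential_weight_bound:
  fixes t w y :: "'n \<Rightarrow> real"
  assumes t: "\<And>j. t j \<ge> 0" "(\<Sum>j\<in>UNIV. t j) \<le> 1"
    and w: "w = (\<lambda>j. a j - (\<Sum>k\<in>UNIV. t k * a k))" "\<And>j. \<bar>a j\<bar> \<le> B" "B \<ge> 1"
    and K: "K = 1 + 3 * (2 * B + 1)\<^sup>2" and e: "0 < e" "e * K \<le> 1"
    and y: "\<And>j. y j \<le> w j + e"
  shows "(\<Sum>j\<in>UNIV. t j * exp (e * (y j - K * e))) \<le> 1"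
proof -
  define T where "T = (\<Sum>j\<in>UNIV. t j)"
  define S where "S = (\<Sum>k\<in>UNIV. t k * a k)"
  define v where "v = (\<lambda>j. e * w j - (K - 1) * e\<^sup>2)"
  have T: "0 \<le> T" "T \<le> 1" unfolding T_def using t by (auto intro: sum_nonneg)
  have "\<bar>S\<bar> \<le> (\<Sum>k\<in>UNIV. \<bar>t k * a k\<bar>)" unfolding S_def by (rule sum_abs)
  also have "\<dots> \<le> (\<Sum>k\<in>UNIV. t k * B)"
    using t w(2) by (intro sum_mono) (auto simp: abs_mult intro!: mult_left_mono)
  also have "\<dots> \<le> B" using T w(3) mult_right_mono[of T 1 B] by (simp add: T_def sum_distrib_right)
  finally have S: "\<bar>S\<bar> \<le> B" .
  have wB: "\<bar>w j\<bar> \<le> 2 * B" for j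
    using S w(2)[of j] unfolding w(1) S_def[symmetric] by linarith
  have B1: "2 * B + 1 \<le> (2 * B + 1)\<^sup>2" using w(3) by (simp add: power2_eq_square)
  have KB: "2 * B + 1 \<le> K" "B \<le> K" using B1 w(3) unfolding K by linarith+
  have K1: "K \<ge> 1" using KB w(3) by linarith
  have eB: "e * (2 * B + 1) \<le> 1" "e * B \<le> 1"
    using e mult_left_mono[OF KB(1), of e] mult_left_mono[OF KB(2), of e] by linarith+
  have eK: "(K - 1) * e \<le> 1" "0 \<le> (K - 1) * e" using e K1 by (auto simp: algebra_simps)
  have v: "\<bar>v j\<bar> \<le> e * (2 * B + 1)" for j
  proof -
    have "v j = e * (w j - (K - 1) * e)" by (simp add: v_def power2_eq_square algebra_simps)
    moreover have "\<bar>w j - (K - 1) * e\<bar> \<le> 2 * B + 1" using wB[of j] eK by linarith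
    ultimately show ?thesis using e by (simp add: abs_mult)
  qed
  have le: "t j * exp (e * (y j - K * e)) \<le> t j + e * (t j * w j) - t j * ((K - 1) * e\<^sup>2) + t j * (3 * (e * (2 * B + 1))\<^sup>2)" for j
  proof -
    have "e * (y j - K * e) \<le> e * (w j + e - K * e)" using y[of j] e by (intro mult_left_mono) auto
    also have "\<dots> = v j" by (simp add: v_def power2_eq_square algebra_simps)
    finally have "exp (e * (y j - K * e)) \<le> exp (v j)" by simp
    also have "\<dots> \<le> 1 + v j + 3 * (v j)\<^sup>2"
      by (rule exp_le_quadratic) (use v[of j] eB in linarith)
    also have "(v j)\<^sup>2 \<le> (e * (2 * B + 1))\<^sup>2" using v[of j] by (rule abs_le_square_iff[THEN iffD1, OF order_trans]) (use e w(3) in simp)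
    finally have "exp (e * (y j - K * e)) \<le> 1 + v j + 3 * (e * (2 * B + 1))\<^sup>2" by simp
    then have "t j * exp (e * (y j - K * e)) \<le> t j * (1 + v j + 3 * (e * (2 * B + 1))\<^sup>2)"
      using t by (intro mult_left_mono) auto
    then show ?thesis by (simp add: v_def algebra_simps)
  qed
  have "(\<Sum>j\<in>UNIV. t j * w j) = S - T * S"
    unfolding w(1) S_def[symmetric] T_def by (simp add: right_diff_distrib sum_subtractf sum_distrib_right S_def[symmetric])
  then have tw: "(\<Sum>j\<in>UNIV. t j * w j) = (1 - T) * S" by (simp add: algebra_simps)
  have "(\<Sum>j\<in>UNIV. t j * exp (e * (y j - K * e))) \<le>
     (\<Sum>j\<in>UNIV. t j + e * (t j * w j) - t j * ((K - 1) * e\<^sup>2) + t j * (3 * (e * (2 * B + 1))\<^sup>2))"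
    by (rule sum_mono) (rule le)
  also have "\<dots> = T + e * ((1 - T) * S) - T * ((K - 1) * e\<^sup>2) + T * (3 * (e * (2 * B + 1))\<^sup>2)"
    unfolding sum.distrib sum_subtractf sum_distrib_left[symmetric] sum_distrib_right[symmetric] tw T_def ..
  also have "3 * (e * (2 * B + 1))\<^sup>2 = (K - 1) * e\<^sup>2" unfolding K by (simp add: power_mult_distrib)
  also have "e * ((1 - T) * S) \<le> 1 - T"
  proof -
    have "(1 - T) * (e * S) \<le> (1 - T) * 1"
      using T S eB e mult_left_mono[of S B e] by (intro mult_left_mono) linarith+
    then show ?thesis by (simp add: algebra_simps)
  qed
  finally show ?thesis by simp
qed

end

context extremal_functional
begin

text \<open>First variation: in \<open>F j (r z)\<close> the \<open>j\<close>-th component is multiplied by \<open>exp (e g j / (2 p j))\<close>,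
  where \<open>Re (g j)\<close> approximates on the circle the deviation \<open>nval j - ntot * tval r j\<close> corrected so
  as to respect the constraint to first order.\<close>

lemma modulus_estimate:
  "\<exists>e0 C. e0 > 0 \<and> C \<ge> 0 \<and> (\<forall>e r. 0 < e \<longrightarrow> e \<le> e0 \<longrightarrow> 0 < r \<longrightarrow> r < 1 \<longrightarrow>
     circ_avg (\<lambda>z. \<Sum>j\<in>UNIV. (nval j z - ntot z * tval r j z)\<^sup>2) \<le> C * (e + omega r / e))"
proof -
  obtain B where B: "B \<ge> 1" "\<And>z. norm z = 1 \<Longrightarrow> \<bar>ntot z\<bar> \<le> B"
    using sphere_bounded[OF continuous_on_ntot] by blast
  define K where "K = 1 + 3 * (2 * B + 1)\<^sup>2"
  \<comment> \<open>\<open>X\<close> bounds the exponents at the nodes: the sum majorises the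
    approximating polynomials, the additional 1 the shift \<open>K * e\<close>. The choice of
    \<open>e0\<close> gives \<open>e * K <= 1\<close> and \<open>e * X <= 1\<close>
    together.\<close>
  define X where "X = (\<Sum>i=1..m. 3 * (2 * B + 1) / (1 - norm (l i))) + 1"
  define S where "S = (\<Sum>(i, j)\<in>{1..m} \<times> UNIV. norm (d i j))"
  define P where "P = (\<Sum>j\<in>UNIV. circ_avg (density j) / (2 * p j))"
  define e0 where "e0 = 1 / (K + X)"
  define C where "C = 2 * 4 ^ m * (5 + 3 * X\<^sup>2 * S + (K + 1) * P)"
  have K1: "K \<ge> 1" by (simp add: K_def)
  have Xterm: "3 * (2 * B + 1) / (1 - norm (l i)) \<ge> 0" if "i \<in> {1..m}" for i
    using l_disc[OF that] B(1) by simp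
  have "(\<Sum>i=1..m. 3 * (2 * B + 1) / (1 - norm (l i))) \<ge> 0" by (rule sum_nonneg) (rule Xterm)
  then have X1: "X \<ge> 1" by (simp add: X_def)
  have S0: "S \<ge> 0" unfolding S_def by (intro sum_nonneg) auto
  have avg_density: "circ_avg (density j) \<ge> 0" for j
    using circ_avg_mono[of "\<lambda>_. 0" "density j"] density_nonneg by (auto intro: continuous_intros)
  have P0: "P \<ge> 0" unfolding P_def using avg_density p_pos by (intro sum_nonneg divide_nonneg_pos) auto
  have C0: "C \<ge> 0" using S0 P0 K1 by (simp add: C_def)
  have e0: "e0 > 0" using K1 X1 by (simp add: e0_def)
  have main: "circ_avg (\<lambda>z. \<Sum>j\<in>UNIV. (nval j z - ntot z * tval r j z)\<^sup>2) \<le> C * (e + omega r / e)"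
    if e: "0 < e" "e \<le> e0" and r: "0 < r" "r < 1" for e r
  proof -
    have eKX: "e * (K + X) \<le> 1" using e K1 X1 by (simp add: e0_def pos_le_divide_eq)
    then have eK: "e * K \<le> 1" and eX: "e * X \<le> 1" using e K1 X1 by (simp_all add: distrib_left)
        (smt (verit) mult_nonneg_nonneg)+
    have e1: "e \<le> 1" using eK K1 e mult_left_mono[of 1 K e] by linarith
    define a where "a j z = nval j z - ntot z * tval r j z" for j z
    define w where "w j z = a j z - (\<Sum>k\<in>UNIV. tval r k z * a k z)" for j z
    have ca [continuous_intros]: "continuous_on (sphere 0 1) (a j)" for j
      unfolding a_def by (intro continuous_intros r)
    have cw [continuous_intros]: "continuous_on (sphere 0 1) (w j)" for j
      unfolding w_def by (intro continuous_intros r)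
    have t1: "tval r j z \<le> 1" if "norm z = 1" for j z
      using tval_sum_le[OF r, of z] that member_le_sum[of j UNIV "\<lambda>j. tval r j z"] tval_nonneg by force
    have aB: "\<bar>a j z\<bar> \<le> B" if z: "norm z = 1" for j z
    proof -
      have nt: "0 \<le> ntot z" "ntot z \<le> B" using B(2)[OF z] nval_nonneg[OF z] nval_le_ntot[OF z] order_trans by (blast, linarith)
      have "0 \<le> ntot z * tval r j z" "ntot z * tval r j z \<le> ntot z"
        using nt t1[OF z] tval_nonneg by (auto intro: mult_left_le)
      then show ?thesis using nt nval_nonneg[OF z, of j] nval_le_ntot[OF z, of j] unfolding a_def by linarith
    qed
    have wB: "\<bar>w j z\<bar> \<le> 2 * B" if z: "norm z = 1" for j z
    proof -
      have "\<bar>\<Sum>k\<in>UNIV. tval r k z * a k z\<bar> \<le> (\<Sum>k\<in>UNIV. tval r k z * B)"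
        using aB[OF z] tval_nonneg
        by (intro order_trans[OF sum_abs] sum_mono) (auto simp: abs_mult intro!: mult_left_mono)
      also have "\<dots> \<le> 1 * B" unfolding sum_distrib_right[symmetric]
        using tval_sum_le[OF r, of z] z B(1) by (intro mult_right_mono) auto
      finally show ?thesis using aB[OF z, of j] unfolding w_def by linarith
    qed
    have "\<exists>g. (\<forall>z. norm z = 1 \<longrightarrow> \<bar>Re (poly g z) - w j z\<bar> < e) \<and>
       (\<forall>z. norm z < 1 \<longrightarrow> norm (poly g z) \<le> 3 * (2 * B + 1) / (1 - norm z))" for j
      using circle_poly_approx_bound[OF cw wB e(1) e1, of j] by metis
    then obtain g where g: "\<And>j z. norm z = 1 \<Longrightarrow> \<bar>Re (poly (g j) z) - w j z\<bar> < e"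
      "\<And>j z. norm z < 1 \<Longrightarrow> norm (poly (g j) z) \<le> 3 * (2 * B + 1) / (1 - norm z)" by metis
    \<comment> \<open>Division by \<open>2 * p j\<close> undoes the exponent in the constraint; the
      shift by \<open>K * e\<close> restores admissibility to second order.\<close>
    define y where "y j z = (poly (g j) z - of_real (K * e)) / of_real (2 * p j)" for j z
    define h where "h j z = F j (of_real r * z) * exp (of_real e * y j z)" for j z
    have h_cont: "continuous_on (cball 0 1) (h j)" for j
      unfolding h_def y_def using p_pos[of j]
      by (intro continuous_intros continuous_on_dilate(1)[OF F_hol r]) auto
    have h_hol: "h j holomorphic_on ball 0 1" for j
      unfolding h_def y_def using p_pos[of j]
      by (intro holomorphic_intros continuous_on_dilate(2)[OF F_hol r]) auto
    have h_powr: "norm (h j z) powr (2 * p j) = tval r j z * exp (e * (Re (poly (g j) z) - K * e))" for j z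
    proof -
      have "Re (y j z) = (Re (poly (g j) z) - K * e) / (2 * p j)"
        unfolding y_def by (simp add: Re_divide_of_real)
      then have "e * Re (y j z) * (2 * p j) = e * (Re (poly (g j) z) - K * e)" using p_pos[of j] by simp
      then show ?thesis
        by (simp add: h_def norm_mult powr_mult tval_def exp_powr_real)
    qed
    have "Re (\<Sum>i=1..m. \<Sum>j\<in>UNIV. c i j * h j (l i)) \<le> Re (\<Sum>i=1..m. \<Sum>j\<in>UNIV. c i j * F j (l i))"
    proof (rule optimal[OF h_hol])
      fix z :: complex assume z: "norm z < 1"
      show "(\<Sum>j\<in>UNIV. norm (h j z) powr (2 * p j)) \<le> 1"
      proof (rule sum_powr_maximum_principle[OF h_cont h_hol _ _ z])
        show "1 \<le> 2 * p j" for j using p_ge[of j] by simp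
        fix u :: complex assume u: "norm u = 1"
        show "(\<Sum>j\<in>UNIV. norm (h j u) powr (2 * p j)) \<le> 1" unfolding h_powr
        proof (rule exponential_weight_bound[where a = "\<lambda>j. a j u" and w = "\<lambda>j. w j u" and B = B])
          show "Re (poly (g j) u) \<le> w j u + e" for j using g(1)[OF u, of j] by linarith
        qed (use tval_nonneg tval_sum_le[OF r] u aB[OF u] B(1) K_def e eK in \<open>auto simp: w_def\<close>)
      qed
    qed
    then have "Re (\<Sum>(i, j)\<in>{1..m} \<times> UNIV. (c i j * F j (of_real r * l i)) * exp (of_real e * y j (l i)))
        \<le> Re (\<Sum>(i, j)\<in>{1..m} \<times> UNIV. d i j)"
      unfolding sum.cartesian_product[symmetric] by (simp add: h_def d_def mult.assoc)
    then have "Re (\<Sum>a\<in>{1..m} \<times> UNIV. (case a of (i, j) \<Rightarrow> c i j * F j (of_real r * l i)) *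
          exp (of_real e * (case a of (i, j) \<Rightarrow> y j (l i))))
        \<le> Re (\<Sum>a\<in>{1..m} \<times> UNIV. case a of (i, j) \<Rightarrow> d i j)"
      by (simp add: case_prod_unfold)
    from first_order_variation[OF _ e(1) eX this]
    have "Re (\<Sum>a\<in>{1..m} \<times> UNIV. (case a of (i, j) \<Rightarrow> d i j) * (case a of (i, j) \<Rightarrow> y j (l i)))
       \<le> 5 * (\<Sum>a\<in>{1..m} \<times> UNIV. norm ((case a of (i, j) \<Rightarrow> c i j * F j (of_real r * l i)) -
            (case a of (i, j) \<Rightarrow> d i j))) / e
         + 3 * e * X\<^sup>2 * (\<Sum>a\<in>{1..m} \<times> UNIV. norm (case a of (i, j) \<Rightarrow> d i j))"
    proof this
      fix a assume a: "a \<in> {1..m} \<times> (UNIV :: 'n set)"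
      obtain i j where ij: "a = (i, j)" by force
      have i: "i \<in> {1..m}" using a ij by auto
      have "norm (y j (l i)) = norm (poly (g j) (l i) - of_real (K * e)) / (2 * p j)"
        unfolding y_def using p_pos[of j] by (simp add: norm_divide)
      also have "\<dots> \<le> norm (poly (g j) (l i) - of_real (K * e)) / 1"
        using p_ge[of j] by (intro divide_left_mono) auto
      also have "\<dots> \<le> norm (poly (g j) (l i)) + K * e"
        using norm_triangle_ineq4[of "poly (g j) (l i)" "of_real (K * e)"] K1 e by (simp add: norm_mult)
      also have "\<dots> \<le> 3 * (2 * B + 1) / (1 - norm (l i)) + 1"
        using g(2)[OF l_disc[OF i]] eK by (intro add_mono) (auto simp: mult.commute)
      also have "3 * (2 * B + 1) / (1 - norm (l i)) \<le> (\<Sum>i=1..m. 3 * (2 * B + 1) / (1 - norm (l i)))"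
        by (rule member_le_sum[OF i]) (use Xterm in auto)
      finally show "norm (case a of (i, j) \<Rightarrow> y j (l i)) \<le> X" by (simp add: ij X_def)
    qed
    then have fo: "Re (\<Sum>j\<in>UNIV. \<Sum>i=1..m. d i j * y j (l i)) \<le> 5 * omega r / e + 3 * e * X\<^sup>2 * S"
      unfolding omega_def S_def by (subst sum.swap, subst sum.cartesian_product) (simp add: case_prod_unfold)
    \<comment> \<open>The reproducing formula turns node values into circle means, where the
      nonnegative density allows \<open>Re (g j)\<close> to be replaced by its lower bound
      \<open>w j - e\<close>.\<close>
    have lower: "(circ_avg (\<lambda>z. density j z * w j z) - (K + 1) * e * circ_avg (density j)) / (2 * p j)
        \<le> Re (\<Sum>i=1..m. d i j * y j (l i))" for j
    proof -
      have "(\<Sum>i=1..m. d i j * y j (l i)) =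
          (\<Sum>i=1..m. d i j * (poly (g j) (l i) - of_real (K * e))) / of_real (2 * p j)"
        by (simp add: y_def sum_divide_distrib)
      then have "Re (\<Sum>i=1..m. d i j * y j (l i)) =
          Re (\<Sum>i=1..m. d i j * (poly (g j) (l i) - of_real (K * e))) / (2 * p j)"
        by (simp only: Re_divide_of_real)
      also have "Re (\<Sum>i=1..m. d i j * (poly (g j) (l i) - of_real (K * e))) =
         circ_avg (\<lambda>z. density j z * Re (poly (g j) z - of_real (K * e)))"
        by (rule density_reproducing_Re[symmetric]) (intro continuous_intros holomorphic_intros)+
      finally have eq: "Re (\<Sum>i=1..m. d i j * y j (l i)) =
        circ_avg (\<lambda>z. density j z * Re (poly (g j) z - of_real (K * e))) / (2 * p j)" .
      have "circ_avg (\<lambda>z. density j z * w j z) - (K + 1) * e * circ_avg (density j)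
         = circ_avg (\<lambda>z. density j z * w j z - (K + 1) * e * density j z)"
        unfolding circ_avg_mult_left[symmetric] by (rule circ_avg_diff[symmetric]) (intro continuous_intros)+
      also have "\<dots> \<le> circ_avg (\<lambda>z. density j z * Re (poly (g j) z - of_real (K * e)))"
      proof (rule circ_avg_mono)
        fix z :: complex assume z: "norm z = 1"
        have "w j z - (K + 1) * e \<le> Re (poly (g j) z) - K * e"
          using g(1)[OF z, of j] by (simp add: algebra_simps)
        then have "density j z * (w j z - (K + 1) * e) \<le> density j z * (Re (poly (g j) z) - K * e)"
          using density_nonneg[OF z] by (intro mult_left_mono) auto
        then show "density j z * w j z - (K + 1) * e * density j z
            \<le> density j z * Re (poly (g j) z - of_real (K * e))" by (simp add: algebra_simps)
      qed (intro continuous_intros)+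
      finally show ?thesis unfolding eq using p_pos[of j] by (intro divide_right_mono) auto
    qed
    \<comment> \<open>The point of this \<open>w\<close>: collecting the terms with
      \<open>nval j\<close> and \<open>ntot\<close> turns the first order gain into a sum of
      squares, so optimality forces every \<open>a j\<close> to be small in the mean.\<close>
    have id: "(\<Sum>j\<in>UNIV. (1 / (2 * p j)) * (density j z * w j z)) = (\<Sum>j\<in>UNIV. (a j z)\<^sup>2) / (2 * lprod z)"
      if z: "norm z = 1" for z
    proof -
      have L: "lprod z > 0" by (rule lprod_pos[OF z])
      have "(\<Sum>j\<in>UNIV. (1 / (2 * p j)) * (density j z * w j z)) = (\<Sum>j\<in>UNIV. nval j z * w j z / (2 * lprod z))"
        by (rule sum.cong) (use L p_pos numer_trig_val[OF z] in \<open>auto simp: nval_def\<close>)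
      also have "\<dots> = (\<Sum>j\<in>UNIV. nval j z * w j z) / (2 * lprod z)" by (simp add: sum_divide_distrib)
      also have "(\<Sum>j\<in>UNIV. nval j z * w j z) = (\<Sum>j\<in>UNIV. nval j z * a j z) - ntot z * (\<Sum>k\<in>UNIV. tval r k z * a k z)"
        by (simp add: w_def right_diff_distrib sum_subtractf sum_distrib_right[symmetric] ntot_def)
      also have "\<dots> = (\<Sum>j\<in>UNIV. (a j z)\<^sup>2)"
        unfolding sum_distrib_left sum_subtractf[symmetric]
        by (rule sum.cong) (auto simp: a_def power2_eq_square algebra_simps)
      finally show ?thesis .
    qed
    have "circ_avg (\<lambda>z. \<Sum>j\<in>UNIV. (a j z)\<^sup>2) \<le> circ_avg (\<lambda>z. (2 * 4 ^ m) * (\<Sum>j\<in>UNIV. (1 / (2 * p j)) * (density j z * w j z)))"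
    proof (rule circ_avg_mono)
      fix z :: complex assume z: "norm z = 1"
      have Q: "(\<Sum>j\<in>UNIV. (a j z)\<^sup>2) \<ge> 0" by (simp add: sum_nonneg)
      have "(\<Sum>j\<in>UNIV. (a j z)\<^sup>2) * lprod z \<le> (\<Sum>j\<in>UNIV. (a j z)\<^sup>2) * 4 ^ m"
        by (rule mult_left_mono[OF lprod_le[OF z] Q])
      then show "(\<Sum>j\<in>UNIV. (a j z)\<^sup>2) \<le> (2 * 4 ^ m) * (\<Sum>j\<in>UNIV. (1 / (2 * p j)) * (density j z * w j z))"
        unfolding id[OF z] using lprod_pos[OF z] by (simp add: field_simps)
    qed (intro continuous_intros)+
    also have "\<dots> = (2 * 4 ^ m) * (\<Sum>j\<in>UNIV. (1 / (2 * p j)) * circ_avg (\<lambda>z. density j z * w j z))"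
    proof -
      have "continuous_on (sphere 0 1) (\<lambda>z. (1 / (2 * p j)) * (density j z * w j z))" for j
        by (intro continuous_on_mult continuous_on_const continuous_on_density cw)
      then show ?thesis by (simp only: circ_avg_mult_left circ_avg_sum[OF finite])
    qed
    also have "(\<Sum>j\<in>UNIV. (1 / (2 * p j)) * circ_avg (\<lambda>z. density j z * w j z)) \<le>
       (5 * omega r / e + 3 * e * X\<^sup>2 * S) + (K + 1) * e * P"
    proof -
      have "(\<Sum>j\<in>UNIV. (circ_avg (\<lambda>z. density j z * w j z) - (K + 1) * e * circ_avg (density j)) / (2 * p j))
         \<le> (\<Sum>j\<in>UNIV. Re (\<Sum>i=1..m. d i j * y j (l i)))" by (rule sum_mono) (rule lower)
      also have "\<dots> \<le> 5 * omega r / e + 3 * e * X\<^sup>2 * S" using fo by (simp only: Re_sum)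
      finally show ?thesis
        by (simp add: P_def diff_divide_distrib sum_subtractf sum_distrib_left)
    qed
    also have "(5 * omega r / e + 3 * e * X\<^sup>2 * S) + (K + 1) * e * P \<le> (5 + 3 * X\<^sup>2 * S + (K + 1) * P) * (e + omega r / e)"
    proof -
      have o: "omega r / e \<ge> 0" using e unfolding omega_def by (intro divide_nonneg_pos sum_nonneg) auto
      have "0 \<le> (3 * X\<^sup>2 * S + (K + 1) * P) * (omega r / e)" using o S0 P0 K1 by (intro mult_nonneg_nonneg add_nonneg_nonneg) auto
      then show ?thesis using e by (simp add: algebra_simps)
    qed
    finally show ?thesis unfolding a_def C_def by (simp add: mult.assoc)
  qed
  show ?thesis using main e0 C0 by blast
qed

lemma modulus_convergence:
  assumes "\<epsilon> > 0"
  shows "eventually (\<lambda>r. circ_avg (\<lambda>z. \<Sum>j\<in>UNIV. (nval j z - ntot z * tval r j z)\<^sup>2) \<le> \<epsilon>) (at_left 1)"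
proof -
  obtain e0 C where "e0 > 0" "C \<ge> 0" and le: "\<And>e r. 0 < e \<Longrightarrow> e \<le> e0 \<Longrightarrow> 0 < r \<Longrightarrow> r < 1 \<Longrightarrow>
     circ_avg (\<lambda>z. \<Sum>j\<in>UNIV. (nval j z - ntot z * tval r j z)\<^sup>2) \<le> C * (e + omega r / e)"
    using modulus_estimate by blast
  then show ?thesis using eventually_small_of_variation[OF le _ omega_tendsto assms] by blast
qed

end

section \<open>Outer factors\<close>

lemma norm_powr_of_real: "norm (w powr of_real s) = norm w powr s" for w :: complex
  by (cases "w = 0") (simp_all add: powr_def)

lemma quotient_half_plane:
  assumes "Re a \<ge> 0" "Re b > 0"
  shows "Re (a / b) \<ge> 0 \<or> Im (a / b) \<noteq> 0"
proof (rule disjCI)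
  assume "\<not> Im (a / b) \<noteq> 0"
  then have r: "a / b = of_real (Re (a / b))" by (simp add: complex_eq_iff)
  have "b \<noteq> 0" using assms(2) by auto
  then have "a = of_real (Re (a / b)) * b" using r by (metis nonzero_eq_divide_eq)
  then have "Re a = Re (a / b) * Re b" by (metis Re_complex_of_real Im_complex_of_real times_complex.sel(1) mult_zero_left diff_zero) 
  then show "Re (a / b) \<ge> 0" using assms by (metis mult_less_0_iff not_less)
qed

lemma Re_one_minus_nonneg:
  assumes "norm a \<le> 1" "norm z \<le> 1" shows "Re (1 - cnj a * z) \<ge> 0"
proof -
  have "Re (cnj a * z) \<le> norm (cnj a * z)" by (rule complex_Re_le_cmod)
  also have "\<dots> \<le> 1" using assms by (simp add: norm_mult mult_le_one)
  finally show ?thesis by simp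
qed

lemma Re_one_minus_pos':
  assumes "norm a < 1" "norm z \<le> 1" shows "Re (1 - cnj a * z) > 0"
proof -
  have "Re (cnj a * z) \<le> norm (cnj a * z)" by (rule complex_Re_le_cmod)
  also have "\<dots> \<le> norm a" using assms by (simp add: norm_mult mult_left_le)
  finally show ?thesis using assms by simp
qed

text \<open>A quotient of numbers with nonnegative and with positive real part stays off the
  negative axis. For \<open>|a| = 1\<close> the base vanishes at the boundary point
  \<open>a\<close>; there \<open>s > 0\<close> gives continuity.\<close>

lemma continuous_on_factor_powr:
  assumes "norm a \<le> 1" "norm a0 < 1" "s > 0"
  shows "continuous_on (cball 0 1) (\<lambda>z. ((1 - cnj a * z) / (1 - cnj a0 * z)) powr of_real s)"
proof (rule continuous_on_powr_complex)
  show "cball 0 1 \<subseteq> {z. 0 \<le> Re ((1 - cnj a * z) / (1 - cnj a0 * z)) \<or> Im ((1 - cnj a * z) / (1 - cnj a0 * z)) \<noteq> 0}"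
  proof
    fix z :: complex assume "z \<in> cball 0 1"
    then have "norm z \<le> 1" by simp
    then show "z \<in> {z. 0 \<le> Re ((1 - cnj a * z) / (1 - cnj a0 * z)) \<or> Im ((1 - cnj a * z) / (1 - cnj a0 * z)) \<noteq> 0}"
      using quotient_half_plane[OF Re_one_minus_nonneg[OF assms(1)] Re_one_minus_pos'[OF assms(2)], of z z] by blast
  qed
  have "1 - cnj a0 * z \<noteq> 0" if "norm z \<le> 1" for z
    using Re_one_minus_pos'[OF assms(2) that] by (metis less_irrefl zero_complex.sel(1))
  then show "continuous_on (cball 0 1) (\<lambda>z. (1 - cnj a * z) / (1 - cnj a0 * z))"
    by (intro continuous_intros) auto
qed (use assms in auto)

lemma holomorphic_on_factor_powr:
  assumes "norm a \<le> 1" "norm a0 \<le> 1"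
  shows "(\<lambda>z. ((1 - cnj a * z) / (1 - cnj a0 * z)) powr w) holomorphic_on ball 0 1"
  by (rule principal_branch(1)[OF assms])

text \<open>\<open>1 - \<eta> w\<close> is a sum of positive multiples of \<open>1 - w\<close> and
  \<open>1 + w\<close>, which enclose no obtuse angle for \<open>|w| <= 1\<close>; so it is at least
  as long as the first summand. The constant tends to 1 with \<open>\<eta>\<close>, so moving a zero
  off the circle costs nothing in the limit.\<close>

lemma norm_one_minus_dilate:
  assumes "norm (w::complex) \<le> 1" "0 < \<eta>" "\<eta> < 1"
  shows "norm (1 - w) \<le> 2 / (1 + \<eta>) * norm (1 - of_real \<eta> * w)"
proof -
  define x where "x = of_real ((1 + \<eta>) / 2) * (1 - w)"
  define y where "y = of_real ((1 - \<eta>) / 2) * (1 + w)"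
  have xy: "x + y = 1 - of_real \<eta> * w" by (simp add: x_def y_def field_simps)
  have "(norm (x + y))\<^sup>2 = (norm x)\<^sup>2 + (norm y)\<^sup>2 + 2 * (x \<bullet> y)"
    by (simp add: power2_norm_eq_inner inner_add inner_commute)
  moreover have "x \<bullet> y \<ge> 0"
  proof -
    have "x \<bullet> y = (1 + \<eta>) / 2 * ((1 - \<eta>) / 2) * (1 - (norm w)\<^sup>2)"
      by (simp add: x_def y_def inner_complex_def cmod_power2) algebra
    moreover have "(norm w)\<^sup>2 \<le> 1" using assms by (simp add: abs_square_le_1)
    ultimately show ?thesis using assms
      by (simp only:) (intro mult_nonneg_nonneg; simp)
  qed
  ultimately have "(norm x)\<^sup>2 \<le> (norm (x + y))\<^sup>2" by simp
  then have "norm x \<le> norm (1 - of_real \<eta> * w)" unfolding xy by (rule power2_le_imp_le) simp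
  moreover have "norm x = (1 + \<eta>) / 2 * norm (1 - w)" using assms
    unfolding x_def norm_mult norm_of_real by simp
  ultimately show ?thesis using assms by (simp add: field_simps)
qed

section \<open>Weak forms of the convergence of moduli\<close>

context extremal_functional
begin

text \<open>The pointwise bound \<open>v <= \<delta> + v^2 / \<delta>\<close> replaces the
  Cauchy-Schwarz inequality.\<close>

lemma modulus_convergence_L1:
  assumes "\<epsilon> > 0"
  shows "eventually (\<lambda>r. circ_avg (\<lambda>z. \<bar>nval j z - ntot z * tval r j z\<bar>) \<le> \<epsilon>) (at_left 1)"
proof -
  define \<delta> where "\<delta> = \<epsilon> / 2"
  have \<delta>: "\<delta> > 0" using assms by (simp add: \<delta>_def)
  have "eventually (\<lambda>r. r \<in> {0<..<1}) (at_left (1::real))"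
    by (rule eventually_at_left_real) simp
  moreover have "eventually (\<lambda>r. circ_avg (\<lambda>z. \<Sum>j\<in>UNIV. (nval j z - ntot z * tval r j z)\<^sup>2) \<le> \<delta>\<^sup>2) (at_left 1)"
    by (rule modulus_convergence) (use \<delta> in simp)
  ultimately show ?thesis
  proof eventually_elim
    case (elim r)
    then have r: "0 < r" "r < 1" by auto
    have "circ_avg (\<lambda>z. \<bar>nval j z - ntot z * tval r j z\<bar>)
        \<le> circ_avg (\<lambda>z. \<delta> + (1 / \<delta>) * (\<Sum>j\<in>UNIV. (nval j z - ntot z * tval r j z)\<^sup>2))"
    proof (rule circ_avg_mono)
      fix z :: complex
      define v where "v = \<bar>nval j z - ntot z * tval r j z\<bar>"
      have "v * \<delta> \<le> \<delta>\<^sup>2 + v\<^sup>2"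
      proof -
        have "0 \<le> v * \<delta>" using \<delta> by (simp add: v_def)
        then show ?thesis using sum_squares_bound[of v \<delta>] by linarith
      qed
      also have "v\<^sup>2 = (nval j z - ntot z * tval r j z)\<^sup>2" by (simp add: v_def)
      also have "\<dots> \<le> (\<Sum>j\<in>UNIV. (nval j z - ntot z * tval r j z)\<^sup>2)"
        by (rule member_le_sum[where f = "\<lambda>j. (nval j z - ntot z * tval r j z)\<^sup>2"]) auto
      finally show "v \<le> \<delta> + (1 / \<delta>) * (\<Sum>j\<in>UNIV. (nval j z - ntot z * tval r j z)\<^sup>2)"
        using \<delta> by (simp add: field_simps power2_eq_square)
    qed (intro continuous_intros r)+
    also have "\<dots> = \<delta> + (1 / \<delta>) * circ_avg (\<lambda>z. \<Sum>j\<in>UNIV. (nval j z - ntot z * tval r j z)\<^sup>2)"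
      by (subst circ_avg_add) (intro continuous_intros r, intro continuous_intros r, simp only: circ_avg_const circ_avg_mult_left)
    also have "\<dots> \<le> \<delta> + (1 / \<delta>) * \<delta>\<^sup>2" using elim(2) \<delta> by (intro add_left_mono mult_left_mono) auto
    also have "\<dots> = \<epsilon>" using \<delta> by (simp add: \<delta>_def power2_eq_square)
    finally show ?case .
  qed
qed

lemma modulus_convergence_weak:
  assumes u: "continuous_on (sphere 0 1) u" and "\<epsilon> > 0"
  shows "eventually (\<lambda>r. \<bar>circ_avg (\<lambda>z. u z * (nval j z - ntot z * tval r j z))\<bar> \<le> \<epsilon>) (at_left 1)"
proof -
  obtain B where B: "B \<ge> 1" "\<And>z. norm z = 1 \<Longrightarrow> \<bar>u z\<bar> \<le> B"
    using sphere_bounded[OF u] by blast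
  have "eventually (\<lambda>r. r \<in> {0<..<1}) (at_left (1::real))"
    by (rule eventually_at_left_real) simp
  moreover have "eventually (\<lambda>r. circ_avg (\<lambda>z. \<bar>nval j z - ntot z * tval r j z\<bar>) \<le> \<epsilon> / B) (at_left 1)"
    by (rule modulus_convergence_L1) (use B assms in simp)
  ultimately show ?thesis
  proof eventually_elim
    case (elim r)
    then have r: "0 < r" "r < 1" by auto
    have "norm (circ_avg (\<lambda>z. u z * (nval j z - ntot z * tval r j z)))
       \<le> circ_avg (\<lambda>z. B * \<bar>nval j z - ntot z * tval r j z\<bar>)"
      by (rule circ_avg_norm_le)
         (use B in \<open>auto intro!: continuous_intros u r mult_right_mono simp: abs_mult\<close>)
    also have "\<dots> \<le> B * (\<epsilon> / B)" unfolding circ_avg_mult_left using elim B by (intro mult_left_mono) auto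
    finally show ?case using B by simp
  qed
qed

text \<open>If the sum vanished, so would every density; the reproducing formula for the constant 1
  would then give the functional the value 0 at \<open>F\<close>.\<close>

lemma numer_sum_neq_0: "(\<Sum>j\<in>UNIV. numer j) \<noteq> 0"
proof
  assume 0: "(\<Sum>j\<in>UNIV. numer j) = 0"
  have "density j z = 0" if z: "norm z = 1" for j z
  proof -
    have "ntot z = trig_val (m - 1) (\<Sum>j\<in>UNIV. numer j) z"
      by (simp add: ntot_def nval_def trig_val_sum)
    then have "ntot z = 0" unfolding 0 by (simp add: trig_val_def)
    then have "nval j z = 0" using nval_nonneg[OF z, of j] nval_le_ntot[OF z, of j] by simp
    then show ?thesis unfolding nval_def numer_trig_val[OF z]
      using lprod_pos[OF z] p_pos[of j] by simp
  qed
  then have "circ_avg (\<lambda>z. of_real (density j z) * (1::complex)) = circ_avg (\<lambda>z. 0)" for j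
    by (intro circ_avg_cong) simp
  then have "(\<Sum>i=1..m. d i j) = 0" for j
    using density_reproducing[of "\<lambda>_. 1" j] by simp
  then have "(\<Sum>j\<in>UNIV. \<Sum>i=1..m. d i j) = 0" by simp
  then have "(\<Sum>i=1..m. \<Sum>j\<in>UNIV. d i j) = 0" by (subst sum.swap)
  then show False using value_pos by (simp add: d_def)
qed

end

section \<open>Comparison of \<open>F\<close> with outer functions\<close>

locale extremal_factored = extremal_functional p m l F c
  for p :: "'n::finite \<Rightarrow> real" and m l F c +
  fixes rr :: "'n \<Rightarrow> real" and r0 :: real and b :: "'n \<Rightarrow> nat \<Rightarrow> complex" and b0 :: "nat \<Rightarrow> complex"
  assumes r0: "r0 > 0" and rr: "rr j \<ge> 0"
    and b0_le: "k \<in> {1..m-1} \<Longrightarrow> norm (b0 k) \<le> 1"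
    and b_le: "k \<in> {1..m-1} \<Longrightarrow> norm (b j k) \<le> 1"
    and b_eq: "k \<in> {1..m-1} \<Longrightarrow> norm (b0 k) = 1 \<Longrightarrow> b j k = b0 k"
    and numer_eq: "numer j = smult (of_real (rr j)) (\<Prod>k=1..m-1. qfac (b j k))"
    and numer_sum_eq: "(\<Sum>j\<in>UNIV. numer j) = smult (of_real r0) (\<Prod>k=1..m-1. qfac (b0 k))"
begin

lemma trig_val_prod_qfac:
  assumes "norm z = 1" "N = smult (of_real x) (\<Prod>k=1..M. qfac (a k))"
  shows "trig_val M N z = x * (\<Prod>k=1..M. (norm (z - a k))\<^sup>2)"
proof (rule trig_val_eqI[OF assms(1)])
  have "poly N z = of_real x * (\<Prod>k=1..M. z * of_real ((norm (z - a k))\<^sup>2))"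
    unfolding assms(2) poly_smult poly_prod poly_qfac circle_factor[OF assms(1)] ..
  then show "poly N z = z ^ M * of_real (x * (\<Prod>k=1..M. (norm (z - a k))\<^sup>2))"
    by (simp add: prod.distrib)
qed

lemma nval_eq: "norm z = 1 \<Longrightarrow> nval j z = rr j * (\<Prod>k=1..m-1. (norm (z - b j k))\<^sup>2)"
  unfolding nval_def by (rule trig_val_prod_qfac[OF _ numer_eq])

lemma ntot_eq: "norm z = 1 \<Longrightarrow> ntot z = r0 * (\<Prod>k=1..m-1. (norm (z - b0 k))\<^sup>2)"
proof -
  assume z: "norm z = 1"
  have "ntot z = trig_val (m - 1) (\<Sum>j\<in>UNIV. numer j) z"
    by (simp add: ntot_def nval_def trig_val_sum)
  then show ?thesis using trig_val_prod_qfac[OF z numer_sum_eq] by simp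
qed

text \<open>On the circle \<open>|K|^(2 p j)\<close> carries the factor \<open>ntot\<close>, so the
  sub-mean inequality for \<open>F j (r z) * K\<close> involves \<open>ntot * tval\<close>, whose
  weak limit \<open>nval\<close> is known. \<open>K\<close> should also divide by the zeros of
  \<open>nval\<close>; those on the circle would be singular, so all are moved to
  \<open>\<eta> * b j k\<close>.\<close>

lemma outer_bound_dilated:
  assumes \<eta>: "0 < \<eta>" "\<eta> < 1" and w: "norm w < 1"
  shows "norm (F j w) powr (2 * p j) *
      (\<Prod>k=1..m-1. (norm (1 - cnj (b0 k) * w))\<^sup>2 / (norm (1 - of_real \<eta> * (cnj (b j k) * w)))\<^sup>2)
     \<le> rr j / r0 * (\<Prod>k=1..m-1. (2 / (1 + \<eta>))\<^sup>2)"
proof -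
  define a where "a k = of_real \<eta> * b j k" for k
  have a1: "norm (a k) < 1" if "k \<in> {1..m-1}" for k
  proof -
    have "norm (a k) \<le> \<eta>" using b_le[OF that] \<eta> by (simp add: a_def norm_mult mult_left_le)
    then show ?thesis using \<eta> by simp
  qed
  have a_eq: "1 - cnj (a k) * z = 1 - of_real \<eta> * (cnj (b j k) * z)" for k z
    by (simp add: a_def mult.assoc)
  have nz: "1 - cnj (a k) * z \<noteq> 0" if "k \<in> {1..m-1}" "norm z \<le> 1" for k z
    using one_minus_cnj_mult_neq_0[of "a k" z] a1[OF that(1)] that(2) by auto
  define K where "K z = (\<Prod>k=1..m-1. ((1 - cnj (b0 k) * z) / (1 - cnj (a k) * z)) powr of_real (1 / p j))" for z
  have K_cont: "continuous_on (cball 0 1) K" unfolding K_def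
    by (intro continuous_on_prod continuous_on_factor_powr b0_le a1) (use p_pos in auto)
  have K_hol: "K holomorphic_on ball 0 1" unfolding K_def
    by (intro holomorphic_on_prod holomorphic_on_factor_powr b0_le less_imp_le[OF a1])
  define G where "G z = (\<Prod>k=1..m-1. (norm (1 - cnj (b0 k) * z))\<^sup>2 / (norm (1 - cnj (a k) * z))\<^sup>2)" for z
  have K_powr: "norm (K z) powr (2 * p j) = G z" for z
  proof -
    have "norm (K z) powr (2 * p j) = (\<Prod>k=1..m-1. norm (((1 - cnj (b0 k) * z) / (1 - cnj (a k) * z)) powr of_real (1 / p j)) powr (2 * p j))"
      unfolding K_def prod_norm[symmetric] by (rule prod_powr_distrib)
    also have "\<dots> = G z" unfolding G_def
    proof (rule prod.cong[OF refl])
      fix k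
      have "norm (((1 - cnj (b0 k) * z) / (1 - cnj (a k) * z)) powr of_real (1 / p j)) powr (2 * p j)
        = norm ((1 - cnj (b0 k) * z) / (1 - cnj (a k) * z)) powr 2"
        unfolding norm_powr_of_real powr_powr using p_pos[of j] by simp
      also have "\<dots> = (norm (1 - cnj (b0 k) * z))\<^sup>2 / (norm (1 - cnj (a k) * z))\<^sup>2"
        by (simp add: norm_divide power_divide)
      finally show "norm (((1 - cnj (b0 k) * z) / (1 - cnj (a k) * z)) powr of_real (1 / p j)) powr (2 * p j)
        = (norm (1 - cnj (b0 k) * z))\<^sup>2 / (norm (1 - cnj (a k) * z))\<^sup>2" .
    qed
    finally show ?thesis .
  qed
  define u where "u z = poisson w z / (r0 * (\<Prod>k=1..m-1. (norm (1 - cnj (a k) * z))\<^sup>2))" for z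
  have u_cont: "continuous_on (sphere 0 1) u" unfolding u_def
    by (intro continuous_intros w) (use r0 nz in \<open>auto simp: prod_zero_iff\<close>)
  \<comment> \<open>This has the shape of a continuous function times \<open>ntot\<close>, to which
    the weak convergence applies.\<close>
  have PG: "poisson w z * G z = u z * ntot z" if z: "norm z = 1" for z
    unfolding u_def G_def ntot_eq[OF z] using r0
    by (simp add: prod_dividef circle_norm_reflect[OF z, of "b0 _"])
  define RHS where "RHS = rr j / r0 * (\<Prod>k=1..m-1. (2 / (1 + \<eta>))\<^sup>2)"
  have u_nval: "u z * nval j z \<le> poisson w z * RHS" if z: "norm z = 1" for z
  proof -
    have "(\<Prod>k=1..m-1. (norm (z - b j k))\<^sup>2 / (norm (1 - cnj (a k) * z))\<^sup>2) \<le> (\<Prod>k=1..m-1. (2 / (1 + \<eta>))\<^sup>2)"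
    proof (rule prod_mono)
      fix k assume k: "k \<in> {1..m-1}"
      have "norm (cnj (b j k) * z) \<le> 1" using b_le[OF k] z by (simp add: norm_mult)
      then have "norm (z - b j k) \<le> 2 / (1 + \<eta>) * norm (1 - cnj (a k) * z)"
        unfolding circle_norm_reflect[OF z, symmetric] a_eq by (intro norm_one_minus_dilate \<eta>)
      then have "norm (z - b j k) / norm (1 - cnj (a k) * z) \<le> 2 / (1 + \<eta>)"
        using nz[OF k, of z] z by (simp add: pos_divide_le_eq)
      then have "(norm (z - b j k) / norm (1 - cnj (a k) * z))\<^sup>2 \<le> (2 / (1 + \<eta>))\<^sup>2"
        by (intro power_mono) auto
      then show "0 \<le> (norm (z - b j k))\<^sup>2 / (norm (1 - cnj (a k) * z))\<^sup>2 \<and>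
         (norm (z - b j k))\<^sup>2 / (norm (1 - cnj (a k) * z))\<^sup>2 \<le> (2 / (1 + \<eta>))\<^sup>2" by (simp add: power_divide)
    qed
    then have "poisson w z * (rr j / r0 * (\<Prod>k=1..m-1. (norm (z - b j k))\<^sup>2 / (norm (1 - cnj (a k) * z))\<^sup>2))
        \<le> poisson w z * RHS"
      unfolding RHS_def using rr[of j] r0 poisson_nonneg[OF w] by (intro mult_left_mono) auto
    moreover have "u z * nval j z = poisson w z * (rr j / r0 * (\<Prod>k=1..m-1. (norm (z - b j k))\<^sup>2 / (norm (1 - cnj (a k) * z))\<^sup>2))"
      unfolding u_def nval_eq[OF z] by (simp add: prod_dividef)
    ultimately show ?thesis by simp
  qed
  have ineq: "eventually (\<lambda>r. norm (F j (of_real r * w)) powr (2 * p j) * G w \<le> RHS + \<epsilon>) (at_left 1)"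
    if \<epsilon>: "\<epsilon> > 0" for \<epsilon>
  proof -
    have "eventually (\<lambda>r. r \<in> {0<..<1}) (at_left (1::real))"
      by (rule eventually_at_left_real) simp
    moreover have "eventually (\<lambda>r. \<bar>circ_avg (\<lambda>z. u z * (nval j z - ntot z * tval r j z))\<bar> \<le> \<epsilon>) (at_left 1)"
      by (rule modulus_convergence_weak[OF u_cont \<epsilon>])
    ultimately show ?thesis
    proof eventually_elim
      case (elim r)
      then have r: "0 < r" "r < 1" by auto
      have "norm (F j (of_real r * w)) powr (2 * p j) * G w = norm (F j (of_real r * w) * K w) powr (2 * p j)"
        by (simp add: norm_mult powr_mult K_powr)
      also have "\<dots> \<le> circ_avg (\<lambda>z. poisson w z * norm (F j (of_real r * z) * K z) powr (2 * p j))"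
        by (rule submean_powr[where H = "\<lambda>z. F j (of_real r * z) * K z"])
           (use p_ge[of j] in \<open>auto intro!: continuous_intros holomorphic_intros continuous_on_dilate[OF F_hol r] K_cont K_hol w\<close>)
      also have "\<dots> = circ_avg (\<lambda>z. u z * nval j z - u z * (nval j z - ntot z * tval r j z))"
      proof (rule circ_avg_cong)
        fix z :: complex assume z: "norm z = 1"
        have "poisson w z * norm (F j (of_real r * z) * K z) powr (2 * p j) = poisson w z * G z * tval r j z"
          by (simp add: norm_mult powr_mult K_powr tval_def)
        then show "poisson w z * norm (F j (of_real r * z) * K z) powr (2 * p j) =
            u z * nval j z - u z * (nval j z - ntot z * tval r j z)"
          unfolding PG[OF z] by (simp add: algebra_simps)
      qed
      also have "\<dots> = circ_avg (\<lambda>z. u z * nval j z) - circ_avg (\<lambda>z. u z * (nval j z - ntot z * tval r j z))"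
        by (rule circ_avg_diff) (intro continuous_intros u_cont r)+
      also have "circ_avg (\<lambda>z. u z * nval j z) \<le> circ_avg (\<lambda>z. poisson w z * RHS)"
        by (rule circ_avg_mono) (intro continuous_intros u_cont w | rule u_nval; assumption)+
      also have "circ_avg (\<lambda>z. poisson w z * RHS) = RHS"
        using circ_avg_mult_left[of RHS "poisson w"] circ_avg_poisson_one[OF w] by (simp add: mult.commute)
      finally show ?case using elim(2) by linarith
    qed
  qed
  have "isCont (F j) (of_real 1 * w)"
    using F_hol[of j] w
    by (metis continuous_on_eq_continuous_at dist_0_norm holomorphic_on_imp_continuous_on mem_ball mult_1 of_real_1 open_ball)
  then have "((\<lambda>r. F j (of_real r * w)) \<longlongrightarrow> F j (of_real 1 * w)) (at_left (1::real))"
    by (rule isCont_tendsto_compose) (intro tendsto_intros)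
  then have lim: "((\<lambda>r. norm (F j (of_real r * w)) powr (2 * p j) * G w) \<longlongrightarrow> norm (F j (of_real 1 * w)) powr (2 * p j) * G w) (at_left (1::real))"
    using p_pos[of j] by (intro tendsto_intros tendsto_powr') auto
  have "norm (F j (of_real 1 * w)) powr (2 * p j) * G w \<le> RHS"
  proof (rule field_le_epsilon)
    fix \<epsilon> :: real assume "\<epsilon> > 0"
    then show "norm (F j (of_real 1 * w)) powr (2 * p j) * G w \<le> RHS + \<epsilon>"
      using tendsto_upperbound[OF lim ineq] by simp
  qed
  then show ?thesis unfolding G_def RHS_def a_eq by simp
qed

end

lemma dilate_uniform:
  fixes u :: "complex \<Rightarrow> 'a::metric_space"
  assumes "continuous_on (cball 0 1) u" "\<epsilon> > 0"
  shows "eventually (\<lambda>r. \<forall>z. norm z = 1 \<longrightarrow> dist (u (of_real r * z)) (u z) < \<epsilon>) (at_left (1::real))"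
proof -
  have "uniformly_continuous_on (cball 0 1) u"
    by (intro compact_uniformly_continuous assms) auto
  then obtain \<delta> where \<delta>: "\<delta> > 0" "\<And>x y. x \<in> cball 0 1 \<Longrightarrow> y \<in> cball 0 1 \<Longrightarrow> dist y x < \<delta> \<Longrightarrow> dist (u y) (u x) < \<epsilon>"
    using assms(2) unfolding uniformly_continuous_on_def by metis
  have "eventually (\<lambda>r. r \<in> {max 0 (1 - \<delta>)<..<1}) (at_left (1::real))"
    by (rule eventually_at_left_real) (use \<delta> in auto)
  then show ?thesis
  proof eventually_elim
    case (elim r)
    show ?case
    proof (intro allI impI \<delta>(2))
      fix z :: complex assume z: "norm z = 1"
      show "z \<in> cball 0 1" "of_real r * z \<in> cball 0 1" using z elim by (auto simp: norm_mult)
      have "dist (of_real r * z) z = norm (of_real (r - 1) * z)"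
        by (simp add: dist_norm algebra_simps)
      also have "\<dots> = 1 - r" using z elim unfolding norm_mult norm_of_real by simp
      finally show "dist (of_real r * z) z < \<delta>" using elim by simp
    qed
  qed
qed

section \<open>Outer functions with the limiting moduli\<close>

context extremal_factored
begin

text \<open>Zeros of \<open>ntot\<close> on the circle are common to all \<open>nval j\<close>; moving them to the origin keeps all
  quotients and places the poles of the outer functions outside the closed disc.\<close>

definition a0 :: "nat \<Rightarrow> complex" where "a0 k = (if norm (b0 k) = 1 then 0 else b0 k)"
definition a :: "'n \<Rightarrow> nat \<Rightarrow> complex" where "a j k = (if norm (b0 k) = 1 then 0 else b j k)"

lemma a0_less: "k \<in> {1..m-1} \<Longrightarrow> norm (a0 k) < 1"
  using b0_le[of k] by (auto simp: a0_def)

lemma a_le: "k \<in> {1..m-1} \<Longrightarrow> norm (a j k) \<le> 1"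
  using b_le[of k j] by (auto simp: a_def)

lemma a0_nz: "k \<in> {1..m-1} \<Longrightarrow> norm z \<le> 1 \<Longrightarrow> 1 - cnj (a0 k) * z \<noteq> 0"
  using one_minus_cnj_mult_neq_0[of "a0 k" z] a0_less[of k] by auto

definition coef :: "'n \<Rightarrow> real" where "coef j = (rr j / r0) powr (1 / (2 * p j))"

definition outer :: "'n \<Rightarrow> complex \<Rightarrow> complex" where
  "outer j z = of_real (coef j) *
     (\<Prod>k=1..m-1. ((1 - cnj (a j k) * z) / (1 - cnj (a0 k) * z)) powr of_real (1 / p j))"

text \<open>A rational stand-in for the outer function, with
  \<open>|outer j|^(2 p j) = |ratio j|^2\<close>. It has no branches, and its squared moduli add up
  to 1 on the circle, so the maximum principle applies to it with all exponents equal to 2.\<close>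

definition ratio :: "'n \<Rightarrow> complex \<Rightarrow> complex" where
  "ratio j z = of_real (sqrt (rr j / r0)) * (\<Prod>k=1..m-1. (1 - cnj (a j k) * z) / (1 - cnj (a0 k) * z))"

lemma coef_powr: "coef j powr (2 * p j) = rr j / r0"
  using p_pos[of j] rr[of j] r0 by (simp add: coef_def powr_powr)

lemma outer_hol: "outer j holomorphic_on ball 0 1"
  unfolding outer_def
  by (intro holomorphic_intros holomorphic_on_prod holomorphic_on_factor_powr a_le less_imp_le[OF a0_less])

lemma ratio_cont: "continuous_on (cball 0 1) (ratio j)"
  unfolding ratio_def by (intro continuous_intros) (use a0_nz in auto)

lemma ratio_hol: "ratio j holomorphic_on ball 0 1"
  unfolding ratio_def by (intro holomorphic_intros) (use a0_nz in auto)

lemma norm_ratio_square: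
  "(norm (ratio j z))\<^sup>2 = rr j / r0 * (\<Prod>k=1..m-1. (norm (1 - cnj (a j k) * z))\<^sup>2 / (norm (1 - cnj (a0 k) * z))\<^sup>2)"
  unfolding ratio_def norm_mult norm_of_real power_mult_distrib prod_norm[symmetric] prod_power_distrib
    norm_divide power_divide power2_abs
  using rr[of j] r0 by simp

lemma outer_powr: "norm (outer j z) powr (2 * p j) = (norm (ratio j z))\<^sup>2"
proof -
  have "norm (outer j z) powr (2 * p j) = coef j powr (2 * p j) *
     (\<Prod>k=1..m-1. norm (((1 - cnj (a j k) * z) / (1 - cnj (a0 k) * z)) powr of_real (1 / p j)) powr (2 * p j))"
    by (simp only: outer_def norm_mult norm_of_real prod_norm[symmetric] powr_mult prod_powr_distrib)
       (simp add: coef_def)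
  also have "(\<Prod>k=1..m-1. norm (((1 - cnj (a j k) * z) / (1 - cnj (a0 k) * z)) powr of_real (1 / p j)) powr (2 * p j))
     = (\<Prod>k=1..m-1. (norm (1 - cnj (a j k) * z))\<^sup>2 / (norm (1 - cnj (a0 k) * z))\<^sup>2)"
  proof (rule prod.cong[OF refl])
    fix k
    have "norm (((1 - cnj (a j k) * z) / (1 - cnj (a0 k) * z)) powr of_real (1 / p j)) powr (2 * p j)
      = norm ((1 - cnj (a j k) * z) / (1 - cnj (a0 k) * z)) powr 2"
      unfolding norm_powr_of_real powr_powr using p_pos[of j] by simp
    also have "\<dots> = (norm (1 - cnj (a j k) * z))\<^sup>2 / (norm (1 - cnj (a0 k) * z))\<^sup>2"
      by (simp add: norm_divide power_divide)
    finally show "norm (((1 - cnj (a j k) * z) / (1 - cnj (a0 k) * z)) powr of_real (1 / p j)) powr (2 * p j)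
      = (norm (1 - cnj (a j k) * z))\<^sup>2 / (norm (1 - cnj (a0 k) * z))\<^sup>2" .
  qed
  finally show ?thesis unfolding coef_powr norm_ratio_square .
qed

text \<open>All terms of the polynomial identity share the factors with \<open>|b0 k| = 1\<close>;
  these are cancelled and replaced by \<open>qfac 0\<close>, the factor \<open>z\<close>.\<close>

lemma sum_identity:
  "(\<Sum>j\<in>UNIV. of_real (rr j) * (\<Prod>k=1..m-1. (z - a j k) * (1 - cnj (a j k) * z)))
     = of_real r0 * (\<Prod>k=1..m-1. (z - a0 k) * (1 - cnj (a0 k) * z))"
proof -
  define Bad where "Bad = {k\<in>{1..m-1}. norm (b0 k) = 1}"
  define G where "G = (\<Prod>k\<in>Bad. qfac (b0 k))"
  define Z where "Z = (\<Prod>k\<in>Bad. qfac 0)"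
  have split: "(\<Prod>k=1..m-1. f k) = (\<Prod>k\<in>Bad. f k) * (\<Prod>k\<in>{1..m-1}-Bad. f k)" for f :: "nat \<Rightarrow> complex poly"
    by (subst mult.commute, rule prod.subset_diff) (auto simp: Bad_def)
  have restA: "(\<Prod>k\<in>{1..m-1}-Bad. qfac (a j k)) = (\<Prod>k\<in>{1..m-1}-Bad. qfac (b j k))" for j
    by (rule prod.cong) (auto simp: Bad_def a_def)
  have restA0: "(\<Prod>k\<in>{1..m-1}-Bad. qfac (a0 k)) = (\<Prod>k\<in>{1..m-1}-Bad. qfac (b0 k))"
    by (rule prod.cong) (auto simp: Bad_def a0_def)
  have badA: "(\<Prod>k\<in>Bad. qfac (a j k)) = Z" for j
    unfolding Z_def by (rule prod.cong) (auto simp: Bad_def a_def)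
  have badA0: "(\<Prod>k\<in>Bad. qfac (a0 k)) = Z"
    unfolding Z_def by (rule prod.cong) (auto simp: Bad_def a0_def)
  have badB: "(\<Prod>k\<in>Bad. qfac (b j k)) = G" for j
    unfolding G_def by (rule prod.cong) (auto simp: Bad_def b_eq)
  have qfac_nz: "qfac c \<noteq> 0" for c
  proof
    assume "qfac c = 0"
    then have "[:-c, 1:] = 0 \<or> [:1, -cnj c:] = 0" by (simp only: mult_eq_0_iff)
    then show False by auto
  qed
  have "finite Bad" by (simp add: Bad_def)
  then have G0: "G \<noteq> 0" unfolding G_def prod_zero_iff[OF \<open>finite Bad\<close>] using qfac_nz by blast
  have "G * (\<Sum>j\<in>UNIV. smult (of_real (rr j)) (\<Prod>k\<in>{1..m-1}-Bad. qfac (b j k)))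
      = (\<Sum>j\<in>UNIV. numer j)"
    unfolding sum_distrib_left numer_eq split badB by (intro sum.cong refl) (simp only: mult_smult_right)
  also have "\<dots> = G * smult (of_real r0) (\<Prod>k\<in>{1..m-1}-Bad. qfac (b0 k))"
    unfolding numer_sum_eq split G_def by (simp only: mult_smult_right)
  finally have "(\<Sum>j\<in>UNIV. smult (of_real (rr j)) (\<Prod>k\<in>{1..m-1}-Bad. qfac (b j k)))
      = smult (of_real r0) (\<Prod>k\<in>{1..m-1}-Bad. qfac (b0 k))"
    by (rule mult_left_cancel[OF G0, THEN iffD1])
  then have "Z * (\<Sum>j\<in>UNIV. smult (of_real (rr j)) (\<Prod>k\<in>{1..m-1}-Bad. qfac (b j k)))
      = Z * smult (of_real r0) (\<Prod>k\<in>{1..m-1}-Bad. qfac (b0 k))" by (rule arg_cong)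
  then have "(\<Sum>j\<in>UNIV. smult (of_real (rr j)) (\<Prod>k=1..m-1. qfac (a j k)))
      = smult (of_real r0) (\<Prod>k=1..m-1. qfac (a0 k))"
    unfolding split badA badA0 restA restA0 sum_distrib_left by (simp only: mult_smult_right)
  then have "poly (\<Sum>j\<in>UNIV. smult (of_real (rr j)) (\<Prod>k=1..m-1. qfac (a j k))) z
      = poly (smult (of_real r0) (\<Prod>k=1..m-1. qfac (a0 k))) z" by (rule arg_cong)
  then show ?thesis unfolding poly_sum poly_smult poly_prod poly_qfac .
qed

lemma ratio_sum_circle:
  assumes z: "norm z = 1" shows "(\<Sum>j\<in>UNIV. (norm (ratio j z))\<^sup>2) = 1"
proof -
  have z0: "z \<noteq> 0" using z by auto
  have pos: "(\<Prod>k=1..m-1. (norm (z - a0 k))\<^sup>2) > 0"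
    by (rule prod_pos) (use a0_less z in fastforce)
  have conv: "of_real x * (\<Prod>k=1..m-1. (z - c k) * (1 - cnj (c k) * z)) =
      z ^ (m - 1) * of_real (x * (\<Prod>k=1..m-1. (norm (z - c k))\<^sup>2))" for x c
    unfolding circle_factor[OF z] prod.distrib by simp
  have "z ^ (m - 1) * of_real (\<Sum>j\<in>UNIV. rr j * (\<Prod>k=1..m-1. (norm (z - a j k))\<^sup>2))
      = z ^ (m - 1) * of_real (r0 * (\<Prod>k=1..m-1. (norm (z - a0 k))\<^sup>2))"
    using sum_identity[of z] unfolding conv by (simp add: sum_distrib_left)
  then have eq: "(\<Sum>j\<in>UNIV. rr j * (\<Prod>k=1..m-1. (norm (z - a j k))\<^sup>2)) = r0 * (\<Prod>k=1..m-1. (norm (z - a0 k))\<^sup>2)"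
    using z0 by (simp only: mult_cancel_left power_eq_0_iff of_real_eq_iff) simp
  have "(\<Sum>j\<in>UNIV. (norm (ratio j z))\<^sup>2) =
     (\<Sum>j\<in>UNIV. rr j * (\<Prod>k=1..m-1. (norm (z - a j k))\<^sup>2)) / (r0 * (\<Prod>k=1..m-1. (norm (z - a0 k))\<^sup>2))"
    unfolding norm_ratio_square circle_norm_reflect[OF z] prod_dividef sum_divide_distrib by simp
  moreover have "r0 * (\<Prod>k=1..m-1. (norm (z - a0 k))\<^sup>2) \<noteq> 0"
    using mult_pos_pos[OF r0 pos] by (metis less_irrefl)
  ultimately show ?thesis unfolding eq by (metis divide_self)
qed

lemma outer_sum_le:
  assumes w: "norm w < 1" shows "(\<Sum>j\<in>UNIV. norm (outer j w) powr (2 * p j)) \<le> 1"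
proof -
  have "(\<Sum>j\<in>UNIV. norm (ratio j w) powr 2) \<le> 1"
    by (rule sum_powr_maximum_principle[OF ratio_cont ratio_hol _ _ w]) (use ratio_sum_circle in auto)
  then show ?thesis unfolding outer_powr by simp
qed

text \<open>The limit \<open>\<eta> -> 1\<close> of the dilated bound. The indices with
  \<open>|b0 k| = 1\<close> contribute 1 there, because then \<open>b j k = b0 k\<close>.\<close>

lemma F_le_outer:
  assumes w: "norm w < 1" shows "norm (F j w) \<le> norm (outer j w)"
proof -
  define g where "g \<eta> = (\<Prod>k=1..m-1. (norm (1 - cnj (b0 k) * w))\<^sup>2 / (norm (1 - of_real \<eta> * (cnj (b j k) * w)))\<^sup>2)" for \<eta>
  have bnz: "1 - cnj (b j k) * w \<noteq> 0" "1 - cnj (b0 k) * w \<noteq> 0" if "k \<in> {1..m-1}" for k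
    using one_minus_cnj_mult_neq_0[of _ w] b_le[OF that] b0_le[OF that] w by auto
  have "eventually (\<lambda>\<eta>. norm (F j w) powr (2 * p j) * g \<eta> \<le> rr j / r0 * (\<Prod>k=1..m-1. (2 / (1 + \<eta>))\<^sup>2)) (at_left 1)"
  proof -
    have "eventually (\<lambda>r. r \<in> {0<..<1}) (at_left (1::real))"
      by (rule eventually_at_left_real) simp
    then show ?thesis by eventually_elim (use outer_bound_dilated[OF _ _ w] g_def in auto)
  qed
  moreover have "((\<lambda>\<eta>. norm (F j w) powr (2 * p j) * g \<eta>) \<longlongrightarrow> norm (F j w) powr (2 * p j) * g 1) (at_left 1)"
    unfolding g_def by (intro tendsto_intros) (use bnz in auto)
  moreover have "((\<lambda>\<eta>. rr j / r0 * (\<Prod>k=1..m-1. (2 / (1 + \<eta>))\<^sup>2)) \<longlongrightarrow> rr j / r0 * (\<Prod>k=1..m-1. (2 / (1 + 1))\<^sup>2)) (at_left (1::real))"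
    by (intro tendsto_intros) auto
  ultimately have le: "norm (F j w) powr (2 * p j) * g 1 \<le> rr j / r0 * (\<Prod>k=1..m-1. (2 / (1 + 1))\<^sup>2)"
    by (intro tendsto_le[OF trivial_limit_at_left_real]) 
  have g1: "g 1 > 0" unfolding g_def by (rule prod_pos) (use bnz in auto)
  have "norm (F j w) powr (2 * p j) \<le> rr j / r0 * (1 / g 1)"
    using le g1 by (simp add: pos_le_divide_eq del: divide_divide_eq_left)
  also have "1 / g 1 = (\<Prod>k=1..m-1. (norm (1 - cnj (a j k) * w))\<^sup>2 / (norm (1 - cnj (a0 k) * w))\<^sup>2)"
    unfolding g_def prod_inversef[symmetric, unfolded inverse_eq_divide comp_def, simplified]
    by (rule sym, rule prod.cong[OF refl]) (use bnz b_eq in \<open>auto simp: a_def a0_def\<close>)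
  finally have "norm (F j w) powr (2 * p j) \<le> norm (outer j w) powr (2 * p j)"
    unfolding outer_powr norm_ratio_square .
  then show ?thesis
    using p_pos[of j] powr_less_mono2[of "2 * p j" "norm (outer j w)" "norm (F j w)"] by (meson norm_ge_zero not_less mult_pos_pos zero_less_numeral)
qed

lemma F_zero: "rr j = 0 \<Longrightarrow> norm w < 1 \<Longrightarrow> F j w = 0"
  using F_le_outer[of w j] by (simp add: outer_def coef_def)

lemma outer_nz: "rr j > 0 \<Longrightarrow> norm w < 1 \<Longrightarrow> outer j w \<noteq> 0"
  using a_le[of _ j] a0_nz[of _ w] one_minus_cnj_mult_neq_0[of _ w] r0
  by (auto simp: outer_def coef_def prod_zero_iff)

definition quot :: "'n \<Rightarrow> complex \<Rightarrow> complex" where "quot j z = F j z / outer j z"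

lemma F_eq_quot: "norm w < 1 \<Longrightarrow> rr j > 0 \<Longrightarrow> F j w = quot j w * outer j w"
  using outer_nz by (simp add: quot_def)

lemma quot_le: "norm w < 1 \<Longrightarrow> norm (quot j w) \<le> 1"
  using F_le_outer[of w j] by (cases "outer j w = 0") (auto simp: quot_def norm_divide divide_le_eq_1)

lemma quot_hol: "rr j > 0 \<Longrightarrow> quot j holomorphic_on ball 0 1"
  unfolding quot_def by (intro holomorphic_intros F_hol outer_hol) (use outer_nz in auto)

text \<open>The outer functions satisfy the constraint jointly and dominate the components of
  \<open>F\<close>. Hence one inner part may be replaced by any function bounded by 1, independently
  of the other components.\<close>

lemma quot_optimal:
  assumes h: "h holomorphic_on ball 0 1" "\<And>z. norm z < 1 \<Longrightarrow> norm (h z) \<le> 1"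
  shows "Re (\<Sum>i=1..m. c i j * outer j (l i) * h (l i)) \<le> Re (\<Sum>i=1..m. d i j)"
proof -
  have "Re (\<Sum>i=1..m. c i j * (outer j (l i) * h (l i))) \<le> Re (\<Sum>i=1..m. d i j)"
  proof (rule optimal_component[where h = "\<lambda>z. outer j z * h z"])
    fix z :: complex assume z: "norm z < 1"
    have "norm (outer j z * h z) powr (2 * p j) \<le> norm (outer j z) powr (2 * p j)"
      using h(2)[OF z] p_pos[of j] by (intro powr_mono2) (auto simp: norm_mult mult_left_le)
    moreover have "(\<Sum>k\<in>UNIV - {j}. norm (F k z) powr (2 * p k)) \<le> (\<Sum>k\<in>UNIV - {j}. norm (outer k z) powr (2 * p k))"
    proof (rule sum_mono)
      fix k show "norm (F k z) powr (2 * p k) \<le> norm (outer k z) powr (2 * p k)"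
        using F_le_outer[OF z] p_pos[of k] by (intro powr_mono2) auto
    qed
    moreover have "(\<Sum>k\<in>UNIV. norm (outer k z) powr (2 * p k)) =
        norm (outer j z) powr (2 * p j) + (\<Sum>k\<in>UNIV - {j}. norm (outer k z) powr (2 * p k))"
      by (rule sum.remove) auto
    ultimately show "norm (outer j z * h z) powr (2 * p j) + (\<Sum>k\<in>UNIV - {j}. norm (F k z) powr (2 * p k)) \<le> 1"
      using outer_sum_le[OF z] by linarith
  qed (intro holomorphic_intros outer_hol h)
  then show ?thesis by (simp add: mult.assoc)
qed

end

section \<open>Inner factors\<close>

lemma circ_maximum_modulus:
  assumes H: "continuous_on (cball 0 1) H" "H holomorphic_on ball 0 1"
    and le: "\<And>z. norm z = 1 \<Longrightarrow> norm (H z) \<le> 1" and w: "norm w < 1"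
  shows "norm (H w) \<le> 1"
proof -
  have cH: "continuous_on (sphere 0 1) H" by (rule continuous_on_subset[OF H(1)]) auto
  have "norm (H w) powr 1 \<le> circ_avg (\<lambda>z. poisson w z * norm (H z) powr 1)"
    by (rule submean_powr[OF H w]) simp
  also have "\<dots> \<le> circ_avg (poisson w)"
    by (rule circ_avg_mono)
       (use le poisson_nonneg[OF w] in \<open>auto intro!: continuous_intros w cH mult_left_le\<close>)
  finally show ?thesis using circ_avg_poisson_one[OF w] by simp
qed

text \<open>On the circle \<open>cnj z ^ n = 1 / z ^ n\<close>, so this is Cauchy's formula for
  Taylor coefficients.\<close>

lemma circ_avg_coefficient:
  assumes "continuous_on (cball 0 1) G" "G holomorphic_on ball 0 1"
  shows "circ_avg (\<lambda>z. cnj z ^ n * G z) = (deriv ^^ n) G 0 / fact n"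
proof -
  have "((\<lambda>u. G u / (u - 0) ^ Suc n) has_contour_integral
      ((2 * pi * \<i>) / fact n * (deriv ^^ n) G 0)) (circlepath 0 1)"
    by (rule Cauchy_has_contour_integral_higher_derivative_circlepath) (use assms in auto)
  then have "((\<lambda>x. G (circlepath 0 1 x) / (circlepath 0 1 x) ^ Suc n *
       (2 * pi * \<i> * exp (2 * of_real pi * \<i> * x))) has_integral
       ((2 * pi * \<i>) / fact n * (deriv ^^ n) G 0)) {0..1}"
    unfolding has_contour_integral by (simp add: vector_derivative_circlepath)
  then have "((\<lambda>x. (1 / (2 * of_real pi * \<i>)) * (G (circlepath 0 1 x) / (circlepath 0 1 x) ^ Suc n *
       (2 * pi * \<i> * exp (2 * of_real pi * \<i> * x)))) has_integral
       (1 / (2 * of_real pi * \<i>)) * ((2 * pi * \<i>) / fact n * (deriv ^^ n) G 0)) {0..1}"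
    by (rule has_integral_mult_right)
  then have "((\<lambda>x. G (circlepath 0 1 x) / (circlepath 0 1 x) ^ n) has_integral
       ((deriv ^^ n) G 0 / fact n)) {0..1}"
    by (simp add: circlepath)
  then have "circ_avg (\<lambda>z. G z / z ^ n) = (deriv ^^ n) G 0 / fact n"
    unfolding circ_avg_def by (rule integral_unique)
  moreover have "circ_avg (\<lambda>z. G z / z ^ n) = circ_avg (\<lambda>z. cnj z ^ n * G z)"
  proof (rule circ_avg_cong)
    fix z :: complex assume z: "norm z = 1"
    then have "z \<noteq> 0" by auto
    then have "cnj z = 1 / z" using unit_mult_cnj[OF z] by (simp add: eq_divide_eq mult.commute)
    then show "G z / z ^ n = cnj z ^ n * G z" by (simp add: power_one_over)
  qed
  ultimately show ?thesis by simp
qed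

text \<open>\<open>1 + x <= exp x\<close>, applied to the squared norm. The bound has exponential
  form so that a factor \<open>exp (- e * g)\<close> can compensate it.\<close>

lemma norm_add_scaled_le_exp:
  fixes q k :: complex
  assumes "norm q \<le> 1" "norm k \<le> C"
  shows "norm (q + of_real e * k) \<le> exp (e * Re (k * cnj q) + (e * C)\<^sup>2 / 2)"
proof -
  have "(norm (q + of_real e * k))\<^sup>2 = (norm q)\<^sup>2 + (norm (of_real e * k))\<^sup>2 + 2 * (q \<bullet> (of_real e * k))"
    by (simp add: power2_norm_eq_inner inner_add inner_commute)
  also have "q \<bullet> (of_real e * k) = e * Re (k * cnj q)"
    by (simp add: inner_complex_def algebra_simps)
  also have "(norm (of_real e * k))\<^sup>2 \<le> (e * C)\<^sup>2"
    unfolding norm_mult norm_of_real power_mult_distrib power2_abs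
    using assms(2) by (intro mult_left_mono power_mono) auto
  also have "(norm q)\<^sup>2 \<le> 1" using assms(1) by (simp add: abs_square_le_1)
  finally have "(norm (q + of_real e * k))\<^sup>2 \<le> 1 + 2 * (e * Re (k * cnj q) + (e * C)\<^sup>2 / 2)" by simp
  also have "\<dots> \<le> exp (2 * (e * Re (k * cnj q) + (e * C)\<^sup>2 / 2))" by (rule exp_ge_add_one_self)
  also have "\<dots> = (exp (e * Re (k * cnj q) + (e * C)\<^sup>2 / 2))\<^sup>2" by (rule exp_double)
  finally show ?thesis by (rule power2_le_imp_le) simp
qed

context extremal_factored
begin

definition omega_quot :: "'n \<Rightarrow> real \<Rightarrow> real" where
  "omega_quot j r = (\<Sum>i=1..m. norm (c i j * outer j (l i) * quot j (of_real r * l i) - d i j))"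

lemma omega_quot_tendsto:
  assumes "rr j > 0"
  shows "(omega_quot j \<longlongrightarrow> 0) (at_left 1)"
  unfolding omega_quot_def
proof (rule tendsto_null_sum)
  fix i assume i: "i \<in> {1..m}"
  have "isCont (quot j) (of_real 1 * l i)"
    using quot_hol[OF assms] l_disc[OF i]
    by (metis continuous_on_eq_continuous_at dist_0_norm holomorphic_on_imp_continuous_on mem_ball mult_1 of_real_1 open_ball)
  then have "((\<lambda>r. quot j (of_real r * l i)) \<longlongrightarrow> quot j (of_real 1 * l i)) (at_left (1::real))"
    by (rule isCont_tendsto_compose) (intro tendsto_intros)
  then have "((\<lambda>r. norm (c i j * outer j (l i) * quot j (of_real r * l i) - d i j)) \<longlongrightarrow>
      norm (c i j * outer j (l i) * quot j (of_real 1 * l i) - d i j)) (at_left (1::real))"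
    by (intro tendsto_intros)
  then show "((\<lambda>r. norm (c i j * outer j (l i) * quot j (of_real r * l i) - d i j)) \<longlongrightarrow> 0) (at_left (1::real))"
    using F_eq_quot[OF l_disc[OF i] assms] by (simp add: d_def mult_ac)
qed

text \<open>Variation of the inner part: \<open>q(r z)\<close> is replaced by \<open>(q(r z) + e k) exp (- e g)\<close> with
  \<open>Re g\<close> close to \<open>Re (k cnj (q(r z)))\<close> on the circle, so that the modulus stays at most 1.\<close>

lemma inner_variation:
  assumes j: "rr j > 0" and k: "\<And>i. i \<in> {1..m} \<Longrightarrow> poly k (l i) = 0" and \<epsilon>: "\<epsilon> > 0"
  shows "eventually (\<lambda>r. - circ_avg (\<lambda>z. density j z * Re (poly k z * cnj (quot j (of_real r * z)))) \<le> \<epsilon>) (at_left 1)"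
proof -
  have "continuous_on (sphere 0 1) (\<lambda>z. norm (poly k z))" by (intro continuous_intros)
  then obtain C where C: "C \<ge> 1" "\<And>z. norm z = 1 \<Longrightarrow> \<bar>norm (poly k z)\<bar> \<le> C"
    using sphere_bounded by blast
  \<comment> \<open>The 1 pays for the distance of \<open>Re g\<close> from \<open>w\<close>, and
    \<open>C\<^sup>2\<close> for the quadratic term in \<open>|q + e k|\<close>.\<close>
  define K where "K = 1 + C\<^sup>2"
  define X where "X = (\<Sum>i=1..m. 3 * (C + 1) / (1 - norm (l i))) + 1"
  define S where "S = (\<Sum>i=1..m. norm (d i j))"
  define P where "P = circ_avg (density j)"
  define e0 where "e0 = 1 / (K + X)"
  have K1: "K \<ge> 1" by (simp add: K_def)
  have Xterm: "3 * (C + 1) / (1 - norm (l i)) \<ge> 0" if "i \<in> {1..m}" for i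
    using l_disc[OF that] C(1) by simp
  have "(\<Sum>i=1..m. 3 * (C + 1) / (1 - norm (l i))) \<ge> 0" by (rule sum_nonneg) (rule Xterm)
  then have X1: "X \<ge> 1" by (simp add: X_def)
  have S0: "S \<ge> 0" unfolding S_def by (intro sum_nonneg) auto
  have P0: "P \<ge> 0" unfolding P_def
    using circ_avg_mono[of "\<lambda>_. 0" "density j"] density_nonneg by (auto intro: continuous_intros)
  have e0: "e0 > 0" using K1 X1 by (simp add: e0_def)
  have main: "- circ_avg (\<lambda>z. density j z * Re (poly k z * cnj (quot j (of_real r * z))))
      \<le> (5 + 3 * X\<^sup>2 * S + (K + 1) * P) * (e + omega_quot j r / e)"
    if e: "0 < e" "e \<le> e0" and r: "0 < r" "r < 1" for e r
  proof -
    have eKX: "e * (K + X) \<le> 1" using e K1 X1 by (simp add: e0_def pos_le_divide_eq)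
    then have eK: "e * K \<le> 1" and eX: "e * X \<le> 1" using e K1 X1 by (simp_all add: distrib_left)
        (smt (verit) mult_nonneg_nonneg)+
    have e1: "e \<le> 1" using eK K1 e mult_left_mono[of 1 K e] by linarith
    define qr where "qr z = quot j (of_real r * z)" for z
    have qr_cont: "continuous_on (cball 0 1) qr" and qr_hol: "qr holomorphic_on ball 0 1"
      unfolding qr_def using continuous_on_dilate[OF quot_hol[OF j] r] by auto
    have qr_cont': "continuous_on (sphere 0 1) qr" by (rule continuous_on_subset[OF qr_cont]) auto
    have qr_le: "norm (qr z) \<le> 1" if "norm z = 1" for z
      unfolding qr_def by (rule quot_le) (use that r in \<open>simp add: norm_mult\<close>)
    define w where "w z = Re (poly k z * cnj (qr z))" for z
    have cw: "continuous_on (sphere 0 1) w" unfolding w_def by (intro continuous_intros qr_cont')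
    have wC: "\<bar>w z\<bar> \<le> C" if z: "norm z = 1" for z
    proof -
      have "\<bar>w z\<bar> \<le> norm (poly k z) * norm (qr z)"
        unfolding w_def using abs_Re_le_cmod[of "poly k z * cnj (qr z)"] by (simp add: norm_mult)
      also have "\<dots> \<le> norm (poly k z)" using qr_le[OF z] by (intro mult_left_le) auto
      finally show ?thesis using C(2)[OF z] by simp
    qed
    obtain g where g: "\<And>z. norm z = 1 \<Longrightarrow> \<bar>Re (poly g z) - w z\<bar> < e"
      "\<And>z. norm z < 1 \<Longrightarrow> norm (poly g z) \<le> 3 * (C + 1) / (1 - norm z)"
      using circle_poly_approx_bound[OF cw wC e(1) e1] by metis
    define y where "y z = - (poly g z + of_real (K * e))" for z
    define h where "h z = (qr z + of_real e * poly k z) * exp (of_real e * y z)" for z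
    have h_cont: "continuous_on (cball 0 1) h" and h_hol: "h holomorphic_on ball 0 1"
      unfolding h_def y_def by (intro continuous_intros holomorphic_intros qr_cont qr_hol)+
    have "Re (\<Sum>i=1..m. c i j * outer j (l i) * h (l i)) \<le> Re (\<Sum>i=1..m. d i j)"
    proof (rule quot_optimal[OF h_hol])
      fix z :: complex assume z: "norm z < 1"
      show "norm (h z) \<le> 1"
      proof (rule circ_maximum_modulus[OF h_cont h_hol _ z])
        fix u :: complex assume u: "norm u = 1"
        have "norm (h u) = norm (qr u + of_real e * poly k u) * exp (e * Re (y u))"
          by (simp add: h_def norm_mult)
        also have "\<dots> \<le> exp (e * w u + (e * C)\<^sup>2 / 2) * exp (e * Re (y u))"
          unfolding w_def using C(2)[OF u]
          by (intro mult_right_mono norm_add_scaled_le_exp qr_le[OF u]) auto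
        also have "\<dots> = exp (e * (w u + e * C\<^sup>2 / 2 + Re (y u)))"
          by (simp add: exp_add[symmetric] power2_eq_square algebra_simps)
        also have "\<dots> \<le> exp 0"
        proof -
          have "e * C\<^sup>2 \<ge> 0" using e by simp
          moreover have "Re (y u) \<le> - w u + e - K * e" using g(1)[OF u] by (simp add: y_def)
          moreover have "K * e = e + e * C\<^sup>2" by (simp add: K_def algebra_simps)
          ultimately have "w u + e * C\<^sup>2 / 2 + Re (y u) \<le> 0" by linarith
          then have "e * (w u + e * C\<^sup>2 / 2 + Re (y u)) \<le> 0" using e by (simp add: mult_nonneg_nonpos)
          then show ?thesis by (simp only: exp_le_cancel_iff)
        qed
        finally show "norm (h u) \<le> 1" by simp
      qed
    qed
    \<comment> \<open>The summand \<open>e * k\<close> vanishes at the nodes: the constraint sees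
      it, but the functional sees only the exponential factor.\<close>
    moreover have "(\<Sum>i=1..m. c i j * outer j (l i) * h (l i)) =
        (\<Sum>i=1..m. (c i j * outer j (l i) * quot j (of_real r * l i)) * exp (of_real e * y (l i)))"
      by (rule sum.cong) (auto simp: h_def qr_def k)
    ultimately have le: "Re (\<Sum>i=1..m. (c i j * outer j (l i) * quot j (of_real r * l i)) * exp (of_real e * y (l i)))
        \<le> Re (\<Sum>i=1..m. d i j)" by (simp only:)
    have fo: "Re (\<Sum>i=1..m. d i j * y (l i)) \<le> 5 * omega_quot j r / e + 3 * e * X\<^sup>2 * S"
      unfolding omega_quot_def S_def
    proof (rule first_order_variation[OF _ e(1) eX le])
      fix i assume i: "i \<in> {1..m}"
      have "norm (y (l i)) \<le> norm (poly g (l i)) + K * e"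
        using norm_triangle_ineq[of "poly g (l i)" "of_real (K * e)"] K1 e
        by (simp only: y_def norm_minus_cancel norm_of_real) simp
      also have "\<dots> \<le> 3 * (C + 1) / (1 - norm (l i)) + 1"
        using g(2)[OF l_disc[OF i]] eK by (intro add_mono) (auto simp: mult.commute)
      also have "3 * (C + 1) / (1 - norm (l i)) \<le> (\<Sum>i=1..m. 3 * (C + 1) / (1 - norm (l i)))"
        by (rule member_le_sum[OF i]) (use Xterm in auto)
      finally show "norm (y (l i)) \<le> X" by (simp add: X_def)
    qed
    have "Re (\<Sum>i=1..m. d i j * y (l i)) = circ_avg (\<lambda>z. density j z * Re (y z))"
      unfolding y_def by (rule density_reproducing_Re[symmetric]) (intro continuous_intros holomorphic_intros)+
    moreover have "circ_avg (\<lambda>z. - 1 * (density j z * w z) + (- ((K + 1) * e)) * density j z)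
        \<le> circ_avg (\<lambda>z. density j z * Re (y z))"
    proof (rule circ_avg_mono)
      fix z :: complex assume z: "norm z = 1"
      have "- w z - (K + 1) * e \<le> Re (y z)"
        using g(1)[OF z] by (simp add: y_def algebra_simps)
      then have "density j z * (- w z - (K + 1) * e) \<le> density j z * Re (y z)"
        using density_nonneg[OF z] by (intro mult_left_mono) auto
      then show "- 1 * (density j z * w z) + (- ((K + 1) * e)) * density j z \<le> density j z * Re (y z)"
        by (simp add: algebra_simps)
    qed (use cw in \<open>auto intro!: continuous_intros simp: y_def\<close>)
    moreover have "circ_avg (\<lambda>z. - 1 * (density j z * w z) + (- ((K + 1) * e)) * density j z)
        = - 1 * circ_avg (\<lambda>z. density j z * w z) + (- ((K + 1) * e)) * P"
      unfolding P_def circ_avg_mult_left[symmetric] by (rule circ_avg_add) (intro continuous_intros cw)+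
    ultimately have "- circ_avg (\<lambda>z. density j z * w z) \<le> 5 * omega_quot j r / e + 3 * e * X\<^sup>2 * S + (K + 1) * e * P"
      using fo by simp
    also have "\<dots> \<le> (5 + 3 * X\<^sup>2 * S + (K + 1) * P) * (e + omega_quot j r / e)"
    proof -
      have o: "omega_quot j r / e \<ge> 0" using e unfolding omega_quot_def by (intro divide_nonneg_pos sum_nonneg) auto
      have "0 \<le> (3 * X\<^sup>2 * S + (K + 1) * P) * (omega_quot j r / e)" using o S0 P0 K1 by (intro mult_nonneg_nonneg add_nonneg_nonneg) auto
      then show ?thesis using e by (simp add: algebra_simps)
    qed
    finally show ?thesis unfolding w_def qr_def .
  qed
  show ?thesis
    by (rule eventually_small_of_variation[OF main e0 omega_quot_tendsto[OF j] \<epsilon>]) (use S0 P0 K1 in auto)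
qed

text \<open>The one-sided estimate is applied to \<open>k\<close> times each of \<open>1\<close>,
  \<open>-1\<close>, \<open>\<i>\<close>, \<open>-\<i>\<close>, which bounds the real and the
  imaginary part of the mean from both sides.\<close>

lemma quot_orthogonal:
  assumes j: "rr j > 0" and k: "\<And>i. i \<in> {1..m} \<Longrightarrow> poly k (l i) = 0"
  shows "((\<lambda>r. circ_avg (\<lambda>z. of_real (density j z) * (poly k z * cnj (quot j (of_real r * z))))) \<longlongrightarrow> 0) (at_left 1)"
proof (rule tendstoI)
  fix \<epsilon> :: real assume \<epsilon>: "\<epsilon> > 0"
  define I where "I k r = circ_avg (\<lambda>z. density j z * Re (poly k z * cnj (quot j (of_real r * z))))" for k r
  have ev: "eventually (\<lambda>r. - I (smult v k) r \<le> \<epsilon> / 4) (at_left 1)" for v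
    unfolding I_def by (rule inner_variation[OF j]) (use k \<epsilon> in auto)
  have "eventually (\<lambda>r. r \<in> {0<..<1}) (at_left (1::real))"
    by (rule eventually_at_left_real) simp
  with ev[of 1] ev[of "-1"] ev[of \<i>] ev[of "-\<i>"]
  show "eventually (\<lambda>r. dist (circ_avg (\<lambda>z. of_real (density j z) * (poly k z * cnj (quot j (of_real r * z))))) 0 < \<epsilon>) (at_left 1)"
  proof eventually_elim
    case (elim r)
    then have r: "0 < r" "r < 1" by auto
    define J where "J = circ_avg (\<lambda>z. of_real (density j z) * (poly k z * cnj (quot j (of_real r * z))))"
    have cq: "continuous_on (sphere 0 1) (\<lambda>z. quot j (of_real r * z))"
      by (rule continuous_on_subset[OF continuous_on_dilate(1)[OF quot_hol[OF j] r]]) auto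
    have Iv: "I (smult v k) r = Re (v * J)" for v
    proof -
      have "v * J = circ_avg (\<lambda>z. v * (of_real (density j z) * (poly k z * cnj (quot j (of_real r * z)))))"
        unfolding J_def by (rule circ_avg_mult_left[symmetric])
      then have "Re (v * J) = circ_avg (\<lambda>z. Re (v * (of_real (density j z) * (poly k z * cnj (quot j (of_real r * z))))))"
        by (simp only:, intro circ_avg_linear[symmetric] continuous_intros cq bounded_linear_Re)
      also have "\<dots> = I (smult v k) r"
        unfolding I_def
      proof (rule circ_avg_cong)
        fix z
        have "v * (of_real (density j z) * (poly k z * cnj (quot j (of_real r * z)))) =
          of_real (density j z) * (poly (smult v k) z * cnj (quot j (of_real r * z)))" by (simp add: mult_ac)
        then show "Re (v * (of_real (density j z) * (poly k z * cnj (quot j (of_real r * z))))) =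
            density j z * Re (poly (smult v k) z * cnj (quot j (of_real r * z)))"
          by (simp only: Re_complex_of_real Im_complex_of_real times_complex.sel(1)[of "of_real _"])
      qed
      finally show ?thesis by simp
    qed
    have "\<bar>Re J\<bar> \<le> \<epsilon> / 4" "\<bar>Im J\<bar> \<le> \<epsilon> / 4" using elim unfolding Iv by auto
    then have "norm J < \<epsilon>" using cmod_le[of J] \<epsilon> by linarith
    then show ?case by (simp add: J_def)
  qed
qed

text \<open>Orthogonality to the multiples of \<open>\<Prod>(z - l i) (1 - cnj (l i) z)\<close> by
  monomials says that the Taylor coefficients of \<open>numer j * quot j\<close> of order above
  \<open>2 * (m - 1)\<close> vanish.\<close>

lemma quot_numer_polynomial:
  assumes j: "rr j > 0"
  shows "\<exists>Q. degree Q \<le> 2 * (m - 1) \<and> (\<forall>z. norm z < 1 \<longrightarrow> quot j z * poly (numer j) z = poly Q z)"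
proof -
  define M where "M = m - 1"
  define G where "G z = poly (numer j) z * quot j z" for z
  have G_hol: "G holomorphic_on ball 0 1" unfolding G_def by (intro holomorphic_intros quot_hol j)
  have coeff0: "(deriv ^^ n) G 0 = 0" if n: "n > 2 * M" for n
  proof -
    \<comment> \<open>\<open>2 * M + 1 = M + m\<close>: \<open>M\<close> powers of \<open>z\<close>
      belong to \<open>numer j\<close>, \<open>m\<close> to the product over the nodes, and the
      remaining \<open>s\<close> to the monomial.\<close>
    define s where "s = n - (2 * M + 1)"
    have nm: "n = M + (s + m)" using n m_pos by (simp add: s_def M_def)
    define k where "k = monom 1 s * (\<Prod>i=1..m. qfac (l i))"
    have kl: "poly k (l i) = 0" if "i \<in> {1..m}" for i
      unfolding k_def poly_mult[of "monom _ _"] poly_prod poly_qfac using that by (auto simp: prod_zero_iff)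
    define J where "J r = circ_avg (\<lambda>z. of_real (density j z) * (poly k z * cnj (quot j (of_real r * z))))" for r
    have J0: "(J \<longlongrightarrow> 0) (at_left 1)" unfolding J_def by (rule quot_orthogonal[OF j kl])
    \<comment> \<open>The Leibniz sum for the \<open>n\<close>-th derivative at 0 of
      \<open>numer j (z) * quot j (r z)\<close>. Being finite, it passes to the limit
      \<open>r = 1\<close>, where it is the derivative of \<open>G\<close>.\<close>
    define T where "T r = (\<Sum>i=0..n. of_nat (n choose i) * (deriv ^^ i) (poly (numer j)) 0 *
        (of_real r ^ (n - i) * (deriv ^^ (n - i)) (quot j) 0))" for r :: real
    have JT: "cnj (J r) = of_real (p j) * (T r / fact n)" if r: "0 < r" "r < 1" for r
    proof -
      have q1: "continuous_on (cball 0 1) (\<lambda>z. quot j (of_real r * z))" 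
        and q2: "(\<lambda>z. quot j (of_real r * z)) holomorphic_on ball 0 1"
        using continuous_on_dilate[OF quot_hol[OF j] r] by auto
      have q3: "continuous_on (sphere 0 1) (\<lambda>z. quot j (of_real r * z))"
        by (rule continuous_on_subset[OF q1]) auto
      have "cnj (J r) = circ_avg (\<lambda>z. cnj (of_real (density j z) * (poly k z * cnj (quot j (of_real r * z)))))"
        unfolding J_def by (rule circ_avg_linear[symmetric]) (intro continuous_intros q3 bounded_linear_cnj)+
      also have "\<dots> = circ_avg (\<lambda>z. of_real (p j) * (cnj z ^ n * (poly (numer j) z * quot j (of_real r * z))))"
      proof (rule circ_avg_cong)
        fix z :: complex assume z: "norm z = 1"
        have zz: "cnj z ^ M * z ^ M = 1"
          using unit_mult_cnj[OF z] by (metis mult.commute power_mult_distrib power_one)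
        have "poly k z = z ^ s * (\<Prod>i=1..m. z * of_real ((norm (z - l i))\<^sup>2))"
          unfolding k_def poly_mult[of "monom _ _"] poly_prod poly_qfac circle_factor[OF z] by (simp add: poly_monom)
        also have "\<dots> = z ^ (s + m) * of_real (lprod z)"
          by (simp add: prod.distrib lprod_def power_add)
        finally have "cnj (poly k z) = cnj z ^ (s + m) * of_real (lprod z)" by simp
        moreover have "cnj z ^ n * poly (numer j) z = (cnj z ^ M * z ^ M) * cnj z ^ (s + m) * of_real (density j z / p j * lprod z)"
          unfolding numer_val[OF z] nm power_add[of _ M] by (simp add: M_def mult_ac)
        then have "cnj z ^ n * poly (numer j) z = cnj z ^ (s + m) * of_real (density j z / p j * lprod z)"
          unfolding zz by simp
        moreover have "cnj (of_real (density j z) * (poly k z * cnj (quot j (of_real r * z))))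
          = of_real (density j z) * cnj (poly k z) * quot j (of_real r * z)" by simp
        moreover have "of_real (p j) * (cnj z ^ n * (poly (numer j) z * quot j (of_real r * z)))
          = of_real (p j) * (cnj z ^ n * poly (numer j) z) * quot j (of_real r * z)" by (simp only: mult.assoc)
        ultimately show "cnj (of_real (density j z) * (poly k z * cnj (quot j (of_real r * z))))
          = of_real (p j) * (cnj z ^ n * (poly (numer j) z * quot j (of_real r * z)))"
          using p_pos[of j] by simp
      qed
      also have "\<dots> = of_real (p j) * circ_avg (\<lambda>z. cnj z ^ n * (poly (numer j) z * quot j (of_real r * z)))"
        by (rule circ_avg_mult_left)
      also have "circ_avg (\<lambda>z. cnj z ^ n * (poly (numer j) z * quot j (of_real r * z)))
         = (deriv ^^ n) (\<lambda>z. poly (numer j) z * quot j (of_real r * z)) 0 / fact n"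
        by (rule circ_avg_coefficient) (intro continuous_intros holomorphic_intros q1 q2)+
      also have "(deriv ^^ n) (\<lambda>z. poly (numer j) z * quot j (of_real r * z)) 0 =
         (\<Sum>i=0..n. of_nat (n choose i) * (deriv ^^ i) (poly (numer j)) 0 *
           (deriv ^^ (n - i)) (\<lambda>z. quot j (of_real r * z)) 0)"
        by (rule higher_deriv_mult[of _ "ball 0 1"]) (auto intro!: holomorphic_intros q2)
      also have "\<dots> = T r" unfolding T_def
      proof (rule sum.cong[OF refl])
        fix i
        have "(deriv ^^ (n - i)) (\<lambda>z. quot j (of_real r * z)) 0 = of_real r ^ (n - i) * (deriv ^^ (n - i)) (quot j) (of_real r * 0)"
          by (rule higher_deriv_compose_linear[OF quot_hol[OF j], of "ball 0 1"])
             (use r in \<open>auto simp: norm_mult intro: le_less_trans[OF mult_left_le_one_le]\<close>)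
        then show "of_nat (n choose i) * (deriv ^^ i) (poly (numer j)) 0 * (deriv ^^ (n - i)) (\<lambda>z. quot j (of_real r * z)) 0 =
          of_nat (n choose i) * (deriv ^^ i) (poly (numer j)) 0 * (of_real r ^ (n - i) * (deriv ^^ (n - i)) (quot j) 0)" by simp
      qed
      finally show ?thesis .
    qed
    have "((\<lambda>r. cnj (J r)) \<longlongrightarrow> cnj 0) (at_left 1)" by (intro tendsto_cnj J0)
    moreover have "eventually (\<lambda>r. cnj (J r) = of_real (p j) * (T r / fact n)) (at_left 1)"
    proof -
      have "eventually (\<lambda>r. r \<in> {0<..<1}) (at_left (1::real))"
        by (rule eventually_at_left_real) simp
      then show ?thesis by eventually_elim (use JT in auto)
    qed
    ultimately have "((\<lambda>r. of_real (p j) * (T r / fact n)) \<longlongrightarrow> 0) (at_left 1)"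
      by (simp add: tendsto_cong)
    moreover have "((\<lambda>r. of_real (p j) * (T r / fact n)) \<longlongrightarrow> of_real (p j) * (T 1 / fact n)) (at_left 1)"
      unfolding T_def by (intro tendsto_intros) auto
    ultimately have "of_real (p j) * (T 1 / fact n) = 0"
      using tendsto_unique[OF trivial_limit_at_left_real] by blast
    then have "T 1 = 0" using p_pos[of j] by simp
    moreover have "(deriv ^^ n) G 0 = T 1"
    proof -
      have "(deriv ^^ n) (\<lambda>z. poly (numer j) z * quot j z) 0 =
         (\<Sum>i=0..n. of_nat (n choose i) * (deriv ^^ i) (poly (numer j)) 0 * (deriv ^^ (n - i)) (quot j) 0)"
        by (rule higher_deriv_mult[of _ "ball 0 1"]) (auto intro!: holomorphic_intros quot_hol j)
      then show ?thesis by (simp add: T_def G_def[abs_def])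
    qed
    ultimately show ?thesis by simp
  qed
  define Q where "Q = (\<Sum>n\<le>2 * M. monom ((deriv ^^ n) G 0 / fact n) n)"
  have "quot j z * poly (numer j) z = poly Q z" if z: "norm z < 1" for z
  proof -
    have "(\<lambda>n. (deriv ^^ n) G 0 / fact n * (z - 0) ^ n) sums G z"
      by (rule holomorphic_power_series[OF G_hol]) (use z in simp)
    moreover have "(\<lambda>n. (deriv ^^ n) G 0 / fact n * (z - 0) ^ n) sums (\<Sum>n\<le>2 * M. (deriv ^^ n) G 0 / fact n * (z - 0) ^ n)"
      by (rule sums_finite) (use coeff0 in auto)
    ultimately have "G z = (\<Sum>n\<le>2 * M. (deriv ^^ n) G 0 / fact n * (z - 0) ^ n)"
      using sums_unique2 by blast
    then show ?thesis by (simp add: Q_def poly_sum poly_monom G_def mult.commute)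
  qed
  moreover have "degree Q \<le> 2 * M" unfolding Q_def
    by (rule degree_sum_le) (auto intro: order_trans[OF degree_monom_le])
  ultimately show ?thesis unfolding M_def by blast
qed

end

text \<open>The form \<open>(\<ast>\<^sub>m)\<close> restricted to the components with index in \<open>J\<close>.\<close>

definition star_on :: "nat \<Rightarrow> ('n::finite \<Rightarrow> real) \<Rightarrow> 'n set \<Rightarrow> ('n \<Rightarrow> complex \<Rightarrow> complex) \<Rightarrow> bool" where
  "star_on m p J F \<longleftrightarrow>
     (\<exists>A \<alpha> \<alpha>0 r. (\<forall>j\<in>J. A j \<noteq> 0) \<and>
        (\<forall>k\<in>{1..m-1}. norm (\<alpha>0 k) < 1 \<and> (\<forall>j. norm (\<alpha> k j) \<le> 1 \<and> r k j \<in> {0, 1::nat})) \<and>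
        (\<forall>z. (\<Sum>j\<in>J. complex_of_real (norm (A j) powr (2 * p j)) *
               (\<Prod>k=1..m-1. (z - \<alpha> k j) * (1 - cnj (\<alpha> k j) * z)))
            = (\<Prod>k=1..m-1. (z - \<alpha>0 k) * (1 - cnj (\<alpha>0 k) * z))) \<and>
        (\<forall>j\<in>J. \<forall>z. norm z < 1 \<longrightarrow> F j z = A j * (\<Prod>k=1..m-1.
           ((z - \<alpha> k j) / (1 - cnj (\<alpha> k j) * z)) ^ r k j *
           ((1 - cnj (\<alpha> k j) * z) / (1 - cnj (\<alpha>0 k) * z)) powr complex_of_real (1 / p j))))"

section \<open>Boundary modulus of the inner part and the final form\<close>

context extremal_factored
begin

lemma ntot_ratio:
  assumes z: "norm z = 1" shows "ntot z * (norm (ratio j z))\<^sup>2 = nval j z"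
proof -
  have "(\<Prod>k=1..m-1. (norm (z - b0 k))\<^sup>2) * (\<Prod>k=1..m-1. (norm (z - a j k))\<^sup>2 / (norm (z - a0 k))\<^sup>2)
     = (\<Prod>k=1..m-1. (norm (z - b j k))\<^sup>2)"
    unfolding prod.distrib[symmetric]
  proof (rule prod.cong[OF refl])
    fix k assume k: "k \<in> {1..m-1}"
    have "z \<noteq> b0 k" if "norm (b0 k) \<noteq> 1" using z that by auto
    then show "(norm (z - b0 k))\<^sup>2 * ((norm (z - a j k))\<^sup>2 / (norm (z - a0 k))\<^sup>2) = (norm (z - b j k))\<^sup>2"
      using b_eq[OF k] z by (auto simp: a_def a0_def)
  qed
  then show ?thesis
    unfolding ntot_eq[OF z] nval_eq[OF z] norm_ratio_square circle_norm_reflect[OF z]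
    using r0 by (simp add: mult_ac)
qed

text \<open>With \<open>x = |q(r w)|\<close>, mean convergence makes
  \<open>nval * (1 - x powr (2 * p j))\<close> small, and \<open>2 * p j >= 1\<close> then makes
  \<open>nval * (1 - x)\<close> small. So \<open>|Q|\<close> and \<open>nval\<close> differ by zero
  in the mean; as both are continuous they agree, without any boundary value of
  \<open>q\<close>.\<close>

lemma quot_numer_modulus:
  assumes j: "rr j > 0" and Q: "\<And>z. norm z < 1 \<Longrightarrow> quot j z * poly (numer j) z = poly Q z" and z: "norm z = 1"
  shows "norm (poly Q z) = nval j z"
proof -
  define N where "N = numer j"
  define V where "V w = (norm (ratio j w))\<^sup>2" for w
  have V_cont: "continuous_on (cball 0 1) V" unfolding V_def by (intro continuous_intros ratio_cont)
  define E where "E w = \<bar>norm (poly N w) - norm (poly Q w)\<bar>" for w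
  have E_cont: "continuous_on (sphere 0 1) E" unfolding E_def by (intro continuous_intros)
  have normN: "norm (poly N w) = nval j w" if "norm w = 1" for w
    using numer_nonneg[of j] that unfolding nonneg_trig_def nval_def N_def
    by (metis abs_of_nonneg mult_1 norm_mult norm_of_real norm_power power_one)
  obtain B where B: "B \<ge> 1" "\<And>w. norm w = 1 \<Longrightarrow> \<bar>ntot w\<bar> \<le> B"
    using sphere_bounded[OF continuous_on_ntot] by blast
  have "circ_avg E \<le> 0"
  proof (rule field_le_epsilon)
    fix \<epsilon> :: real assume \<epsilon>: "\<epsilon> > 0"
    \<comment> \<open>Four errors: the mean convergence and the dilations of \<open>V\<close>,
      \<open>N\<close> and \<open>Q\<close>.\<close>
    define \<delta> where "\<delta> = \<epsilon> / 4"
    have \<delta>: "\<delta> > 0" using \<epsilon> by (simp add: \<delta>_def)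
    have "eventually (\<lambda>r. r \<in> {0<..<1}) (at_left (1::real))"
      by (rule eventually_at_left_real) simp
    moreover have "eventually (\<lambda>r. circ_avg (\<lambda>z. \<bar>nval j z - ntot z * tval r j z\<bar>) \<le> \<delta>) (at_left 1)"
      by (rule modulus_convergence_L1[OF \<delta>])
    moreover have "eventually (\<lambda>r. \<forall>z. norm z = 1 \<longrightarrow> dist (V (of_real r * z)) (V z) < \<delta> / B) (at_left 1)"
      by (rule dilate_uniform[OF V_cont]) (use \<delta> B in simp)
    moreover have "eventually (\<lambda>r. \<forall>z. norm z = 1 \<longrightarrow> dist (poly N (of_real r * z)) (poly N z) < \<delta>) (at_left 1)"
      by (rule dilate_uniform[OF _ \<delta>]) (intro continuous_intros)
    moreover have "eventually (\<lambda>r. \<forall>z. norm z = 1 \<longrightarrow> dist (poly Q (of_real r * z)) (poly Q z) < \<delta>) (at_left 1)"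
      by (rule dilate_uniform[OF _ \<delta>]) (intro continuous_intros)
    ultimately have "eventually (\<lambda>r. circ_avg E \<le> \<epsilon>) (at_left (1::real))"
    proof eventually_elim
      case (elim r)
      then have r: "0 < r" "r < 1" by auto
      have "circ_avg E \<le> circ_avg (\<lambda>z. \<bar>nval j z - ntot z * tval r j z\<bar> + 3 * \<delta>)"
      proof (rule circ_avg_mono[OF E_cont])
        fix w :: complex assume w: "norm w = 1"
        define x where "x = norm (quot j (of_real r * w))"
        have rw: "norm (of_real r * w) < 1" using r w by (simp add: norm_mult)
        have x: "0 \<le> x" "x \<le> 1" using quot_le[OF rw] by (auto simp: x_def)
        have tv: "tval r j w = V (of_real r * w) * x powr (2 * p j)"
          unfolding tval_def F_eq_quot[OF rw j] x_def V_def outer_powr[symmetric]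
          by (simp add: norm_mult powr_mult mult.commute)
        have xp: "x powr (2 * p j) \<le> x"
          using powr_mono'[of 1 "2 * p j" x] p_ge[of j] x by simp
        have nt: "ntot w \<ge> 0" "ntot w \<le> B" using B(2)[OF w] nval_nonneg[OF w] nval_le_ntot[OF w] order_trans by (blast, linarith)
        have "nval j w * (1 - x) \<le> nval j w * (1 - x powr (2 * p j))"
          using xp nval_nonneg[OF w] by (intro mult_left_mono) auto
        also have "\<dots> = nval j w - ntot w * (V w * x powr (2 * p j))"
          using ntot_ratio[OF w, of j] by (simp add: V_def algebra_simps)
        also have "\<dots> = (nval j w - ntot w * tval r j w) + ntot w * ((V (of_real r * w) - V w) * x powr (2 * p j))"
          unfolding tv by (simp add: algebra_simps)
        also have "ntot w * ((V (of_real r * w) - V w) * x powr (2 * p j)) \<le> B * (\<delta> / B * 1)"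
        proof -
          have "V (of_real r * w) - V w \<le> \<delta> / B" using elim(3) w by (auto simp: dist_real_def)
          then have "(V (of_real r * w) - V w) * x powr (2 * p j) \<le> \<delta> / B * x powr (2 * p j)" by (intro mult_right_mono) auto
          also have "\<dots> \<le> \<delta> / B * 1" using xp x \<delta> B by (intro mult_left_mono) auto
          finally have "ntot w * ((V (of_real r * w) - V w) * x powr (2 * p j)) \<le> ntot w * (\<delta> / B * 1)"
            using nt by (intro mult_left_mono)
          also have "\<dots> \<le> B * (\<delta> / B * 1)" using nt \<delta> B by (intro mult_right_mono) auto
          finally show ?thesis .
        qed
        also have "B * (\<delta> / B * 1) = \<delta>" using B by simp
        finally have 1: "nval j w * (1 - x) \<le> \<bar>nval j w - ntot w * tval r j w\<bar> + \<delta>" by linarith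
        have 2: "0 \<le> nval j w * (1 - x)" using nval_nonneg[OF w] x by simp
        have "norm (poly Q (of_real r * w)) = x * norm (poly N (of_real r * w))"
          unfolding Q[OF rw, symmetric] by (simp add: norm_mult x_def N_def)
        moreover have "\<bar>x * norm (poly N (of_real r * w)) - x * norm (poly N w)\<bar> \<le> \<delta>"
        proof -
          have "\<bar>x * (norm (poly N (of_real r * w)) - norm (poly N w))\<bar> \<le> 1 * dist (poly N (of_real r * w)) (poly N w)"
            unfolding abs_mult dist_norm using x by (intro mult_mono norm_triangle_ineq3) auto
          also have "\<dots> \<le> \<delta>" using elim(4) w by (simp add: less_imp_le)
          finally show ?thesis by (simp add: right_diff_distrib)
        qed
        moreover have "\<bar>norm (poly Q (of_real r * w)) - norm (poly Q w)\<bar> \<le> \<delta>"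
          using elim(5) w norm_triangle_ineq3[of "poly Q (of_real r * w)" "poly Q w"]
          unfolding dist_norm by (meson less_imp_le order_trans)
        moreover have "norm (poly N w) - x * norm (poly N w) = nval j w * (1 - x)"
          using normN[OF w] by (simp add: algebra_simps)
        ultimately show "E w \<le> \<bar>nval j w - ntot w * tval r j w\<bar> + 3 * \<delta>"
          unfolding E_def using 1 2 by linarith
      qed (intro continuous_intros r)
      also have "\<dots> = circ_avg (\<lambda>z. \<bar>nval j z - ntot z * tval r j z\<bar>) + 3 * \<delta>"
        by (subst circ_avg_add) (intro continuous_intros r, intro continuous_intros, simp only: circ_avg_const)
      also have "\<dots> \<le> \<epsilon>" using elim(2) by (simp add: \<delta>_def)
      finally show ?case .
    qed
    then show "circ_avg E \<le> 0 + \<epsilon>" using eventually_happens[OF _] trivial_limit_at_left_real by force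
  qed
  moreover have "circ_avg E \<ge> 0"
    using circ_avg_mono[of "\<lambda>_. 0" E] E_cont by (auto simp: E_def)
  ultimately have "E z = 0"
    by (intro circ_avg_eq_0D[OF E_cont]) (use z in \<open>auto simp: E_def\<close>)
  then show ?thesis using normN[OF z] by (simp add: E_def)
qed

text \<open>For \<open>|b0 k| = 1\<close> the Moebius factor of \<open>b j k\<close> is the constant
  \<open>- b0 k\<close>; its power goes into the unimodular factor, and the index keeps
  \<open>a j k = 0\<close> with exponent 0.\<close>

lemma component_form:
  assumes j: "rr j > 0"
  shows "\<exists>u r. norm u = 1 \<and> (\<forall>k. r k \<in> {0, 1::nat}) \<and> (\<forall>z. norm z < 1 \<longrightarrow>
     F j z = (u * of_real (coef j)) * (\<Prod>k=1..m-1. ((z - a j k) / (1 - cnj (a j k) * z)) ^ r k *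
       ((1 - cnj (a j k) * z) / (1 - cnj (a0 k) * z)) powr of_real (1 / p j)))"
proof -
  obtain Q where Q: "degree Q \<le> 2 * (m - 1)" "\<And>z. norm z < 1 \<Longrightarrow> quot j z * poly (numer j) z = poly Q z"
    using quot_numer_polynomial[OF j] by blast
  have "\<exists>u r. norm u = 1 \<and> (\<forall>k. r k \<in> {0, 1::nat}) \<and>
     (\<forall>z. norm z < 1 \<longrightarrow> quot j z = u * (\<Prod>k=1..m-1. ((z - b j k) / (1 - cnj (b j k) * z)) ^ r k))"
  proof (rule blaschke_from_quotient)
    show "continuous_on (ball 0 1) (quot j)"
      by (rule holomorphic_on_imp_continuous_on[OF quot_hol[OF j]])
    show "degree (smult (of_real (1 / rr j)) Q) \<le> 2 * (m - 1)"
      using Q(1) degree_smult_le order_trans by blast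
    fix z :: complex
    show "quot j z * (\<Prod>k=1..m-1. (z - b j k) * (1 - cnj (b j k) * z)) = poly (smult (of_real (1 / rr j)) Q) z"
      if "norm z < 1"
      using Q(2)[OF that] j unfolding numer_eq poly_smult poly_prod poly_qfac
      by (simp add: field_simps)
    show "norm (poly (smult (of_real (1 / rr j)) Q) z) = (\<Prod>k=1..m-1. (norm (z - b j k))\<^sup>2)" if "norm z = 1"
      using quot_numer_modulus[OF j Q(2) that] nval_eq[OF that, of j] j
      by (simp add: norm_mult norm_divide)
  qed (use b_le in auto)
  then obtain u r where ur: "norm u = 1" "\<And>k. r k \<in> {0, 1::nat}"
    "\<And>z. norm z < 1 \<Longrightarrow> quot j z = u * (\<Prod>k=1..m-1. ((z - b j k) / (1 - cnj (b j k) * z)) ^ r k)" by blast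
  define r' where "r' k = (if norm (b0 k) = 1 then 0 else r k)" for k
  define v where "v k = (if norm (b0 k) = 1 then (- b0 k) ^ r k else 1)" for k
  define u' where "u' = u * (\<Prod>k=1..m-1. v k)"
  have "norm u' = 1" unfolding u'_def norm_mult prod_norm[symmetric] ur(1)
    by (simp, rule prod.neutral) (auto simp: v_def norm_power)
  moreover have "\<forall>k. r' k \<in> {0, 1}" using ur(2) by (auto simp: r'_def)
  moreover have "F j z = (u' * of_real (coef j)) * (\<Prod>k=1..m-1. ((z - a j k) / (1 - cnj (a j k) * z)) ^ r' k *
       ((1 - cnj (a j k) * z) / (1 - cnj (a0 k) * z)) powr of_real (1 / p j))" if z: "norm z < 1" for z
  proof -
    have "(\<Prod>k=1..m-1. ((z - b j k) / (1 - cnj (b j k) * z)) ^ r k) =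
      (\<Prod>k=1..m-1. v k * ((z - a j k) / (1 - cnj (a j k) * z)) ^ r' k)"
    proof (rule prod.cong[OF refl])
      fix k assume k: "k \<in> {1..m-1}"
      show "((z - b j k) / (1 - cnj (b j k) * z)) ^ r k = v k * ((z - a j k) / (1 - cnj (a j k) * z)) ^ r' k"
        using b_eq[OF k] boundary_factor_constant[OF _ z, of "b0 k"] by (simp add: v_def r'_def a_def)
    qed
    then have "quot j z = u' * (\<Prod>k=1..m-1. ((z - a j k) / (1 - cnj (a j k) * z)) ^ r' k)"
      using ur(3)[OF z] by (simp add: u'_def prod.distrib)
    then show ?thesis unfolding F_eq_quot[OF z j] by (simp add: outer_def prod.distrib mult_ac)
  qed
  ultimately show ?thesis by blast
qed

text \<open>A vanishing component has vanishing weights \<open>d i j\<close>, hence a vanishing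
  numerator; for \<open>rr j > 0\<close> a product with finitely many zeros would then vanish on the
  whole disc.\<close>

lemma F_nonzero_iff: "(\<exists>z. norm z < 1 \<and> F j z \<noteq> 0) \<longleftrightarrow> rr j > 0"
proof
  assume "\<exists>z. norm z < 1 \<and> F j z \<noteq> 0"
  then show "rr j > 0" using F_zero[of j] rr[of j] by (metis less_eq_real_def)
next
  assume j: "rr j > 0"
  show "\<exists>z. norm z < 1 \<and> F j z \<noteq> 0"
  proof (rule ccontr)
    assume "\<not> (\<exists>z. norm z < 1 \<and> F j z \<noteq> 0)"
    then have "d i j = 0" if "i \<in> {1..m}" for i using l_disc[OF that] by (auto simp: d_def)
    then have "numer j = 0" by (simp add: numer_def)
    then have "poly (numer j) z = 0" for z by simp
    then have "(\<Prod>k=1..m-1. (z - b j k) * (1 - cnj (b j k) * z)) = 0" for z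
      using j unfolding numer_eq poly_smult poly_prod poly_qfac by simp
    then have "z \<in> (b j) ` {1..m-1}" if "norm z < 1" for z
      using that b_le one_minus_cnj_mult_neq_0[of _ z] by (fastforce simp: prod_zero_iff)
    then have "ball 0 1 \<subseteq> (b j) ` {1..m-1}" by auto
    then have "finite (ball (0::complex) 1)" using finite_subset by blast
    then have "closure (ball (0::complex) 1 - ball 0 1) = cball 0 1" by (rule ball_diff_closure)
    then have "cball (0::complex) 1 = {}" by (simp only: Diff_cancel closure_empty)
    then show False by simp
  qed
qed

lemma star_on_nonzero: "star_on m p {j. \<exists>z. norm z < 1 \<and> F j z \<noteq> 0} F"
proof -
  have J: "{j. \<exists>z. norm z < 1 \<and> F j z \<noteq> 0} = {j. rr j > 0}" using F_nonzero_iff by auto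
  have "\<forall>j. \<exists>u r. rr j > 0 \<longrightarrow> norm u = 1 \<and> (\<forall>k. r k \<in> {0, 1::nat}) \<and> (\<forall>z. norm z < 1 \<longrightarrow>
     F j z = (u * of_real (coef j)) * (\<Prod>k=1..m-1. ((z - a j k) / (1 - cnj (a j k) * z)) ^ r k *
       ((1 - cnj (a j k) * z) / (1 - cnj (a0 k) * z)) powr of_real (1 / p j)))"
    using component_form by blast
  from choice[OF this] obtain u where "\<forall>j. \<exists>r. rr j > 0 \<longrightarrow> norm (u j) = 1 \<and> (\<forall>k. r k \<in> {0, 1::nat}) \<and> (\<forall>z. norm z < 1 \<longrightarrow>
     F j z = (u j * of_real (coef j)) * (\<Prod>k=1..m-1. ((z - a j k) / (1 - cnj (a j k) * z)) ^ r k *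
       ((1 - cnj (a j k) * z) / (1 - cnj (a0 k) * z)) powr of_real (1 / p j)))" by (rule exE)
  from choice[OF this] obtain r where ur: "\<And>j. rr j > 0 \<Longrightarrow> norm (u j) = 1 \<and> (\<forall>k. r j k \<in> {0, 1::nat}) \<and> (\<forall>z. norm z < 1 \<longrightarrow>
     F j z = (u j * of_real (coef j)) * (\<Prod>k=1..m-1. ((z - a j k) / (1 - cnj (a j k) * z)) ^ r j k *
       ((1 - cnj (a j k) * z) / (1 - cnj (a0 k) * z)) powr of_real (1 / p j)))" by blast
  define A where "A j = u j * of_real (coef j)" for j
  define s where "s k j = (if rr j > 0 then r j k else 0)" for k j
  have coef: "coef j > 0" if "rr j > 0" for j using that r0 by (simp add: coef_def)
  have normA: "norm (A j) powr (2 * p j) = rr j / r0" if "rr j > 0" for j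
    using ur[OF that] coef[OF that] coef_powr[of j] by (simp add: A_def norm_mult)
  show ?thesis unfolding star_on_def J
  proof (rule exI[of _ A], rule exI[of _ "\<lambda>k j. a j k"], rule exI[of _ a0], rule exI[of _ s], intro conjI ballI allI impI)
    fix j assume j: "j \<in> {j. rr j > 0}"
    show "A j \<noteq> 0" using ur[of j] coef[of j] j by (auto simp: A_def)
    fix z :: complex assume "norm z < 1"
    then show "F j z = A j * (\<Prod>k=1..m-1. ((z - a j k) / (1 - cnj (a j k) * z)) ^ s k j *
       ((1 - cnj (a j k) * z) / (1 - cnj (a0 k) * z)) powr of_real (1 / p j))"
      using ur[of j] j by (simp add: A_def s_def)
  next
    fix z :: complex
    have "(\<Sum>j\<in>{j. rr j > 0}. of_real (norm (A j) powr (2 * p j)) * (\<Prod>k=1..m-1. (z - a j k) * (1 - cnj (a j k) * z)))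
      = (\<Sum>j\<in>UNIV. of_real (rr j / r0) * (\<Prod>k=1..m-1. (z - a j k) * (1 - cnj (a j k) * z)))"
    proof (rule sum.mono_neutral_cong_left)
      show "\<forall>j\<in>UNIV - {j. rr j > 0}. of_real (rr j / r0) * (\<Prod>k=1..m-1. (z - a j k) * (1 - cnj (a j k) * z)) = 0"
        using rr by (auto simp: less_le)
    qed (use normA in auto)
    also have "\<dots> = (1 / of_real r0) * (\<Sum>j\<in>UNIV. of_real (rr j) * (\<Prod>k=1..m-1. (z - a j k) * (1 - cnj (a j k) * z)))"
      by (simp add: sum_distrib_left)
    also have "\<dots> = (\<Prod>k=1..m-1. (z - a0 k) * (1 - cnj (a0 k) * z))"
      unfolding sum_identity using r0 by simp
    finally show "(\<Sum>j\<in>{j. rr j > 0}. of_real (norm (A j) powr (2 * p j)) * (\<Prod>k=1..m-1. (z - a j k) * (1 - cnj (a j k) * z)))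
      = (\<Prod>k=1..m-1. (z - a0 k) * (1 - cnj (a0 k) * z))" .
  qed (use a0_less a_le ur in \<open>auto simp: s_def\<close>)
qed

end

theorem (in extremal_functional) star_on_of_extremal: "star_on m p {j. \<exists>z. norm z < 1 \<and> F j z \<noteq> 0} F"
proof -
  obtain rr r0 b b0 where *: "r0 > 0" "\<forall>j. rr j \<ge> 0"
    "\<forall>k\<in>{1..m-1}. norm (b0 k) \<le> 1 \<and> (\<forall>j. norm (b j k) \<le> 1) \<and> (norm (b0 k) = 1 \<longrightarrow> (\<forall>j. b j k = b0 k))"
    "\<forall>j. numer j = smult (of_real (rr j)) (\<Prod>k=1..m-1. qfac (b j k))"
    "(\<Sum>j\<in>UNIV. numer j) = smult (of_real r0) (\<Prod>k=1..m-1. qfac (b0 k))"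
    using Fejer_Riesz_family[OF numer_nonneg numer_sum_neq_0] by blast
  interpret extremal_factored p m l F c rr r0 b b0
    by unfold_locales (use * in blast)+
  show ?thesis by (rule star_on_nonzero)
qed

section \<open>Competitors of a map of the given form\<close>

definition lagrange :: "'i set \<Rightarrow> ('i \<Rightarrow> complex) \<Rightarrow> 'i \<Rightarrow> complex poly" where
  "lagrange I l i = (\<Prod>k\<in>I-{i}. smult (1 / (l i - l k)) [:- l k, 1:])"

lemma poly_lagrange: "poly (lagrange I l i) z = (\<Prod>k\<in>I-{i}. (z - l k) / (l i - l k))"
  by (simp add: lagrange_def poly_prod diff_divide_distrib)

lemma lagrange_node:
  assumes "finite I" "inj_on l I" "i \<in> I" "k \<in> I"
  shows "poly (lagrange I l i) (l k) = (if i = k then 1 else 0)"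
proof (cases "i = k")
  case True
  have "l i - l n \<noteq> 0" if "n \<in> I - {i}" for n using assms that by (auto dest: inj_onD)
  then show ?thesis using True by (auto simp: poly_lagrange intro!: prod.neutral)
next
  case False
  then show ?thesis using assms by (auto simp: poly_lagrange prod_zero_iff)
qed

lemma lagrange_sum:
  assumes "finite I" "inj_on l I" "I \<noteq> {}"
  shows "(\<Sum>i\<in>I. lagrange I l i) = 1"
proof (rule poly_eqI_degree[where A = "l ` I"])
  show "poly (\<Sum>i\<in>I. lagrange I l i) x = poly 1 x" if "x \<in> l ` I" for x
  proof -
    obtain k where k: "k \<in> I" "x = l k" using \<open>x \<in> l ` I\<close> by auto
    have "poly (\<Sum>i\<in>I. lagrange I l i) x = (\<Sum>i\<in>I. if i = k then 1 else 0)"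
      unfolding poly_sum k(2) by (rule sum.cong[OF refl]) (rule lagrange_node[OF assms(1,2) _ k(1)])
    then show ?thesis using k assms by simp
  qed
  have card: "card (l ` I) = card I" "card I > 0" using assms card_image by (auto simp: card_gt_0_iff)
  have "degree (lagrange I l i) \<le> card I - 1" if "i \<in> I" for i
  proof -
    have "degree (lagrange I l i) \<le> (\<Sum>k\<in>I-{i}. 1)"
      unfolding lagrange_def using assms(1)
      by (intro order_trans[OF degree_prod_sum_le] sum_mono) (auto intro: order_trans[OF degree_smult_le])
    then show ?thesis using that assms(1) by (simp add: card_Diff_singleton)
  qed
  then have "degree (\<Sum>i\<in>I. lagrange I l i) \<le> card I - 1" by (intro degree_sum_le assms(1)) auto
  then show "card (l ` I) > degree (\<Sum>i\<in>I. lagrange I l i)" using card by linarith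
  show "card (l ` I) > degree (1 :: complex poly)" using card by simp
qed

text \<open>The Lagrange polynomials add up to 1; dividing by the full product gives partial
  fractions, and Cauchy's formula evaluates \<open>G\<close> at the nodes.\<close>

lemma circ_avg_vanishing_nodes:
  assumes I: "finite I" "inj_on l I" "I \<noteq> {}" "\<And>i. i \<in> I \<Longrightarrow> norm (l i) < 1"
    and G: "continuous_on (cball 0 1) G" "G holomorphic_on ball 0 1" "\<And>i. i \<in> I \<Longrightarrow> G (l i) = 0"
  shows "circ_avg (\<lambda>z. G z * z / (\<Prod>i\<in>I. z - l i)) = 0"
proof -
  define w where "w i = (\<Prod>k\<in>I-{i}. 1 / (l i - l k))" for i
  have cG: "continuous_on (sphere 0 1) G" by (rule continuous_on_subset[OF G(1)]) auto
  have nz: "z - l i \<noteq> 0" if "norm z = 1" "i \<in> I" for z i using that I(4)[of i] by auto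
  have "circ_avg (\<lambda>z. G z * z / (\<Prod>i\<in>I. z - l i)) = circ_avg (\<lambda>z. \<Sum>i\<in>I. w i * (G z * z / (z - l i)))"
  proof (rule circ_avg_cong)
    fix z :: complex assume z: "norm z = 1"
    have one: "(\<Sum>i\<in>I. poly (lagrange I l i) z) = 1"
      using arg_cong[OF lagrange_sum[OF I(1-3)], of "\<lambda>q. poly q z"] by (simp add: poly_sum)
    have two: "poly (lagrange I l i) z / (\<Prod>i\<in>I. z - l i) = w i / (z - l i)" if i: "i \<in> I" for i
    proof -
      have "(\<Prod>i\<in>I. z - l i) = (z - l i) * (\<Prod>k\<in>I-{i}. z - l k)" by (rule prod.remove[OF I(1) i])
      moreover have "poly (lagrange I l i) z = w i * (\<Prod>k\<in>I-{i}. z - l k)"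
        unfolding poly_lagrange w_def prod.distrib[symmetric] by (rule prod.cong) auto
      moreover have "(\<Prod>k\<in>I-{i}. z - l k) \<noteq> 0" using nz[OF z] I(1) by (auto simp: prod_zero_iff)
      ultimately show ?thesis by simp
    qed
    have "1 / (\<Prod>i\<in>I. z - l i) = (\<Sum>i\<in>I. w i / (z - l i))"
      unfolding one[symmetric] sum_divide_distrib by (rule sum.cong[OF refl two])
    then have "G z * z * (1 / (\<Prod>i\<in>I. z - l i)) = (\<Sum>i\<in>I. w i * (G z * z / (z - l i)))"
      by (simp add: sum_distrib_left mult_ac)
    then show "G z * z / (\<Prod>i\<in>I. z - l i) = (\<Sum>i\<in>I. w i * (G z * z / (z - l i)))" by simp
  qed
  also have "\<dots> = (\<Sum>i\<in>I. circ_avg (\<lambda>z. w i * (G z * z / (z - l i))))"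
    by (rule circ_avg_sum[OF I(1)]) (use nz in \<open>auto intro!: continuous_intros cG\<close>)
  also have "\<dots> = (\<Sum>i\<in>I. w i * G (l i))"
    unfolding circ_avg_mult_left by (rule sum.cong[OF refl]) (simp add: circ_avg_Cauchy[OF G(1,2) I(4)])
  also have "\<dots> = 0" using G(3) by simp
  finally show ?thesis .
qed

text \<open>For \<open>|a| = 1\<close> the quotient is \<open>0 / 0\<close> at \<open>z = a\<close>;
  prescribing the constant makes the function continuous on the closed disc.\<close>

definition mobius_ext :: "complex \<Rightarrow> complex \<Rightarrow> complex" where
  "mobius_ext a z = (if norm a = 1 then - a else (z - a) / (1 - cnj a * z))"

lemma mobius_ext_disc: "norm a \<le> 1 \<Longrightarrow> norm z < 1 \<Longrightarrow> mobius_ext a z = (z - a) / (1 - cnj a * z)"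
  using boundary_factor_constant[of a z] by (simp add: mobius_ext_def)

lemma mobius_ext_mult:
  assumes "norm a \<le> 1" "norm z \<le> 1"
  shows "mobius_ext a z * (1 - cnj a * z)\<^sup>2 = (z - a) * (1 - cnj a * z)"
proof (cases "norm a = 1")
  case True
  have "- a * (1 - cnj a * z) = z - a" using unit_mult_cnj[OF True] by (simp add: algebra_simps)
  moreover have "mobius_ext a z = - a" using True by (simp add: mobius_ext_def)
  ultimately show ?thesis by (simp only: power2_eq_square mult.assoc[symmetric])
next
  case False
  then have "1 - cnj a * z \<noteq> 0" using assms one_minus_cnj_mult_neq_0[of a z] by auto
  then show ?thesis using False by (simp add: mobius_ext_def power2_eq_square)
qed

lemma mobius_ext_regular:
  assumes "norm a \<le> 1"
  shows "continuous_on (cball 0 1) (mobius_ext a)" "mobius_ext a holomorphic_on ball 0 1"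
  using assms one_minus_cnj_mult_neq_0[of a] unfolding mobius_ext_def
  by (cases "norm a = 1"; auto intro!: continuous_intros holomorphic_intros)+

lemma norm_mobius_ext: "norm a \<le> 1 \<Longrightarrow> norm z = 1 \<Longrightarrow> norm (mobius_ext a z) = 1"
  using circle_norm_reflect[of z a] by (auto simp: mobius_ext_def norm_divide)

text \<open>Unlike \<open>powr\<close> at \<open>0\<close>, the exponent \<open>0\<close> gives \<open>1\<close>; this exponent occurs for \<open>p j = 1/2\<close>.\<close>

definition powc :: "complex \<Rightarrow> real \<Rightarrow> complex" where
  "powc w s = (if s = 0 then 1 else w powr of_real s)"

lemma powc_nonzero: "w \<noteq> 0 \<Longrightarrow> powc w s = w powr of_real s"
  by (simp add: powc_def)

text \<open>\<open>E j\<close> contains exactly the Moebius factors that \<open>f j\<close> lacks,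
  so on the circle \<open>E j * f j = B0 * |f j|^(2 p j)\<close> with one Blaschke product
  \<open>B0\<close> for all \<open>j\<close>. Hence \<open>p j * E j / B0\<close> plays the role of
  a gradient of the constraint at \<open>f\<close>, and \<open>h\<close> lies strictly on its
  negative side.\<close>

theorem star_on_no_competitor:
  fixes p :: "'n::finite \<Rightarrow> real"
  assumes p: "\<And>j. p j \<ge> 1 / 2" and m: "m \<ge> 1" and star: "star_on m p J F"
    and l: "\<And>i. i \<in> {1..m} \<Longrightarrow> norm (l i) < 1" "inj_on l {1..m}"
    and h: "\<And>j. continuous_on (cball 0 1) (h j)" "\<And>j. h j holomorphic_on ball 0 1"
    and h_less: "\<And>z. norm z = 1 \<Longrightarrow> (\<Sum>j\<in>UNIV. norm (h j z) powr (2 * p j)) < 1"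
    and interp: "\<And>i j. i \<in> {1..m} \<Longrightarrow> h j (l i) = F j (l i)"
  shows False
proof -
  obtain A \<alpha> \<alpha>0 r where A: "\<And>j. j \<in> J \<Longrightarrow> A j \<noteq> 0"
    and \<alpha>0: "\<And>k. k \<in> {1..m-1} \<Longrightarrow> norm (\<alpha>0 k) < 1"
    and \<alpha>: "\<And>k j. k \<in> {1..m-1} \<Longrightarrow> norm (\<alpha> k j) \<le> 1"
    and r: "\<And>k j. k \<in> {1..m-1} \<Longrightarrow> r k j \<in> {0, 1::nat}"
    and sum: "\<And>z. (\<Sum>j\<in>J. complex_of_real (norm (A j) powr (2 * p j)) *
               (\<Prod>k=1..m-1. (z - \<alpha> k j) * (1 - cnj (\<alpha> k j) * z)))
            = (\<Prod>k=1..m-1. (z - \<alpha>0 k) * (1 - cnj (\<alpha>0 k) * z))"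
    and F: "\<And>j z. j \<in> J \<Longrightarrow> norm z < 1 \<Longrightarrow> F j z = A j * (\<Prod>k=1..m-1.
           ((z - \<alpha> k j) / (1 - cnj (\<alpha> k j) * z)) ^ r k j *
           ((1 - cnj (\<alpha> k j) * z) / (1 - cnj (\<alpha>0 k) * z)) powr complex_of_real (1 / p j))"
    using star unfolding star_on_def by blast
  have p0: "p j > 0" for j using p[of j] by simp
  have nz0: "1 - cnj (\<alpha>0 k) * z \<noteq> 0" if "k \<in> {1..m-1}" "norm z \<le> 1" for k z
    using one_minus_cnj_mult_neq_0[of "\<alpha>0 k" z] \<alpha>0[OF that(1)] that(2) by auto
  define C where "C j k z = (1 - cnj (\<alpha> k j) * z) / (1 - cnj (\<alpha>0 k) * z)" for j k z
  define f where "f j z = A j * (\<Prod>k=1..m-1. mobius_ext (\<alpha> k j) z ^ r k j * C j k z powr of_real (1 / p j))" for j z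
  define E where "E j z = of_real (norm (A j) powr (2 * p j)) / A j *
     (\<Prod>k=1..m-1. mobius_ext (\<alpha> k j) z ^ (1 - r k j) * powc (C j k z) (2 - 1 / p j))" for j z
  define X where "X j z = norm (A j) powr (2 * p j) * (\<Prod>k=1..m-1. (norm (C j k z))\<^sup>2)" for j z
  define \<Psi> where "\<Psi> z = (\<Sum>j\<in>J. of_real (p j) * E j z * (h j z - f j z))" for z
  have Ck_cont: "continuous_on (cball 0 1) (\<lambda>z. C j k z powr of_real s)" if "k \<in> {1..m-1}" "s > 0" for j k s
    unfolding C_def by (rule continuous_on_factor_powr) (use \<alpha> \<alpha>0 that in auto)
  have Ck_hol: "(\<lambda>z. C j k z powr of_real s) holomorphic_on ball 0 1" if "k \<in> {1..m-1}" for j k s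
    unfolding C_def by (rule holomorphic_on_factor_powr) (use \<alpha> \<alpha>0 that in \<open>auto simp: less_imp_le\<close>)
  have s0: "2 - 1 / p j \<ge> 0" for j using p[of j] p0[of j] by (simp add: field_simps)
  have powc_cont: "continuous_on (cball 0 1) (\<lambda>z. powc (C j k z) (2 - 1 / p j))" if "k \<in> {1..m-1}" for j k
    using Ck_cont[OF that, of "2 - 1 / p j"] s0[of j] by (cases "2 - 1 / p j = 0") (auto simp: powc_def)
  have powc_hol: "(\<lambda>z. powc (C j k z) (2 - 1 / p j)) holomorphic_on ball 0 1" if "k \<in> {1..m-1}" for j k
    using Ck_hol[OF that, of j "2 - 1 / p j"] by (cases "2 - 1 / p j = 0") (auto simp: powc_def)
  have f_cont: "continuous_on (cball 0 1) (f j)" and f_hol: "f j holomorphic_on ball 0 1" for j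
    unfolding f_def using p0[of j]
    by (intro continuous_intros holomorphic_intros mobius_ext_regular \<alpha> Ck_cont Ck_hol; simp)+
  have E_cont: "continuous_on (cball 0 1) (E j)" and E_hol: "E j holomorphic_on ball 0 1" if "j \<in> J" for j
    unfolding E_def using A[OF that]
    by (intro continuous_intros holomorphic_intros mobius_ext_regular \<alpha> powc_cont powc_hol; simp)+
  have \<Psi>_cont: "continuous_on (cball 0 1) \<Psi>" and \<Psi>_hol: "\<Psi> holomorphic_on ball 0 1"
    unfolding \<Psi>_def by (intro continuous_intros holomorphic_intros E_cont E_hol f_cont f_hol h; assumption)+
  have f_F: "f j z = F j z" if "j \<in> J" "norm z < 1" for j z
    unfolding f_def F[OF that] C_def
    by (intro arg_cong[where f = "(*) (A j)"] prod.cong refl) (use mobius_ext_disc \<alpha> that in auto)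
  have \<Psi>_zero: "\<Psi> (l i) = 0" if "i \<in> {1..m}" for i
    unfolding \<Psi>_def using f_F l(1)[OF that] interp[OF that] by (intro sum.neutral) auto
  \<comment> \<open>The extra factors make the kernel positive: together with
    \<open>z / \<Prod>(z - l i)\<close> they equal \<open>W z / B0 z\<close> on the circle, with
    \<open>W z > 0\<close>. The powers of \<open>z\<close> balance because there are
    \<open>m - 1\<close> zeros \<open>\<alpha>0 k\<close> and \<open>m\<close> nodes.\<close>
  define G where "G z = \<Psi> z * (\<Prod>k=1..m-1. (1 - cnj (\<alpha>0 k) * z)\<^sup>2) / (\<Prod>i=1..m. 1 - cnj (l i) * z)" for z
  have nzl: "1 - cnj (l i) * z \<noteq> 0" if "i \<in> {1..m}" "norm z \<le> 1" for i z
    using one_minus_cnj_mult_neq_0[of "l i" z] l(1)[OF that(1)] that(2) by auto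
  have avg0: "circ_avg (\<lambda>z. G z * z / (\<Prod>i=1..m. z - l i)) = 0"
  proof (rule circ_avg_vanishing_nodes)
    show "continuous_on (cball 0 1) G" unfolding G_def
      by (intro continuous_intros \<Psi>_cont) (use nzl in \<open>auto simp: prod_zero_iff\<close>)
    show "G holomorphic_on ball 0 1" unfolding G_def
      by (intro holomorphic_intros \<Psi>_hol) (use nzl in \<open>auto simp: prod_zero_iff\<close>)
  qed (use l \<Psi>_zero m in \<open>auto simp: G_def\<close>)
  define B0 where "B0 z = (\<Prod>k=1..m-1. (z - \<alpha>0 k) / (1 - cnj (\<alpha>0 k) * z))" for z
  define W where "W z = (\<Prod>k=1..m-1. (norm (z - \<alpha>0 k))\<^sup>2) / (\<Prod>i=1..m. (norm (z - l i))\<^sup>2)" for z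
  have z\<alpha>0: "z - \<alpha>0 k \<noteq> 0" if "norm z = 1" "k \<in> {1..m-1}" for z k using \<alpha>0[OF that(2)] that(1) by auto
  have zl: "z - l i \<noteq> 0" if "norm z = 1" "i \<in> {1..m}" for z i using l(1)[OF that(2)] that(1) by auto
  have W_pos: "W z > 0" if "norm z = 1" for z
    unfolding W_def by (intro divide_pos_pos prod_pos) (use z\<alpha>0[OF that] zl[OF that] in auto)
  have kernel: "G z * z / (\<Prod>i=1..m. z - l i) = of_real (W z) * (\<Psi> z / B0 z)" if z: "norm z = 1" for z
  proof -
    have z0: "z \<noteq> 0" using z by auto
    have "(\<Prod>i=1..m. 1 - cnj (l i) * z) * (\<Prod>i=1..m. z - l i) = (\<Prod>i=1..m. (z - l i) * (1 - cnj (l i) * z))"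
      by (simp add: prod.distrib mult.commute)
    also have "\<dots> = z ^ m * of_real (\<Prod>i=1..m. (norm (z - l i))\<^sup>2)"
      unfolding circle_factor[OF z] by (simp add: prod.distrib)
    finally have den: "(\<Prod>i=1..m. 1 - cnj (l i) * z) * (\<Prod>i=1..m. z - l i) = z ^ m * of_real (\<Prod>i=1..m. (norm (z - l i))\<^sup>2)" .
    have "(\<Prod>k=1..m-1. (1 - cnj (\<alpha>0 k) * z)\<^sup>2) * B0 z = (\<Prod>k=1..m-1. (z - \<alpha>0 k) * (1 - cnj (\<alpha>0 k) * z))"
      unfolding B0_def prod.distrib[symmetric]
      by (rule prod.cong) (use nz0 z in \<open>auto simp: power2_eq_square\<close>)
    also have "\<dots> = z ^ (m - 1) * of_real (\<Prod>k=1..m-1. (norm (z - \<alpha>0 k))\<^sup>2)"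
      unfolding circle_factor[OF z] by (simp add: prod.distrib)
    finally have num: "(\<Prod>k=1..m-1. (1 - cnj (\<alpha>0 k) * z)\<^sup>2) * B0 z = z ^ (m - 1) * of_real (\<Prod>k=1..m-1. (norm (z - \<alpha>0 k))\<^sup>2)" .
    have B0nz: "B0 z \<noteq> 0" unfolding B0_def using z\<alpha>0[OF z] nz0 z by (auto simp: prod_zero_iff)
    have zm: "z ^ m = z ^ (m - 1) * z" using m by (metis Suc_diff_1 less_eq_Suc_le One_nat_def power_Suc2)
    have "G z * z / (\<Prod>i=1..m. z - l i) = \<Psi> z * (\<Prod>k=1..m-1. (1 - cnj (\<alpha>0 k) * z)\<^sup>2) * z / (z ^ m * of_real (\<Prod>i=1..m. (norm (z - l i))\<^sup>2))"
      unfolding den[symmetric] G_def by simp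
    also have "(\<Prod>k=1..m-1. (1 - cnj (\<alpha>0 k) * z)\<^sup>2) = z ^ (m - 1) * of_real (\<Prod>k=1..m-1. (norm (z - \<alpha>0 k))\<^sup>2) / B0 z"
      using num B0nz by (simp add: eq_divide_eq)
    also have "\<Psi> z * (z ^ (m - 1) * of_real (\<Prod>k=1..m-1. (norm (z - \<alpha>0 k))\<^sup>2) / B0 z) * z / (z ^ m * of_real (\<Prod>i=1..m. (norm (z - l i))\<^sup>2))
       = of_real (W z) * (\<Psi> z / B0 z)"
      unfolding zm W_def of_real_divide using z0 by (simp add: mult_ac)
    finally show ?thesis .
  qed
  have X_sum: "(\<Sum>j\<in>J. X j z) = 1" if z: "norm z = 1" for z
  proof -
    have z0: "z \<noteq> 0" using z by auto
    have conv: "(\<Prod>k=1..m-1. (z - c k) * (1 - cnj (c k) * z)) = z ^ (m - 1) * of_real (\<Prod>k=1..m-1. (norm (z - c k))\<^sup>2)" for c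
      unfolding circle_factor[OF z] by (simp add: prod.distrib)
    have "z ^ (m - 1) * of_real (\<Sum>j\<in>J. norm (A j) powr (2 * p j) * (\<Prod>k=1..m-1. (norm (z - \<alpha> k j))\<^sup>2))
       = z ^ (m - 1) * of_real (\<Prod>k=1..m-1. (norm (z - \<alpha>0 k))\<^sup>2)"
      using sum[of z] unfolding conv by (simp add: sum_distrib_left mult_ac)
    then have eq: "(\<Sum>j\<in>J. norm (A j) powr (2 * p j) * (\<Prod>k=1..m-1. (norm (z - \<alpha> k j))\<^sup>2)) = (\<Prod>k=1..m-1. (norm (z - \<alpha>0 k))\<^sup>2)"
      using z0 by (simp only: mult_cancel_left power_eq_0_iff of_real_eq_iff) simp
    have "(\<Prod>k=1..m-1. (norm (z - \<alpha>0 k))\<^sup>2) \<noteq> 0" using z\<alpha>0[OF z] by (auto simp: prod_zero_iff)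
    moreover have "(\<Sum>j\<in>J. X j z) = (\<Sum>j\<in>J. norm (A j) powr (2 * p j) * (\<Prod>k=1..m-1. (norm (z - \<alpha> k j))\<^sup>2)) / (\<Prod>k=1..m-1. (norm (z - \<alpha>0 k))\<^sup>2)"
      unfolding X_def C_def norm_divide circle_norm_reflect[OF z] power_divide prod_dividef sum_divide_distrib by simp
    ultimately show ?thesis unfolding eq by (metis divide_self)
  qed
  have Ef: "E j z * f j z / B0 z = of_real (X j z)" if j: "j \<in> J" and z: "norm z = 1" for j z
  proof -
    have "(\<Prod>k=1..m-1. mobius_ext (\<alpha> k j) z ^ (1 - r k j) * powc (C j k z) (2 - 1 / p j)) *
        (\<Prod>k=1..m-1. mobius_ext (\<alpha> k j) z ^ r k j * C j k z powr of_real (1 / p j)) / B0 z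
      = (\<Prod>k=1..m-1. of_real ((norm (C j k z))\<^sup>2))"
      unfolding prod.distrib[symmetric] B0_def prod_dividef[symmetric]
    proof (rule prod.cong[OF refl])
      fix k assume k: "k \<in> {1..m-1}"
      define b where "b = mobius_ext (\<alpha> k j) z"
      have "b ^ (1 - r k j) * b ^ r k j = b" using r[OF k, of j] by auto
      moreover have "powc (C j k z) (2 - 1 / p j) * C j k z powr of_real (1 / p j) = (C j k z)\<^sup>2"
      proof (cases "C j k z = 0")
        case False
        have "powc (C j k z) (2 - 1 / p j) = C j k z powr of_real (2 - 1 / p j)"
          by (rule powc_nonzero[OF False])
        then have "powc (C j k z) (2 - 1 / p j) * C j k z powr of_real (1 / p j) = C j k z powr (of_real (2 - 1 / p j) + of_real (1 / p j))"
          by (simp only: powr_add)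
        also have "of_real (2 - 1 / p j) + of_real (1 / p j) = (of_nat 2 :: complex)"
          unfolding of_real_add[symmetric] by simp
        also have "C j k z powr of_nat 2 = (C j k z)\<^sup>2" using False by (simp only: powr_nat if_False)
        finally show ?thesis .
      qed simp
      ultimately have "b ^ (1 - r k j) * powc (C j k z) (2 - 1 / p j) * (b ^ r k j * C j k z powr of_real (1 / p j)) = b * (C j k z)\<^sup>2"
        by (metis mult.assoc mult.left_commute)
      also have "\<dots> / ((z - \<alpha>0 k) / (1 - cnj (\<alpha>0 k) * z)) = of_real ((norm (C j k z))\<^sup>2)"
      proof -
        have z0: "z \<noteq> 0" using z by auto
        have n0: "of_real ((norm (z - \<alpha>0 k))\<^sup>2) \<noteq> (0::complex)" using z\<alpha>0[OF z k] by simp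
        have "b * (C j k z)\<^sup>2 / ((z - \<alpha>0 k) / (1 - cnj (\<alpha>0 k) * z)) =
           (b * (1 - cnj (\<alpha> k j) * z)\<^sup>2) / ((z - \<alpha>0 k) * (1 - cnj (\<alpha>0 k) * z))"
          using nz0[OF k, of z] z by (simp add: C_def power_divide power2_eq_square)
        also have "\<dots> = of_real ((norm (z - \<alpha> k j))\<^sup>2) / of_real ((norm (z - \<alpha>0 k))\<^sup>2)"
          unfolding b_def mobius_ext_mult[OF \<alpha>[OF k] eq_refl[OF z]] circle_factor[OF z] using z0 by simp
        also have "\<dots> = of_real ((norm (C j k z))\<^sup>2)"
          unfolding C_def norm_divide circle_norm_reflect[OF z] power_divide of_real_divide ..
        finally show ?thesis .
      qed
      finally show "mobius_ext (\<alpha> k j) z ^ (1 - r k j) * powc (C j k z) (2 - 1 / p j) *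
        (mobius_ext (\<alpha> k j) z ^ r k j * C j k z powr of_real (1 / p j)) / ((z - \<alpha>0 k) / (1 - cnj (\<alpha>0 k) * z))
        = of_real ((norm (C j k z))\<^sup>2)" unfolding b_def .
    qed
    moreover have "E j z * f j z / B0 z = of_real (norm (A j) powr (2 * p j)) *
      ((\<Prod>k=1..m-1. mobius_ext (\<alpha> k j) z ^ (1 - r k j) * powc (C j k z) (2 - 1 / p j)) *
        (\<Prod>k=1..m-1. mobius_ext (\<alpha> k j) z ^ r k j * C j k z powr of_real (1 / p j)) / B0 z)"
      unfolding E_def f_def using A[OF j] by simp
    ultimately show ?thesis by (simp add: X_def)
  qed
  have B0_norm: "norm (B0 z) = 1" if z: "norm z = 1" for z
    unfolding B0_def prod_norm[symmetric] norm_divide circle_norm_reflect[OF z]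
    by (rule prod.neutral) (use z\<alpha>0[OF z] in auto)
  have f_powr: "norm (f j z) powr (2 * p j) = X j z" if z: "norm z = 1" for j z
  proof -
    have "norm (f j z) powr (2 * p j) = norm (A j) powr (2 * p j) * (\<Prod>k=1..m-1. norm (C j k z powr of_real (1 / p j)) powr (2 * p j))"
      unfolding f_def norm_mult prod_norm[symmetric] powr_mult prod_powr_distrib norm_power
      by (intro arg_cong[where f = "(*) _"] prod.cong refl) (use norm_mobius_ext[OF \<alpha> z] in simp)
    also have "(\<Prod>k=1..m-1. norm (C j k z powr of_real (1 / p j)) powr (2 * p j)) = (\<Prod>k=1..m-1. (norm (C j k z))\<^sup>2)"
      by (rule prod.cong) (use p0[of j] in \<open>simp_all add: norm_powr_of_real powr_powr del: of_real_divide\<close>)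
    finally show ?thesis by (simp add: X_def)
  qed
  \<comment> \<open>Tangent inequality at \<open>|f j z|\<close>, with
    \<open>norm (E j z) = |f j z|^(2 p j - 1)\<close>. At a zero of \<open>f j\<close> either
    \<open>2 - 1 / p j > 0\<close> and \<open>E j\<close> vanishes as well, or
    \<open>p j = 1/2\<close> and \<open>norm (E j z) = 1\<close> is a subgradient of the
    modulus.\<close>
  have term_le: "p j * Re (E j z * (h j z - f j z) / B0 z) \<le> (norm (h j z) powr (2 * p j) - X j z) / 2"
    if j: "j \<in> J" and z: "norm z = 1" for j z
  proof -
    define y where "y = norm (h j z)"
    have "Re (E j z * h j z / B0 z) \<le> norm (E j z * h j z / B0 z)" by (rule complex_Re_le_cmod)
    also have "\<dots> = norm (E j z) * y" by (simp add: norm_mult norm_divide B0_norm[OF z] y_def)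
    finally have "Re (E j z * (h j z - f j z) / B0 z) \<le> norm (E j z) * y - X j z"
      using Ef[OF j z] by (simp add: right_diff_distrib diff_divide_distrib)
    then have "p j * Re (E j z * (h j z - f j z) / B0 z) \<le> p j * (norm (E j z) * y - X j z)"
      using p0[of j] by (intro mult_left_mono) auto
    also have "\<dots> \<le> (y powr (2 * p j) - X j z) / 2"
    proof (cases "f j z = 0")
      case False
      define x where "x = norm (f j z)"
      have x: "x > 0" using False by (simp add: x_def)
      have Xx: "X j z = x powr (2 * p j)" using f_powr[OF z, of j] by (simp add: x_def)
      have "norm (E j z * f j z / B0 z) = X j z" unfolding Ef[OF j z] Xx by simp
      then have "norm (E j z) * x = x powr (2 * p j)"
        unfolding Xx by (simp add: norm_mult norm_divide B0_norm[OF z] x_def)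
      then have "norm (E j z) = x powr (2 * p j - 1)" using x by (simp add: powr_diff eq_divide_eq)
      moreover have "y powr (2 * p j) \<ge> x powr (2 * p j) + 2 * p j * x powr (2 * p j - 1) * (y - x)"
        by (rule powr_ge_tangent) (use p[of j] x in \<open>auto simp: y_def\<close>)
      moreover define T where "T = x powr (2 * p j - 1)"
      moreover have "x powr (2 * p j) = T * x" using x by (simp add: powr_diff T_def)
      ultimately have "norm (E j z) = T" "y powr (2 * p j) \<ge> T * x + 2 * p j * T * (y - x)" "X j z = T * x"
        unfolding Xx by simp_all
      then show ?thesis by (simp add: algebra_simps)
    next
      case True
      have X0: "X j z = 0" using f_powr[OF z, of j] True p0[of j] by simp
      show ?thesis
      proof (cases "p j = 1 / 2")
        case True
        have powc1: "powc w (2 - 1 / p j) = 1" for w unfolding powc_def True by simp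
        have normA: "norm (A j) powr (2 * p j) = norm (A j)" unfolding True by simp
        have "norm (E j z) = 1"
          unfolding E_def powc1 normA norm_mult prod_norm[symmetric] norm_power norm_divide norm_of_real
          using A[OF j] norm_mobius_ext[OF \<alpha> z] by simp
        have ypowr: "y powr (2 * p j) = y" unfolding True by (simp add: y_def)
        show ?thesis unfolding ypowr unfolding X0 \<open>norm (E j z) = 1\<close> True by simp
      next
        case False
        then have s: "2 - 1 / p j > 0" using s0[of j] p0[of j] by (simp add: field_simps)
        have "(\<Prod>k=1..m-1. (norm (C j k z))\<^sup>2) = 0" using X0 A[OF j] by (simp add: X_def)
        then obtain k where k: "k \<in> {1..m-1}" "C j k z = 0" by (auto simp: prod_zero_iff)
        have "(\<Prod>k=1..m-1. mobius_ext (\<alpha> k j) z ^ (1 - r k j) * powc (C j k z) (2 - 1 / p j)) = 0"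
          by (rule prod_zero) (use k s in \<open>auto simp: powc_def intro!: bexI[of _ k]\<close>)
        then have "E j z = 0" unfolding E_def by (simp only: mult_zero_right)
        then show ?thesis using X0 by simp
      qed
    qed
    finally show ?thesis unfolding y_def .
  qed
  \<comment> \<open>This function has mean zero and is negative everywhere on the circle.\<close>
  define u where "u z = Re (G z * z / (\<Prod>i=1..m. z - l i))" for z
  have u_neg: "u z < 0" if z: "norm z = 1" for z
  proof -
    have "Re (\<Psi> z / B0 z) = (\<Sum>j\<in>J. p j * Re (E j z * (h j z - f j z) / B0 z))"
      unfolding \<Psi>_def sum_divide_distrib Re_sum
    proof (rule sum.cong[OF refl])
      fix j
      have "of_real (p j) * E j z * (h j z - f j z) / B0 z = of_real (p j) * (E j z * (h j z - f j z) / B0 z)"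
        by simp
      then show "Re (of_real (p j) * E j z * (h j z - f j z) / B0 z) = p j * Re (E j z * (h j z - f j z) / B0 z)"
        by (simp only: times_complex.sel Re_complex_of_real Im_complex_of_real mult_zero_left diff_zero)
    qed
    also have "\<dots> \<le> (\<Sum>j\<in>J. (norm (h j z) powr (2 * p j) - X j z) / 2)"
      by (rule sum_mono) (rule term_le[OF _ z])
    also have "\<dots> = ((\<Sum>j\<in>J. norm (h j z) powr (2 * p j)) - 1) / 2"
      using X_sum[OF z] by (simp add: sum_divide_distrib[symmetric] sum_subtractf)
    also have "(\<Sum>j\<in>J. norm (h j z) powr (2 * p j)) \<le> (\<Sum>j\<in>UNIV. norm (h j z) powr (2 * p j))"
      by (rule sum_mono2) auto
    finally have "Re (\<Psi> z / B0 z) < 0" using h_less[OF z] by simp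
    then have "W z * Re (\<Psi> z / B0 z) < 0" using W_pos[OF z] by (simp add: mult_pos_neg)
    moreover have "u z = W z * Re (\<Psi> z / B0 z)" unfolding u_def kernel[OF z]
      by (simp only: times_complex.sel Re_complex_of_real Im_complex_of_real mult_zero_left diff_zero)
    ultimately show ?thesis by simp
  qed
  have cG: "continuous_on (sphere 0 1) (\<lambda>z. G z * z / (\<Prod>i=1..m. z - l i))"
    unfolding G_def
    by (intro continuous_intros continuous_on_subset[OF \<Psi>_cont]) (use nzl zl in \<open>auto simp: prod_zero_iff\<close>)
  have cu: "continuous_on (sphere 0 1) u" unfolding u_def by (rule continuous_on_Re[OF cG])
  have "circ_avg u = Re (circ_avg (\<lambda>z. G z * z / (\<Prod>i=1..m. z - l i)))"
    unfolding u_def by (rule circ_avg_linear[OF cG bounded_linear_Re])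
  then have "circ_avg u = 0" using avg0 by simp
  then have "circ_avg (\<lambda>z. - 1 * u z) = 0" unfolding circ_avg_mult_left by simp
  then have "- 1 * u 1 = 0"
    by (rule circ_avg_eq_0D[rotated 2])
       (use u_neg in \<open>auto simp: less_imp_le intro!: continuous_intros cu\<close>)
  then show False using u_neg[of 1] by simp
qed

section \<open>Separation\<close>

lemma powr_convex_combination:
  fixes x y :: real
  assumes "s \<ge> 1" "x \<ge> 0" "y \<ge> 0" "0 \<le> t" "t \<le> 1"
  shows "((1 - t) * x + t * y) powr s \<le> (1 - t) * x powr s + t * y powr s"
proof (cases "(1 - t) * x + t * y = 0")
  case False
  define u where "u = (1 - t) * x + t * y"
  have u: "u > 0" using False assms by (simp add: u_def less_le)
  define T where "T = s * u powr (s - 1)"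
  have "(1 - t) * x powr s + t * y powr s \<ge> (1 - t) * (u powr s + T * (x - u)) + t * (u powr s + T * (y - u))"
    unfolding T_def using assms u by (intro add_mono mult_left_mono powr_ge_tangent) auto
  also have "(1 - t) * (u powr s + T * (x - u)) + t * (u powr s + T * (y - u)) = u powr s + T * ((1 - t) * x + t * y - u)"
    by (simp add: algebra_simps)
  finally show ?thesis by (simp add: u_def)
qed (use assms in simp)

lemma powr_le_self: "0 \<le> x \<Longrightarrow> x \<le> 1 \<Longrightarrow> s \<ge> 1 \<Longrightarrow> x powr s \<le> (x::real)"
  using powr_mono'[of 1 s x] by simp

lemma convergent_subsequence_finite:
  fixes c :: "nat \<Rightarrow> 'a \<Rightarrow> complex"
  assumes "finite A" "\<And>n a. a \<in> A \<Longrightarrow> norm (c n a) \<le> B"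
  shows "\<exists>\<phi> c'. strict_mono \<phi> \<and> (\<forall>a\<in>A. (\<lambda>n. c (\<phi> n) a) \<longlonglongrightarrow> c' a)"
  using assms
proof (induction A rule: finite_induct)
  case empty
  then show ?case by (intro exI[of _ id] exI[of _ undefined]) (auto simp: strict_mono_def)
next
  case (insert b A)
  then obtain \<phi> c' where \<phi>: "strict_mono \<phi>" "\<And>a. a \<in> A \<Longrightarrow> (\<lambda>n. c (\<phi> n) a) \<longlonglongrightarrow> c' a"
    by (metis insertCI)
  have "\<forall>n. c (\<phi> n) b \<in> cball 0 B" using insert.prems by auto
  moreover have "seq_compact (cball (0::complex) B)"
    using compact_cball compact_imp_seq_compact by blast
  ultimately obtain v \<psi> where \<psi>: "strict_mono \<psi>" "((\<lambda>n. c (\<phi> n) b) \<circ> \<psi>) \<longlonglongrightarrow> v"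
    by (elim seq_compactE[rotated]) auto
  have "(\<lambda>n. c ((\<phi> \<circ> \<psi>) n) a) \<longlonglongrightarrow> (c'(b := v)) a" if "a \<in> insert b A" for a
  proof (cases "a = b")
    case False
    then have "((\<lambda>n. c (\<phi> n) a) \<circ> \<psi>) \<longlonglongrightarrow> c' a" using \<phi>(2)[of a] \<psi>(1) that LIMSEQ_subseq_LIMSEQ by blast
    then show ?thesis using False by (simp add: o_def)
  qed (use \<psi>(2) in \<open>simp add: o_def\<close>)
  then show ?case using strict_mono_o[OF \<phi>(1) \<psi>(1)] by blast
qed

text \<open>Separation of a point from a convex set in \<open>\<complex>\<^sup>A\<close>, with \<open>A\<close> a finite set rather than a finite type.
  The functional is a limit of unit vectors \<open>t x0 - y\<close> with \<open>y\<close> an almost nearest point of \<open>S\<close>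
  to \<open>t x0\<close>, as \<open>t\<close> decreases to \<open>1\<close>.\<close>

lemma separate_point_convex:
  fixes S :: "('a \<Rightarrow> complex) set"
  assumes A: "finite A" and \<delta>: "\<delta> > 0"
    and conv: "\<And>x y t. x \<in> S \<Longrightarrow> y \<in> S \<Longrightarrow> 0 \<le> t \<Longrightarrow> t \<le> 1 \<Longrightarrow> (\<lambda>a. of_real (1 - t) * x a + of_real t * y a) \<in> S"
    and small: "\<And>x. (\<And>a. a \<in> A \<Longrightarrow> norm (x a) \<le> \<delta>) \<Longrightarrow> x \<in> S"
    and bdd: "\<And>x a. x \<in> S \<Longrightarrow> a \<in> A \<Longrightarrow> norm (x a) \<le> B"
    and x0: "x0 \<notin> S"
  shows "\<exists>c. (\<exists>a\<in>A. c a \<noteq> 0) \<and> (\<forall>x\<in>S. Re (\<Sum>a\<in>A. c a * x a) \<le> Re (\<Sum>a\<in>A. c a * x0 a))"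
proof -
  define N where "N v = (\<Sum>a\<in>A. (norm (v a))\<^sup>2)" for v :: "'a \<Rightarrow> complex"
  define ip where "ip v x = (\<Sum>a\<in>A. v a \<bullet> x a)" for v x :: "'a \<Rightarrow> complex"
  have N0: "N v \<ge> 0" for v unfolding N_def by (simp add: sum_nonneg)
  have coord: "norm (v a) \<le> sqrt (N v)" if "a \<in> A" for v a
    unfolding N_def by (rule real_le_rsqrt, rule member_le_sum[OF that]) (use A in auto)
  have approx: "\<exists>c. N c = 1 \<and> (\<forall>x\<in>S. ip c x \<le> t * ip c x0 + \<epsilon>)" if t: "t > 1" and \<epsilon>: "\<epsilon> > 0" for t \<epsilon> :: real
  proof -
    define f where "f x = N (\<lambda>a. of_real t * x0 a - x a)" for x
    define I where "I = Inf (f ` S)"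
    have zero: "(\<lambda>_. 0) \<in> S" by (rule small) (use \<delta> in auto)
    have bb: "bdd_below (f ` S)" by (rule bdd_belowI2[of _ 0]) (simp add: f_def N0)
    have I_le: "I \<le> f x" if "x \<in> S" for x unfolding I_def using bb that by (rule cINF_lower)
    \<comment> \<open>Were \<open>t * x0\<close> closer to \<open>S\<close>, the rescaled difference
      \<open>e\<close> would lie in the small ball inside \<open>S\<close>, and \<open>x0\<close>
      would be a convex combination of \<open>x\<close> and \<open>e\<close>.\<close>
    have f_ge: "((t - 1) * \<delta>)\<^sup>2 \<le> f x" if x: "x \<in> S" for x
    proof (rule ccontr)
      assume "\<not> ((t - 1) * \<delta>)\<^sup>2 \<le> f x"
      then have "sqrt (f x) \<le> (t - 1) * \<delta>" using t \<delta> by (intro real_le_lsqrt) (auto simp: f_def N0)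
      define e where "e a = (of_real t * x0 a - x a) / of_real (t - 1)" for a
      have "e \<in> S"
      proof (rule small)
        fix a assume "a \<in> A"
        then have "norm (of_real t * x0 a - x a) \<le> (t - 1) * \<delta>"
          using coord[of a "\<lambda>a. of_real t * x0 a - x a"] \<open>sqrt (f x) \<le> (t - 1) * \<delta>\<close> by (simp add: f_def)
        moreover have "norm (e a) = norm (of_real t * x0 a - x a) / (t - 1)"
          unfolding e_def norm_divide norm_of_real using t by simp
        ultimately show "norm (e a) \<le> \<delta>" using t by (simp add: pos_divide_le_eq mult.commute)
      qed
      then have "(\<lambda>a. of_real (1 - (1 - 1 / t)) * x a + of_real (1 - 1 / t) * e a) \<in> S"
        by (intro conv x) (use t in auto)
      moreover have "(\<lambda>a. of_real (1 - (1 - 1 / t)) * x a + of_real (1 - 1 / t) * e a) = x0"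
      proof
        fix a
        have "of_real (1 - 1 / t) = of_real (t - 1) / (of_real t :: complex)" using t
          by (simp add: field_simps)
        then have "of_real (1 - 1 / t) * e a = (of_real t * x0 a - x a) / of_real t"
          unfolding e_def using t by simp
        then show "of_real (1 - (1 - 1 / t)) * x a + of_real (1 - 1 / t) * e a = x0 a"
          using t by (simp add: field_simps)
      qed
      ultimately show False using x0 by simp
    qed
    have "((t - 1) * \<delta>)\<^sup>2 \<le> I" unfolding I_def by (rule cINF_greatest) (use zero f_ge in auto)
    then have Ipos: "I > 0" using t \<delta> by (meson less_le_trans mult_pos_pos diff_gt_0_iff_gt zero_less_power)
    \<comment> \<open>A bound for squared distances within \<open>S\<close>; the added 1 keeps it
      positive.\<close>
    define C where "C = real (card A) * (2 * B)\<^sup>2 + 1"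
    have C1: "C \<ge> 1" by (simp add: C_def)
    have NC: "N (\<lambda>a. x a - y a) \<le> C" if "x \<in> S" "y \<in> S" for x y
    proof -
      have "N (\<lambda>a. x a - y a) \<le> (\<Sum>a\<in>A. (2 * B)\<^sup>2)" unfolding N_def
      proof (rule sum_mono)
        fix a assume "a \<in> A"
        then have "norm (x a - y a) \<le> 2 * B"
          using bdd[of x a] bdd[of y a] norm_triangle_ineq4[of "x a" "y a"] that by simp
        then show "(norm (x a - y a))\<^sup>2 \<le> (2 * B)\<^sup>2" by (intro power_mono) auto
      qed
      then show ?thesis by (simp add: C_def)
    qed
    \<comment> \<open>The length of the step from \<open>y\<close> towards a point of
      \<open>S\<close>. As \<open>y\<close> is minimal up to \<open>\<theta>^2 * C\<close>, both
      quadratic errors together, divided by \<open>2 * \<theta>\<close>, amount to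
      \<open>\<theta> * C\<close>, which is at most \<open>\<epsilon> * sqrt I\<close>.\<close>
    define \<theta> where "\<theta> = min 1 (\<epsilon> * sqrt I / C)"
    have \<theta>: "0 < \<theta>" "\<theta> \<le> 1" "\<theta> * C \<le> \<epsilon> * sqrt I"
    proof -
      show "0 < \<theta>" "\<theta> \<le> 1" using \<epsilon> Ipos C1 by (auto simp: \<theta>_def)
      have "\<theta> * C \<le> (\<epsilon> * sqrt I / C) * C" using C1 by (intro mult_right_mono) (auto simp: \<theta>_def)
      then show "\<theta> * C \<le> \<epsilon> * sqrt I" using C1 by simp
    qed
    have "\<exists>y\<in>S. f y < I + \<theta>\<^sup>2 * C"
    proof -
      have "Inf (f ` S) < I + \<theta>\<^sup>2 * C" using \<theta> C1 by (simp add: I_def)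
      then show ?thesis using cInf_less_iff[OF _ bb] zero by auto
    qed
    then obtain y where y: "y \<in> S" "f y < I + \<theta>\<^sup>2 * C" by blast
    define v where "v a = of_real t * x0 a - y a" for a
    define n where "n = sqrt (N v)"
    have fv: "f y = N v" by (simp add: f_def v_def[abs_def])
    have n: "n > 0" "sqrt I \<le> n" "n\<^sup>2 = N v"
      using I_le[OF y(1)] Ipos N0[of v] unfolding fv n_def by auto
    define c where "c a = v a / of_real n" for a
    have "N c = 1"
    proof -
      have "N c = N v / n\<^sup>2" unfolding N_def c_def by (simp add: norm_divide power_divide sum_divide_distrib)
      moreover have "N v \<noteq> 0" using n by (metis power_eq_0_iff less_irrefl)
      ultimately show ?thesis unfolding n(3) by simp
    qed
    moreover have "ip c x \<le> t * ip c x0 + \<epsilon>" if x: "x \<in> S" for x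
    proof -
      have "I \<le> f (\<lambda>a. of_real (1 - \<theta>) * y a + of_real \<theta> * x a)"
        by (rule I_le[OF conv[OF y(1) x]]) (use \<theta> in auto)
      also have "\<dots> = N (\<lambda>a. v a - \<theta> *\<^sub>R (x a - y a))"
        unfolding f_def v_def by (rule arg_cong[where f = N]) (auto simp: scaleR_conv_of_real algebra_simps)
      also have "\<dots> = N v - 2 * \<theta> * ip v (\<lambda>a. x a - y a) + \<theta>\<^sup>2 * N (\<lambda>a. x a - y a)"
        unfolding N_def ip_def sum_distrib_left sum_subtractf[symmetric] sum.distrib[symmetric]
      proof (rule sum.cong[OF refl])
        fix a
        have "(norm (w - \<theta> *\<^sub>R u))\<^sup>2 = (norm w)\<^sup>2 - 2 * \<theta> * (w \<bullet> u) + \<theta>\<^sup>2 * (norm u)\<^sup>2" for w u :: complex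
          unfolding power2_norm_eq_inner by (simp add: inner_diff inner_commute power2_eq_square algebra_simps)
        then show "(norm (v a - \<theta> *\<^sub>R (x a - y a)))\<^sup>2 =
          (norm (v a))\<^sup>2 - 2 * \<theta> * (v a \<bullet> (x a - y a)) + \<theta>\<^sup>2 * (norm (x a - y a))\<^sup>2" .
      qed
      also have "\<dots> \<le> (I + \<theta>\<^sup>2 * C) - 2 * \<theta> * ip v (\<lambda>a. x a - y a) + \<theta>\<^sup>2 * C"
        using y(2) NC[OF x y(1)] unfolding fv by (intro add_mono diff_right_mono mult_left_mono) auto
      finally have "\<theta> * ip v (\<lambda>a. x a - y a) \<le> \<theta> * (\<theta> * C)" by (simp add: power2_eq_square algebra_simps)
      then have "ip v (\<lambda>a. x a - y a) \<le> \<theta> * C" using \<theta>(1) by simp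
      also have "\<dots> \<le> \<epsilon> * n" using \<theta>(3) n(2) \<epsilon> mult_left_mono[of "sqrt I" n \<epsilon>] by linarith
      finally have 1: "ip v (\<lambda>a. x a - y a) \<le> \<epsilon> * n" .
      have "ip v x = ip v (\<lambda>a. x a - y a) + ip v y"
        unfolding ip_def sum.distrib[symmetric] by (rule sum.cong) (auto simp: inner_diff)
      moreover have "ip v y = t * ip v x0 - N v"
        unfolding ip_def N_def sum_distrib_left sum_subtractf[symmetric]
        by (rule sum.cong) (auto simp: v_def power2_norm_eq_inner inner_diff inner_commute
            scaleR_conv_of_real[symmetric] algebra_simps)
      ultimately have le: "ip v x \<le> t * ip v x0 + \<epsilon> * n" using 1 N0[of v] by linarith
      have "ip c z = ip v z / n" for z
        unfolding ip_def c_def sum_divide_distrib by (rule sum.cong) (auto simp: inner_complex_def add_divide_distrib)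
      then have ipn: "ip v z = n * ip c z" for z using n(1) by simp
      have "n * ip c x \<le> n * (t * ip c x0 + \<epsilon>)" using le unfolding ipn by (simp add: algebra_simps)
      then show ?thesis using n(1) by simp
    qed
    ultimately show ?thesis by blast
  qed
  have "\<exists>c. N c = 1 \<and> (\<forall>x\<in>S. ip c x \<le> (1 + 1 / Suc n) * ip c x0 + 1 / Suc n)" for n
    by (rule approx) auto
  then obtain c where c: "\<And>n. N (c n) = 1"
    "\<And>n x. x \<in> S \<Longrightarrow> ip (c n) x \<le> (1 + 1 / Suc n) * ip (c n) x0 + 1 / Suc n" by metis
  have "norm (c n a) \<le> 1" if "a \<in> A" for n a using coord[OF that, of "c n"] c(1) by simp
  then obtain \<phi> c' where \<phi>: "strict_mono \<phi>" "\<And>a. a \<in> A \<Longrightarrow> (\<lambda>n. c (\<phi> n) a) \<longlonglongrightarrow> c' a"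
    using convergent_subsequence_finite[OF A, of c 1] by blast
  have lim_ip: "(\<lambda>n. ip (c (\<phi> n)) x) \<longlonglongrightarrow> ip c' x" for x
    unfolding ip_def by (intro tendsto_intros \<phi>)
  \<comment> \<open>Norm 1 passes to the limit because there are finitely many coordinates; so the
    limit functional is not zero.\<close>
  have "(\<lambda>n. N (c (\<phi> n))) \<longlonglongrightarrow> N c'" unfolding N_def by (intro tendsto_intros \<phi>)
  then have "N c' = 1" unfolding c(1) using LIMSEQ_unique tendsto_const by blast
  have "\<exists>a\<in>A. cnj (c' a) \<noteq> 0"
  proof (rule ccontr)
    assume "\<not> (\<exists>a\<in>A. cnj (c' a) \<noteq> 0)"
    then have "N c' = 0" unfolding N_def by (intro sum.neutral) auto
    then show False using \<open>N c' = 1\<close> by simp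
  qed
  moreover have "ip c' x \<le> ip c' x0" if x: "x \<in> S" for x
  proof -
    have z: "(\<lambda>n. 1 / real (Suc (\<phi> n))) \<longlonglongrightarrow> 0"
      using LIMSEQ_subseq_LIMSEQ[OF LIMSEQ_inverse_real_of_nat \<phi>(1)] by (simp add: o_def inverse_eq_divide)
    have "(\<lambda>n. (1 + 1 / Suc (\<phi> n)) * ip (c (\<phi> n)) x0 + 1 / Suc (\<phi> n)) \<longlonglongrightarrow> (1 + 0) * ip c' x0 + 0"
      by (intro tendsto_intros lim_ip z)
    then show ?thesis using LIMSEQ_le[OF lim_ip] c(2)[OF x] by fastforce
  qed
  moreover have "Re (\<Sum>a\<in>A. cnj (c' a) * x a) = ip c' x" for x
    unfolding ip_def Re_sum by (rule sum.cong) (auto simp: inner_complex_def)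
  ultimately show ?thesis by (intro exI[of _ "\<lambda>a. cnj (c' a)"]) auto
qed

lemma complex_ellipsoid_combination:
  fixes p :: "real ^ 'n" and v z w :: "complex ^ 'n"
  assumes p: "\<And>j. p $ j \<ge> 1 / 2" and t: "0 \<le> t" "t \<le> 1"
    and z: "z \<in> complex_ellipsoid p" and w: "w \<in> complex_ellipsoid p"
    and v: "\<And>j. v $ j = of_real (1 - t) * z $ j + of_real t * w $ j"
  shows "v \<in> complex_ellipsoid p"
proof -
  define S where "S x = (\<Sum>j\<in>UNIV. norm (x $ j) powr (2 * p $ j))" for x :: "complex ^ 'n"
  have "S v \<le> (\<Sum>j\<in>UNIV. (1 - t) * norm (z $ j) powr (2 * p $ j) + t * norm (w $ j) powr (2 * p $ j))"
    unfolding S_def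
  proof (rule sum_mono)
    fix j
    have "norm (v $ j) \<le> norm (of_real (1 - t) * z $ j) + norm (of_real t * w $ j)"
      unfolding v by (rule norm_triangle_ineq)
    also have "\<dots> = (1 - t) * norm (z $ j) + t * norm (w $ j)"
      unfolding norm_mult norm_of_real using t by simp
    finally have "norm (v $ j) powr (2 * p $ j) \<le> ((1 - t) * norm (z $ j) + t * norm (w $ j)) powr (2 * p $ j)"
      using p[of j] by (intro powr_mono2) auto
    also have "\<dots> \<le> (1 - t) * norm (z $ j) powr (2 * p $ j) + t * norm (w $ j) powr (2 * p $ j)"
      by (rule powr_convex_combination) (use p[of j] t in auto)
    finally show "norm (v $ j) powr (2 * p $ j) \<le> (1 - t) * norm (z $ j) powr (2 * p $ j) + t * norm (w $ j) powr (2 * p $ j)" .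
  qed
  also have "\<dots> = (1 - t) * S z + t * S w" by (simp add: S_def sum.distrib sum_distrib_left)
  also have "\<dots> < 1"
  proof -
    have zw: "S z < 1" "S w < 1" using z w by (auto simp: complex_ellipsoid_def S_def)
    show ?thesis
    proof (cases "t = 0")
      case False
      have "(1 - t) * S z + t * S w < (1 - t) * 1 + t * 1"
        using zw t False by (intro add_le_less_mono mult_left_mono mult_strict_left_mono) auto
      then show ?thesis by simp
    qed (use zw in simp)
  qed
  finally show ?thesis by (simp add: complex_ellipsoid_def S_def)
qed

text \<open>\<open>s powr (2 * p $ j) <= s\<close>. For \<open>r * h (r z)\<close> this turns a map
  into the closed ellipsoid into a competitor that is holomorphic across the circle.\<close>

lemma complex_ellipsoid_shrink:
  fixes p :: "real ^ 'n" and v :: "complex ^ 'n"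
  assumes p: "\<And>j. p $ j \<ge> 1 / 2" and s: "0 \<le> s" "s < 1"
    and x: "(\<Sum>j\<in>UNIV. norm (x j) powr (2 * p $ j)) \<le> 1"
    and v: "\<And>j. v $ j = of_real s * x j"
  shows "v \<in> complex_ellipsoid p"
proof -
  have "(\<Sum>j\<in>UNIV. norm (v $ j) powr (2 * p $ j)) \<le> (\<Sum>j\<in>UNIV. s * norm (x j) powr (2 * p $ j))"
  proof (rule sum_mono)
    fix j
    have "norm (v $ j) powr (2 * p $ j) = s powr (2 * p $ j) * norm (x j) powr (2 * p $ j)"
      using s by (simp add: v norm_mult powr_mult)
    also have "\<dots> \<le> s * norm (x j) powr (2 * p $ j)"
      using s p[of j] by (intro mult_right_mono powr_le_self) auto
    finally show "norm (v $ j) powr (2 * p $ j) \<le> s * norm (x j) powr (2 * p $ j)" .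
  qed
  also have "\<dots> \<le> s * 1" unfolding sum_distrib_left[symmetric] using x s by (intro mult_left_mono) auto
  finally show ?thesis using s by (simp add: complex_ellipsoid_def)
qed

lemma complex_ellipsoid_small:
  fixes p :: "real ^ 'n" and v :: "complex ^ 'n"
  assumes p: "\<And>j. p $ j \<ge> 1 / 2" and v: "\<And>j. norm (v $ j) \<le> 1 / (real CARD('n) + 1)"
  shows "v \<in> complex_ellipsoid p"
proof -
  have "(\<Sum>j\<in>UNIV. norm (v $ j) powr (2 * p $ j)) \<le> (\<Sum>j\<in>(UNIV::'n set). 1 / (real CARD('n) + 1))"
  proof (rule sum_mono)
    fix j
    have "1 / (real CARD('n) + 1) \<le> 1" by simp
    then have "norm (v $ j) \<le> 1" using v[of j] by linarith
    then have "norm (v $ j) powr (2 * p $ j) \<le> norm (v $ j)"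
      using p[of j] by (intro powr_le_self) auto
    then show "norm (v $ j) powr (2 * p $ j) \<le> 1 / (real CARD('n) + 1)" using v[of j] by linarith
  qed
  also have "\<dots> < 1" by simp
  finally show ?thesis by (simp add: complex_ellipsoid_def)
qed

lemma complex_ellipsoid_norm_less:
  fixes p :: "real ^ 'n" and v :: "complex ^ 'n"
  assumes p: "\<And>j. p $ j > 0" and v: "v \<in> complex_ellipsoid p"
  shows "norm (v $ j) < 1"
proof (rule ccontr)
  assume "\<not> norm (v $ j) < 1"
  then have "1 \<le> norm (v $ j) powr (2 * p $ j)" using p[of j] by (intro ge_one_powr_ge_zero) auto
  also have "\<dots> \<le> (\<Sum>j\<in>UNIV. norm (v $ j) powr (2 * p $ j))"
    by (rule member_le_sum[where f = "\<lambda>j. norm (v $ j) powr (2 * p $ j)"]) auto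
  finally show False using v by (simp add: complex_ellipsoid_def)
qed

text \<open>The node values of admissible closed discs form a bounded convex set containing a ball
  around 0, and weak extremality puts the values of \<open>f\<close> outside it. The separating
  inequality extends to all holomorphic maps into the closed ellipsoid by \<open>r * h (r z)\<close>
  with \<open>r -> 1\<close>.\<close>

lemma weak_extremal_functional:
  fixes p :: "real ^ 'n"
  assumes p: "\<And>j. p $ j \<ge> 1 / 2" and m: "m \<ge> 1" and f: "weak_extremal_for m (complex_ellipsoid p) l f"
  shows "\<exists>c. extremal_functional (\<lambda>j. p $ j) m l (\<lambda>j z. f z $ j) c"
proof -
  define E where "E = complex_ellipsoid p"
  define A where "A = {1..m} \<times> (UNIV :: 'n set)"
  have p0: "p $ j > 0" for j using p[of j] by simp
  have fhol: "(\<lambda>z. f z $ j) holomorphic_on ball 0 1" for j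
    using f by (simp add: weak_extremal_for_def holomorphic_disc_def holomorphic_map_on_def)
  have fE: "f z \<in> E" if "norm z < 1" for z
    using f that by (auto simp: weak_extremal_for_def holomorphic_disc_def E_def)
  have l: "norm (l i) < 1" if "i \<in> {1..m}" for i
    using f that by (auto simp: weak_extremal_for_def distinct_disc_points_def Pi_iff)
  have inj: "inj_on l {1..m}" using f by (simp add: weak_extremal_for_def distinct_disc_points_def)
  have nocomp: "\<not> (\<exists>h\<in>holomorphic_closed_discs E. \<forall>i\<in>{1..m}. h (l i) = f (l i))"
    using f by (simp add: weak_extremal_for_def E_def)
  define S where "S = {x :: nat \<times> 'n \<Rightarrow> complex. \<exists>h\<in>holomorphic_closed_discs E. \<forall>(i, j)\<in>A. x (i, j) = h (l i) $ j}"
  define x0 where "x0 = (\<lambda>(i, j). f (l i) $ j)"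
  have hol_at: "h (l i) \<in> E" if "h \<in> holomorphic_closed_discs E" "i \<in> {1..m}" for h i
  proof -
    obtain U where "cball 0 1 \<subseteq> U" "h \<in> U \<rightarrow> E" using \<open>h \<in> holomorphic_closed_discs E\<close> by (auto simp: holomorphic_closed_discs_def)
    moreover have "l i \<in> cball 0 1" using l[OF that(2)] by simp
    ultimately show ?thesis by blast
  qed
  have Lbound: "\<exists>B. \<forall>z\<in>cball 0 2. norm (poly (lagrange {1..m} l i) z) \<le> B" for i
  proof -
    have "compact ((\<lambda>z. poly (lagrange {1..m} l i) z) ` cball 0 2)"
      by (intro compact_continuous_image continuous_intros) auto
    then show ?thesis using compact_imp_bounded bounded_iff by (metis imageI)
  qed
  then obtain LB where LB: "\<And>i z. z \<in> cball 0 2 \<Longrightarrow> norm (poly (lagrange {1..m} l i) z) \<le> LB i" by metis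
  \<comment> \<open>Lagrange interpolation on \<open>ball 0 2\<close> of data of size
    \<open>\<delta>\<close> has components of size at most
    \<open>\<delta> * \<Lambda> = 1 / (n + 1)\<close>, \<open>n\<close> being the number of
    variables, and so stays in the ellipsoid.\<close>
  define \<Lambda> where "\<Lambda> = (\<Sum>i=1..m. \<bar>LB i\<bar>) + 1"
  have \<Lambda>: "\<Lambda> \<ge> 1" by (simp add: \<Lambda>_def sum_nonneg)
  define \<delta> where "\<delta> = 1 / (real CARD('n) + 1) / \<Lambda>"
  have \<delta>: "\<delta> > 0" using \<Lambda> by (simp add: \<delta>_def add_pos_pos)
  have small: "x \<in> S" if x: "\<And>a. a \<in> A \<Longrightarrow> norm (x a) \<le> \<delta>" for x
  proof -
    define h :: "complex \<Rightarrow> complex ^ 'n" where "h z = (\<chi> j. \<Sum>i=1..m. x (i, j) * poly (lagrange {1..m} l i) z)" for z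
    have hE: "h z \<in> E" if z: "norm z < 2" for z
      unfolding E_def
    proof (rule complex_ellipsoid_small[OF p])
      fix j
      have "norm (h z $ j) \<le> (\<Sum>i=1..m. norm (x (i, j) * poly (lagrange {1..m} l i) z))"
        unfolding h_def vec_lambda_beta by (rule norm_sum)
      also have "\<dots> \<le> (\<Sum>i=1..m. \<delta> * \<bar>LB i\<bar>)"
        unfolding norm_mult
        by (intro sum_mono mult_mono x order_trans[OF LB abs_ge_self]) (use z \<delta> in \<open>auto simp: A_def\<close>)
      also have "\<dots> \<le> \<delta> * \<Lambda>" unfolding \<Lambda>_def sum_distrib_left[symmetric] using \<delta> by (intro mult_left_mono) auto
      also have "\<dots> = 1 / (real CARD('n) + 1)" using \<Lambda> by (simp add: \<delta>_def)
      finally show "norm (h z $ j) \<le> 1 / (real CARD('n) + 1)" .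
    qed
    have "h \<in> holomorphic_closed_discs E"
      unfolding holomorphic_closed_discs_def holomorphic_map_on_def
      by (rule CollectI, rule exI[of _ "ball 0 2"])
         (use hE in \<open>auto simp: h_def intro!: holomorphic_intros\<close>)
    moreover have "x (i, j) = h (l i) $ j" if "(i, j) \<in> A" for i j
    proof -
      have i: "i \<in> {1..m}" using that by (simp add: A_def)
      have "h (l i) $ j = (\<Sum>n=1..m. x (n, j) * (if n = i then 1 else 0))"
        unfolding h_def vec_lambda_beta
        by (rule sum.cong[OF refl]) (simp only: lagrange_node[OF _ inj _ i] finite_atLeastAtMost)
      also have "\<dots> = (\<Sum>n=1..m. if n = i then x (n, j) else 0)" by (rule sum.cong) auto
      also have "\<dots> = x (i, j)" using i by simp
      finally show ?thesis ..
    qed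
    ultimately show ?thesis unfolding S_def by blast
  qed
  have "\<exists>c. (\<exists>a\<in>A. c a \<noteq> 0) \<and> (\<forall>x\<in>S. Re (\<Sum>a\<in>A. c a * x a) \<le> Re (\<Sum>a\<in>A. c a * x0 a))"
  proof (rule separate_point_convex[OF _ \<delta>])
    fix x y :: "nat \<times> 'n \<Rightarrow> complex" and t :: real assume x: "x \<in> S" and y: "y \<in> S" and t: "0 \<le> t" "t \<le> 1"
    obtain h where h: "h \<in> holomorphic_closed_discs E" "\<And>i j. (i, j) \<in> A \<Longrightarrow> x (i, j) = h (l i) $ j" using x by (auto simp: S_def)
    obtain g where g: "g \<in> holomorphic_closed_discs E" "\<And>i j. (i, j) \<in> A \<Longrightarrow> y (i, j) = g (l i) $ j" using y by (auto simp: S_def)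
    obtain U where U: "open U" "cball 0 1 \<subseteq> U" "\<And>j. (\<lambda>z. h z $ j) holomorphic_on U" "h \<in> U \<rightarrow> E"
      using h(1) by (auto simp: holomorphic_closed_discs_def holomorphic_map_on_def)
    obtain V where V: "open V" "cball 0 1 \<subseteq> V" "\<And>j. (\<lambda>z. g z $ j) holomorphic_on V" "g \<in> V \<rightarrow> E"
      using g(1) by (auto simp: holomorphic_closed_discs_def holomorphic_map_on_def)
    define k :: "complex \<Rightarrow> complex ^ 'n" where "k z = (\<chi> j. of_real (1 - t) * h z $ j + of_real t * g z $ j)" for z
    have "k z \<in> E" if "z \<in> U \<inter> V" for z
      unfolding E_def by (rule complex_ellipsoid_combination[OF p t, of "h z" "g z"])
        (use U(4) V(4) that in \<open>auto simp: k_def E_def\<close>)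
    moreover have "(\<lambda>z. k z $ j) holomorphic_on U \<inter> V" for j
      unfolding k_def vec_lambda_beta
      by (intro holomorphic_intros holomorphic_on_subset[OF U(3)] holomorphic_on_subset[OF V(3)]) auto
    ultimately have "k \<in> holomorphic_closed_discs E"
      unfolding holomorphic_closed_discs_def holomorphic_map_on_def
      by (intro CollectI exI[of _ "U \<inter> V"]) (use U(1,2) V(1,2) in auto)
    then show "(\<lambda>a. of_real (1 - t) * x a + of_real t * y a) \<in> S"
      unfolding S_def by (intro CollectI bexI[of _ k]) (use h(2) g(2) in \<open>auto simp: k_def\<close>)
  next
    fix x a assume "x \<in> S" "a \<in> A"
    then show "norm (x a) \<le> 1"
      using complex_ellipsoid_norm_less[OF p0] hol_at by (fastforce simp: S_def A_def E_def less_imp_le)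
  next
    show "x0 \<notin> S"
    proof
      assume "x0 \<in> S"
      then obtain h where h: "h \<in> holomorphic_closed_discs E" "\<And>i j. (i, j) \<in> A \<Longrightarrow> x0 (i, j) = h (l i) $ j" by (auto simp: S_def)
      have "h (l i) = f (l i)" if "i \<in> {1..m}" for i
        unfolding vec_eq_iff using h(2)[of i] that by (simp add: A_def x0_def)
      then show False using nocomp h(1) by blast
    qed
  next
    fix x :: "nat \<times> 'n \<Rightarrow> complex" assume "\<And>a. a \<in> A \<Longrightarrow> norm (x a) \<le> \<delta>"
    then show "x \<in> S" by (rule small)
  qed (simp add: A_def)
  then obtain c' where c': "\<exists>a\<in>A. c' a \<noteq> 0" "\<And>x. x \<in> S \<Longrightarrow> Re (\<Sum>a\<in>A. c' a * x a) \<le> Re (\<Sum>a\<in>A. c' a * x0 a)"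
    by blast
  define c where "c i j = c' (i, j)" for i j
  have val: "(\<Sum>a\<in>A. c' a * (case a of (i, j) \<Rightarrow> y i j)) = (\<Sum>i=1..m. \<Sum>j\<in>UNIV. c i j * y i j)" for y
    unfolding A_def sum.cartesian_product by (simp add: c_def case_prod_unfold)
  have "extremal_functional (\<lambda>j. p $ j) m l (\<lambda>j z. f z $ j) c"
  proof
    fix z :: complex assume "norm z < 1"
    then show "(\<Sum>j\<in>UNIV. norm (f z $ j) powr (2 * p $ j)) \<le> 1"
      using fE[of z] by (simp add: E_def complex_ellipsoid_def)
  next
    fix h :: "'n \<Rightarrow> complex \<Rightarrow> complex"
    assume h: "\<And>j. h j holomorphic_on ball 0 1"
      "\<And>z. norm z < 1 \<Longrightarrow> (\<Sum>j\<in>UNIV. norm (h j z) powr (2 * p $ j)) \<le> 1"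
    define V where "V r = Re (\<Sum>i=1..m. \<Sum>j\<in>UNIV. c i j * (of_real r * h j (of_real r * l i)))" for r :: real
    have le: "V r \<le> Re (\<Sum>i=1..m. \<Sum>j\<in>UNIV. c i j * f (l i) $ j)" if r: "0 < r" "r < 1" for r
    proof -
      define k :: "complex \<Rightarrow> complex ^ 'n" where "k z = (\<chi> j. of_real r * h j (of_real r * z))" for z
      have mem: "norm (of_real r * z) < 1" if "norm z < 1 / r" for z :: complex
        using that r by (simp add: norm_mult field_simps)
      have kE: "k z \<in> E" if "norm z < 1 / r" for z
        unfolding E_def by (rule complex_ellipsoid_shrink[OF p _ r(2) h(2)[OF mem[OF that]]]) (use r in \<open>auto simp: k_def\<close>)
      have khol: "(\<lambda>z. k z $ j) holomorphic_on ball 0 (1 / r)" for j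
      proof -
        have "(h j \<circ> (\<lambda>z. of_real r * z)) holomorphic_on ball 0 (1 / r)"
          by (rule holomorphic_on_compose_gen[OF _ h(1)]) (use mem in \<open>auto intro!: holomorphic_intros\<close>)
        then show ?thesis by (simp add: k_def o_def holomorphic_intros)
      qed
      have "1 < 1 / r" using r by simp
      then have "k \<in> holomorphic_closed_discs E"
        unfolding holomorphic_closed_discs_def holomorphic_map_on_def
        by (intro CollectI exI[of _ "ball 0 (1 / r)"]) (use kE khol in auto)
      then have "(\<lambda>(i, j). k (l i) $ j) \<in> S"
        unfolding S_def by (intro CollectI bexI[of _ k]) auto
      from c'(2)[OF this] show ?thesis unfolding x0_def val V_def by (simp add: k_def)
    qed
    have "(V \<longlongrightarrow> Re (\<Sum>i=1..m. \<Sum>j\<in>UNIV. c i j * (of_real 1 * h j (of_real 1 * l i)))) (at_left 1)"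
      unfolding V_def
    proof (intro tendsto_intros)
      fix i j assume i: "i \<in> {1..m}"
      have "isCont (h j) (of_real 1 * l i)"
        using h(1)[of j] l[OF i]
        by (metis continuous_on_eq_continuous_at dist_0_norm holomorphic_on_imp_continuous_on mem_ball mult_1 of_real_1 open_ball)
      then show "((\<lambda>r. h j (of_real r * l i)) \<longlongrightarrow> h j (of_real 1 * l i)) (at_left (1::real))"
        by (rule isCont_tendsto_compose) (intro tendsto_intros)
    qed
    moreover have "eventually (\<lambda>r. V r \<le> Re (\<Sum>i=1..m. \<Sum>j\<in>UNIV. c i j * f (l i) $ j)) (at_left 1)"
    proof -
      have "eventually (\<lambda>r. r \<in> {0<..<1}) (at_left (1::real))"
        by (rule eventually_at_left_real) simp
      then show ?thesis by eventually_elim (use le in auto)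
    qed
    ultimately have "Re (\<Sum>i=1..m. \<Sum>j\<in>UNIV. c i j * (of_real 1 * h j (of_real 1 * l i))) \<le> Re (\<Sum>i=1..m. \<Sum>j\<in>UNIV. c i j * f (l i) $ j)"
      by (intro tendsto_upperbound[OF _ _ trivial_limit_at_left_real])
    then show "Re (\<Sum>i=1..m. \<Sum>j\<in>UNIV. c i j * h j (l i)) \<le> Re (\<Sum>i=1..m. \<Sum>j\<in>UNIV. c i j * f (l i) $ j)" by simp
  next
    define \<mu> where "\<mu> = (\<Sum>a\<in>A. norm (c' a)) + 1"
    have finA: "finite A" by (simp add: A_def)
    have \<mu>: "\<mu> \<ge> 1" by (simp add: \<mu>_def sum_nonneg)
    \<comment> \<open>A small multiple of the conjugate of the functional lies in \<open>S\<close>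
      and has positive value, which bounds the value at \<open>f\<close> from below.\<close>
    define x where "x a = of_real (\<delta> / \<mu>) * cnj (c' a)" for a
    have "x \<in> S"
    proof (rule small)
      fix a assume a: "a \<in> A"
      have "norm (c' a) \<le> \<mu>" using member_le_sum[OF a, of "\<lambda>a. norm (c' a)"] finA by (simp add: \<mu>_def)
      then have "\<delta> * norm (c' a) \<le> \<delta> * \<mu>" using \<delta> by (intro mult_left_mono) auto
      moreover have "norm (x a) = \<delta> * norm (c' a) / \<mu>" unfolding x_def norm_mult norm_of_real using \<delta> \<mu> by simp
      ultimately show "norm (x a) \<le> \<delta>" using \<mu> by (simp add: pos_divide_le_eq)
    qed
    from c'(2)[OF this] have "Re (\<Sum>a\<in>A. c' a * x a) \<le> Re (\<Sum>i=1..m. \<Sum>j\<in>UNIV. c i j * f (l i) $ j)"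
      unfolding x0_def val .
    moreover have "Re (\<Sum>a\<in>A. c' a * x a) = \<delta> / \<mu> * (\<Sum>a\<in>A. (norm (c' a))\<^sup>2)"
    proof -
      have "c' a * x a = of_real (\<delta> / \<mu> * (norm (c' a))\<^sup>2)" for a
        unfolding x_def of_real_mult complex_norm_square by (simp add: mult_ac)
      then show ?thesis by (simp add: sum_distrib_left)
    qed
    moreover have "(\<Sum>a\<in>A. (norm (c' a))\<^sup>2) > 0"
    proof -
      obtain a where "a \<in> A" "c' a \<noteq> 0" using c'(1) by blast
      then show ?thesis by (intro sum_pos2[OF finA, of a]) auto
    qed
    ultimately show "Re (\<Sum>i=1..m. \<Sum>j\<in>UNIV. c i j * f (l i) $ j) > 0"
      using \<delta> \<mu> by (smt (verit) divide_pos_pos mult_pos_pos)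
  qed (use p m l fhol in auto)
  then show ?thesis by blast
qed

theorem star_on_of_weak_extremal:
  fixes p :: "real ^ 'n"
  assumes "\<And>j. p $ j \<ge> 1 / 2" "m \<ge> 1" "weak_extremal_for m (complex_ellipsoid p) l f"
  shows "star_on m (\<lambda>j. p $ j) {j. \<exists>z. norm z < 1 \<and> f z $ j \<noteq> 0} (\<lambda>j z. f z $ j)"
  using weak_extremal_functional[OF assms] extremal_functional.star_on_of_extremal by blast

text \<open>A competitor maps the closed disc into the open ellipsoid, so the constraint is strict
  on the circle. As the form names no nodes, the argument serves for every choice of them.\<close>

theorem extremal_of_star_on:
  fixes p :: "real ^ 'n"
  assumes p: "\<And>j. p $ j \<ge> 1 / 2" and m: "m \<ge> 1" and f: "holomorphic_disc f (complex_ellipsoid p)"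
    and star: "star_on m (\<lambda>j. p $ j) J (\<lambda>j z. f z $ j)"
  shows "extremal m (complex_ellipsoid p) f"
  unfolding extremal_def weak_extremal_for_def
proof (intro conjI allI impI f notI; assumption?)
  fix l assume l: "distinct_disc_points m l"
  assume "\<exists>h\<in>holomorphic_closed_discs (complex_ellipsoid p). \<forall>i\<in>{1..m}. h (l i) = f (l i)"
  then obtain h where h: "h \<in> holomorphic_closed_discs (complex_ellipsoid p)"
    and interp: "\<And>i. i \<in> {1..m} \<Longrightarrow> h (l i) = f (l i)" by blast
  obtain U where U: "open U" "cball 0 1 \<subseteq> U" "\<And>j. (\<lambda>z. h z $ j) holomorphic_on U" "h \<in> U \<rightarrow> complex_ellipsoid p"
    using h by (auto simp: holomorphic_closed_discs_def holomorphic_map_on_def)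
  show False
  proof (rule star_on_no_competitor[OF p m star, of l "\<lambda>j z. h z $ j"])
    show "continuous_on (cball 0 1) (\<lambda>z. h z $ j)" for j
      using holomorphic_on_imp_continuous_on[OF U(3)] continuous_on_subset U(2) by blast
    show "(\<lambda>z. h z $ j) holomorphic_on ball 0 1" for j
      using U(2,3) by (meson ball_subset_cball holomorphic_on_subset order_trans)
    fix z :: complex assume "norm z = 1"
    then have "z \<in> U" using U(2) by (intro subsetD[OF U(2)]) simp
    then have "h z \<in> complex_ellipsoid p" using U(4) by auto
    then show "(\<Sum>j\<in>UNIV. norm (h z $ j) powr (2 * p $ j)) < 1" by (simp add: complex_ellipsoid_def)
  qed (use l interp in \<open>auto simp: distinct_disc_points_def Pi_iff\<close>)
qed

section \<open>Classes of exponents\<close>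

lemma star_form_iff_star_on:
  fixes p :: "real ^ 'n"
  shows "star_form m p f \<longleftrightarrow> holomorphic_disc f (complex_ellipsoid p) \<and> \<not> f constant_on ball 0 1 \<and>
     star_on m (\<lambda>j. p $ j) UNIV (\<lambda>j z. f z $ j)"
proof -
  have "(\<exists>a \<alpha> \<alpha>0 r. (\<forall>j. a j \<noteq> 0) \<and>
        (\<forall>k\<in>{1..m-1}. \<alpha>0 k \<in> ball 0 1 \<and> (\<forall>j. \<alpha> k j \<in> cball 0 1 \<and> r k j \<in> {0, 1::nat})) \<and>
        (\<forall>z. (\<Sum>j\<in>UNIV. complex_of_real (cmod (a j) powr (2 * p $ j)) *
                   (\<Prod>k = 1..m-1. (z - \<alpha> k j) * (1 - cnj (\<alpha> k j) * z)))
              = (\<Prod>k = 1..m-1. (z - \<alpha>0 k) * (1 - cnj (\<alpha>0 k) * z))) \<and>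
        (\<forall>z\<in>ball 0 1. \<forall>j. f z $ j =
           a j * (\<Prod>k = 1..m-1.
             ((z - \<alpha> k j) / (1 - cnj (\<alpha> k j) * z)) ^ r k j *
             ((1 - cnj (\<alpha> k j) * z) / (1 - cnj (\<alpha>0 k) * z)) powr complex_of_real (1 / p $ j))))
    \<longleftrightarrow> star_on m (\<lambda>j. p $ j) UNIV (\<lambda>j z. f z $ j)"
    unfolding star_on_def
    by (intro iff_exI conj_cong refl) (auto simp: dist_norm)
  then show ?thesis unfolding star_form_def by blast
qed

text \<open>A constant map would be its own competitor.\<close>

lemma weak_extremal_not_constant:
  assumes "weak_extremal_for m D l f" "m \<ge> 1"
  shows "\<not> f constant_on ball 0 1"
proof
  assume "f constant_on ball 0 1"
  then obtain v where v: "\<And>z. z \<in> ball 0 1 \<Longrightarrow> f z = v" by (auto simp: constant_on_def)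
  have "f 0 \<in> D" using assms(1) by (auto simp: weak_extremal_for_def holomorphic_disc_def Pi_iff)
  then have "(\<lambda>_. v) \<in> holomorphic_closed_discs D"
    using v[of 0] by (auto simp: holomorphic_closed_discs_def holomorphic_map_on_def intro!: exI[of _ UNIV])
  moreover have "f (l i) = v" if "i \<in> {1..m}" for i
    using assms(1) that by (intro v) (auto simp: weak_extremal_for_def distinct_disc_points_def)
  ultimately show False using assms(1) unfolding weak_extremal_for_def by auto
qed

lemma ex_distinct_disc_points: "\<exists>l. distinct_disc_points m l"
proof
  show "distinct_disc_points m (\<lambda>i. of_real (1 / (real i + 1)))"
    unfolding distinct_disc_points_def
  proof (intro conjI inj_onI Pi_I)
    fix i assume "i \<in> {1..m}"
    then show "complex_of_real (1 / (real i + 1)) \<in> ball 0 1"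
      unfolding mem_ball dist_0_norm norm_of_real by simp
  next
    fix i k assume "complex_of_real (1 / (real i + 1)) = complex_of_real (1 / (real k + 1))"
    then have "1 / (real i + 1) = 1 / (real k + 1)" by (simp only: of_real_eq_iff)
    then show "i = k" by (simp add: field_simps)
  qed
qed

lemma extremal_imp_weak_extremal: "extremal m D f \<Longrightarrow> weak_extremal m D f"
  using ex_distinct_disc_points[of m] unfolding extremal_def weak_extremal_def by blast

text \<open>Weak extremality for one choice of nodes gives the form on the components that do not
  vanish identically, and this form gives extremality for all choices.\<close>

lemma extremal_characterization:
  fixes p :: "real ^ 'n"
  assumes p: "\<And>j. p $ j \<ge> 1 / 2" and m: "m \<ge> 1" and f: "holomorphic_disc f (complex_ellipsoid p)"
  shows "(weak_extremal m (complex_ellipsoid p) f \<longleftrightarrow> extremal m (complex_ellipsoid p) f)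
       \<and> ((\<forall>j. \<exists>z\<in>ball 0 1. f z $ j \<noteq> 0) \<longrightarrow>
            (extremal m (complex_ellipsoid p) f \<longleftrightarrow> star_form m p f))"
proof (intro conjI impI)
  have weak: "extremal m (complex_ellipsoid p) f" if "weak_extremal m (complex_ellipsoid p) f"
    using that star_on_of_weak_extremal[OF p m] extremal_of_star_on[OF p m f]
    unfolding weak_extremal_def by blast
  then show "weak_extremal m (complex_ellipsoid p) f \<longleftrightarrow> extremal m (complex_ellipsoid p) f"
    using extremal_imp_weak_extremal by blast
  assume nz: "\<forall>j. \<exists>z\<in>ball 0 1. f z $ j \<noteq> 0"
  show "extremal m (complex_ellipsoid p) f \<longleftrightarrow> star_form m p f"
  proof
    assume "extremal m (complex_ellipsoid p) f"
    then obtain l where l: "weak_extremal_for m (complex_ellipsoid p) l f"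
      using extremal_imp_weak_extremal unfolding weak_extremal_def by blast
    have "{j. \<exists>z. norm z < 1 \<and> f z $ j \<noteq> 0} = UNIV" using nz by (simp add: set_eq_iff Bex_def)
    then show "star_form m p f"
      using star_on_of_weak_extremal[OF p m l] weak_extremal_not_constant[OF l m] f
      by (simp add: star_form_iff_star_on)
  next
    assume "star_form m p f"
    then show "extremal m (complex_ellipsoid p) f"
      using extremal_of_star_on[OF p m f] star_form_iff_star_on by blast
  qed
qed

lemma symmetric_convex_ge_half:
  fixes p :: "real ^ 'n" and j k :: 'n
  assumes sym: "symmetric_exponent p" and conv: "convex (complex_ellipsoid p)"
    and pos: "\<And>j. p $ j > 0" and jk: "j \<noteq> k"
  shows "p $ i \<ge> 1 / 2"
proof (rule ccontr)
  assume "\<not> p $ i \<ge> 1 / 2"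
  define s where "s = 2 * p $ i"
  have s: "0 < s" "s < 1" using \<open>\<not> p $ i \<ge> 1 / 2\<close> pos[of i] by (auto simp: s_def)
  have ps: "2 * p $ n = s" for n using sym by (auto simp: symmetric_exponent_def s_def)
  \<comment> \<open>\<open>2 * (t / 2) powr s >= 1\<close> amounts to
    \<open>t >= (1 / 2) powr (1 / s - 1)\<close>, a number below 1. Its square root lies strictly
    between it and 1, so two axis points at height \<open>t\<close> are inside while their midpoint
    is not.\<close>
  define t where "t = (1 / 2) powr ((1 / s - 1) / 2)"
  have t: "0 < t" "t < 1"
    using powr_less_mono2[of "(1 / s - 1) / 2" "1 / 2" 1] s by (auto simp: t_def)
  define v :: "'n \<Rightarrow> complex ^ 'n" where "v n = (\<chi> i. if i = n then of_real t else 0)" for n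
  have vE: "v n \<in> complex_ellipsoid p" for n
  proof -
    have "(\<Sum>i\<in>UNIV. norm (v n $ i) powr (2 * p $ i)) = (\<Sum>i\<in>UNIV. if i = n then t powr s else 0)"
      unfolding ps by (rule sum.cong) (use t in \<open>auto simp: v_def\<close>)
    also have "\<dots> = t powr s" by simp
    also have "\<dots> < 1" using powr_less_mono2[of s t 1] s t by simp
    finally show ?thesis by (simp add: complex_ellipsoid_def)
  qed
  have "(1 / 2) *\<^sub>R v j + (1 / 2) *\<^sub>R v k \<in> complex_ellipsoid p"
    by (rule convexD[OF conv vE vE]) auto
  then have "(\<Sum>i\<in>UNIV. norm (((1 / 2) *\<^sub>R v j + (1 / 2) *\<^sub>R v k) $ i) powr s) < 1"
    by (simp add: complex_ellipsoid_def ps)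
  moreover have "(\<Sum>i\<in>UNIV. norm (((1 / 2) *\<^sub>R v j + (1 / 2) *\<^sub>R v k) $ i) powr s)
      \<ge> (\<Sum>i\<in>{j, k}. norm (((1 / 2) *\<^sub>R v j + (1 / 2) *\<^sub>R v k) $ i) powr s)"
    by (rule sum_mono2) auto
  moreover have "(\<Sum>i\<in>{j, k}. norm (((1 / 2) *\<^sub>R v j + (1 / 2) *\<^sub>R v k) $ i) powr s) = 2 * (t / 2) powr s"
    using jk t by (simp add: v_def)
  moreover have "2 * (t / 2) powr s \<ge> 1"
  proof -
    have "(t / 2) = (1 / 2) powr ((1 / s - 1) / 2 + 1)" by (simp add: t_def powr_add)
    then have "(t / 2) powr s = (1 / 2) powr (((1 / s - 1) / 2 + 1) * s)" by (simp add: powr_powr)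
    also have "((1 / s - 1) / 2 + 1) * s = (1 + s) / 2" using s by (simp add: field_simps)
    finally have "(t / 2) powr s = (1 / 2) powr ((1 + s) / 2)" .
    moreover have "(1 / 2) powr ((1 + s) / 2) \<ge> (1 / 2 :: real) powr 1" by (rule powr_mono') (use s in auto)
    ultimately show ?thesis by simp
  qed
  ultimately show False by linarith
qed

lemma directional_derivative_sign:
  fixes \<rho> :: "'a::real_normed_vector \<Rightarrow> real"
  assumes L: "(\<rho> has_derivative L) (at x)" and x: "\<rho> x = 0"
  shows "eventually (\<lambda>\<tau>. \<rho> (x + \<tau> *\<^sub>R v) \<ge> 0) (at_right 0) \<Longrightarrow> L v \<ge> 0"
    and "eventually (\<lambda>\<tau>. \<rho> (x + \<tau> *\<^sub>R v) \<le> 0) (at_right 0) \<Longrightarrow> L v \<le> 0"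
proof -
  have "((\<lambda>\<tau>. x + \<tau> *\<^sub>R v) has_derivative (\<lambda>h. h *\<^sub>R v)) (at 0)"
    by (auto intro!: derivative_eq_intros)
  moreover have "(\<rho> has_derivative L) (at (x + 0 *\<^sub>R v))" using L by simp
  ultimately have "((\<lambda>\<tau>. \<rho> (x + \<tau> *\<^sub>R v)) has_derivative (\<lambda>h. L (h *\<^sub>R v))) (at 0)"
    by (rule has_derivative_compose)
  moreover have "(\<lambda>h. L (h *\<^sub>R v)) = (*) (L v)"
    using linear_scale[OF has_derivative_linear[OF L]] by (auto simp: mult.commute)
  ultimately have "((\<lambda>\<tau>. \<rho> (x + \<tau> *\<^sub>R v)) has_real_derivative L v) (at 0)"
    by (simp add: has_field_derivative_def)
  then have "((\<lambda>h. \<rho> (x + h *\<^sub>R v) / h) \<longlongrightarrow> L v) (at 0)"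
    using x by (simp add: DERIV_def)
  then have lim: "((\<lambda>h. \<rho> (x + h *\<^sub>R v) / h) \<longlongrightarrow> L v) (at_right 0)"
    by (rule filterlim_mono) (auto simp: at_within_le_at)
  have pos: "eventually (\<lambda>h::real. h > 0) (at_right 0)" by (rule eventually_at_right_less)
  show "L v \<ge> 0" if "eventually (\<lambda>\<tau>. \<rho> (x + \<tau> *\<^sub>R v) \<ge> 0) (at_right 0)"
  proof (rule tendsto_lowerbound[OF lim])
    show "eventually (\<lambda>h. 0 \<le> \<rho> (x + h *\<^sub>R v) / h) (at_right 0)"
      using that pos by eventually_elim simp
  qed simp
  show "L v \<le> 0" if "eventually (\<lambda>\<tau>. \<rho> (x + \<tau> *\<^sub>R v) \<le> 0) (at_right 0)"
  proof (rule tendsto_upperbound[OF lim])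
    show "eventually (\<lambda>h. \<rho> (x + h *\<^sub>R v) / h \<le> 0) (at_right 0)"
      using that pos by eventually_elim (simp add: divide_le_0_iff)
  qed simp
qed

text \<open>Near 0 the power \<open>\<tau> powr s\<close> with \<open>s < 1\<close> beats any linear
  loss, and \<open>1 - (1 - \<tau>) powr q\<close> is at most \<open>(q + 1) * \<tau>\<close>. The
  bound \<open>\<tau>0\<close> comes from solving
  \<open>\<tau> powr (1 - s) = 1 / (q + 1)\<close>.\<close>

lemma powr_sum_ge_1_near_0:
  fixes s q :: real
  assumes s: "0 < s" "s < 1" and q: "q > 0"
  shows "eventually (\<lambda>\<tau>. \<tau> powr s + (1 - \<tau>) powr q \<ge> 1) (at_right 0)"
proof -
  define \<tau>0 where "\<tau>0 = min 1 ((1 / (q + 1)) powr (1 / (1 - s)))"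
  have \<tau>0: "\<tau>0 > 0" using q by (simp add: \<tau>0_def)
  have "eventually (\<lambda>\<tau>. \<tau> \<in> {0<..<\<tau>0}) (at_right 0)" by (rule eventually_at_right_real[OF \<tau>0])
  then show ?thesis
  proof eventually_elim
    case (elim \<tau>)
    have \<tau>: "0 < \<tau>" "\<tau> < 1" "\<tau> \<le> (1 / (q + 1)) powr (1 / (1 - s))" using elim by (auto simp: \<tau>0_def)
    have "\<tau> powr (1 - s) \<le> ((1 / (q + 1)) powr (1 / (1 - s))) powr (1 - s)"
      using \<tau> s by (intro powr_mono2) auto
    also have "\<dots> = 1 / (q + 1)" using s q by (simp add: powr_powr)
    finally have "\<tau> powr s * \<tau> powr (1 - s) \<le> \<tau> powr s * (1 / (q + 1))" by (intro mult_left_mono) auto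
    moreover have "\<tau> powr s * \<tau> powr (1 - s) = \<tau>" using \<tau> by (simp flip: powr_add)
    ultimately have "(q + 1) * \<tau> \<le> \<tau> powr s" using q by (simp add: pos_le_divide_eq mult.commute)
    moreover have "(1 - \<tau>) powr q \<ge> 1 - (q + 1) * \<tau>"
    proof (cases "q \<ge> 1")
      case True
      have "(1 - \<tau>) powr q \<ge> 1 powr q + q * 1 powr (q - 1) * (1 - \<tau> - 1)"
        by (rule powr_ge_tangent) (use True \<tau> in auto)
      then show ?thesis using \<tau> by (simp add: algebra_simps)
    next
      case False
      have "(1 - \<tau>) powr q \<ge> (1 - \<tau>) powr 1" by (rule powr_mono') (use False \<tau> in auto)
      moreover have "q * \<tau> \<ge> 0" using q \<tau> by simp
      moreover have "(1 - \<tau>) powr 1 = 1 - \<tau>" using \<tau> by simp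
      ultimately show ?thesis by (simp add: algebra_simps)
    qed
    ultimately show ?case by linarith
  qed
qed

text \<open>If \<open>p j < 1/2\<close>, the boundary has a cusp at \<open>e k\<close> in the direction \<open>e j\<close>: the derivative of a
  defining function would have to vanish there.\<close>

lemma C2_smooth_ge_half:
  fixes p :: "real ^ 'n" and j k :: 'n
  assumes smooth: "C2_smooth (complex_ellipsoid p)" and pos: "\<And>j. p $ j > 0" and jk: "j \<noteq> k"
  shows "p $ j \<ge> 1 / 2"
proof (rule ccontr)
  assume "\<not> p $ j \<ge> 1 / 2"
  then have s: "0 < 2 * p $ j" "2 * p $ j < 1" using pos[of j] by auto
  define E where "E = complex_ellipsoid p"
  define x :: "complex ^ 'n" where "x = axis k 1"
  have outside: "y \<notin> E" if "norm (y $ i) \<ge> 1" for y i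
    using complex_ellipsoid_norm_less[OF pos, of y i] that by (auto simp: E_def)
  have xE: "x \<notin> E" by (rule outside[of _ k]) (simp add: x_def axis_def)
  have inE: "x + \<tau> *\<^sub>R (- axis k 1) \<in> E" if \<tau>: "0 < \<tau>" "\<tau> < 1" for \<tau> :: real
  proof -
    have "(\<Sum>i\<in>UNIV. norm ((x + \<tau> *\<^sub>R (- axis k 1)) $ i) powr (2 * p $ i))
      = (\<Sum>i\<in>UNIV. if i = k then (1 - \<tau>) powr (2 * p $ k) else 0)"
    proof (rule sum.cong[OF refl])
      fix i
      have "norm (1 - \<tau> *\<^sub>R (1 :: complex)) = 1 - \<tau>"
        using norm_scaleR[of "1 - \<tau>" "1 :: complex"] \<tau> by (simp add: scaleR_diff_left)
      then show "norm ((x + \<tau> *\<^sub>R (- axis k 1)) $ i) powr (2 * p $ i) = (if i = k then (1 - \<tau>) powr (2 * p $ k) else 0)"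
        by (simp add: x_def axis_def)
    qed
    also have "\<dots> = (1 - \<tau>) powr (2 * p $ k)" by simp
    also have "\<dots> < 1" using powr_less_mono2[of "2 * p $ k" "1 - \<tau>" 1] \<tau> pos[of k] by simp
    finally show ?thesis by (simp add: E_def complex_ellipsoid_def)
  qed
  have lim: "((\<lambda>\<tau>. x + \<tau> *\<^sub>R v) \<longlongrightarrow> x) (at_right 0)" for v
    by (rule tendsto_eq_intros refl | simp)+
  have ev_in: "eventually (\<lambda>\<tau>. x + \<tau> *\<^sub>R (- axis k 1) \<in> E) (at_right 0)"
    using eventually_at_right_real[OF zero_less_one] by eventually_elim (use inE in auto)
  have "x \<in> closure E"
  proof (rule Lim_in_closed_set[OF closed_closure _ _ lim])
    show "eventually (\<lambda>\<tau>. x + \<tau> *\<^sub>R (- axis k 1) \<in> closure E) (at_right 0)"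
      using ev_in by eventually_elim (use closure_subset in blast)
  qed simp
  then have "x \<in> frontier E" using xE interior_subset by (auto simp: frontier_def)
  then obtain U \<rho> where U: "open U" "x \<in> U" and C2: "C2_on U \<rho>"
    and nz: "\<And>y. y \<in> U \<Longrightarrow> \<not> (\<rho> has_derivative (\<lambda>_. 0)) (at y)"
    and EU: "E \<inter> U = {y \<in> U. \<rho> y < 0}"
    using smooth unfolding C2_smooth_def E_def by blast
  obtain L where L: "(\<rho> has_derivative L) (at x)" using C2 U(2) unfolding C2_on_def by blast
  have evU: "eventually (\<lambda>\<tau>. x + \<tau> *\<^sub>R v \<in> U) (at_right 0)" for v
    using topological_tendstoD[OF lim U] .
  have "\<rho> x \<ge> 0" using EU xE U(2) by force
  moreover have "\<rho> x \<le> 0"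
  proof (rule tendsto_upperbound)
    show "((\<lambda>\<tau>. \<rho> (x + \<tau> *\<^sub>R (- axis k 1))) \<longlongrightarrow> \<rho> x) (at_right 0)"
      by (rule isCont_tendsto_compose[OF has_derivative_continuous[OF L] lim])
    show "eventually (\<lambda>\<tau>. \<rho> (x + \<tau> *\<^sub>R (- axis k 1)) \<le> 0) (at_right 0)"
      using ev_in evU[of "- axis k 1"] by eventually_elim (use EU in force)
  qed simp
  ultimately have x0: "\<rho> x = 0" by simp
  have out: "L v \<ge> 0" if "eventually (\<lambda>\<tau>. x + \<tau> *\<^sub>R v \<notin> E) (at_right 0)" for v
  proof (rule directional_derivative_sign(1)[OF L x0])
    show "eventually (\<lambda>\<tau>. \<rho> (x + \<tau> *\<^sub>R v) \<ge> 0) (at_right 0)"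
      using that evU[of v] by eventually_elim (use EU in force)
  qed
  have linL: "linear L" by (rule has_derivative_linear[OF L])
  \<comment> \<open>The whole line stays outside, so the derivative is nonnegative on
    \<open>v\<close> and on \<open>- v\<close>.\<close>
  have both: "L v = 0" if "\<And>\<tau>. x + \<tau> *\<^sub>R v \<notin> E" for v
  proof -
    have "L v \<ge> 0" by (rule out) (use that in auto)
    moreover have "L (- v) \<ge> 0"
      by (rule out) (use that[of "- \<tau>" for \<tau>] in \<open>auto intro!: always_eventually\<close>)
    ultimately show ?thesis using linear_neg[OF linL, of v] by simp
  qed
  have L_other: "L (axis i c) = 0" if "i \<noteq> k" for i c
    by (rule both, rule outside[of _ k]) (use that in \<open>simp add: x_def axis_def\<close>)
  have L_im: "L (axis k \<i>) = 0"
  proof (rule both, rule outside[of _ k])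
    fix \<tau> :: real
    have "Re ((x + \<tau> *\<^sub>R axis k \<i>) $ k) = 1" by (simp add: x_def axis_def)
    then show "1 \<le> norm ((x + \<tau> *\<^sub>R axis k \<i>) $ k)" using complex_Re_le_cmod by metis
  qed
  have "L (axis k 1) = 0"
  proof -
    have "L (- axis k 1) \<le> 0"
    proof (rule directional_derivative_sign(2)[OF L x0])
      show "eventually (\<lambda>\<tau>. \<rho> (x + \<tau> *\<^sub>R (- axis k 1)) \<le> 0) (at_right 0)"
        using ev_in evU[of "- axis k 1"] by eventually_elim (use EU in force)
    qed
    \<comment> \<open>Here the cusp enters: going inwards along \<open>axis k\<close> and equally
      far along \<open>axis j\<close> leaves the ellipsoid. As \<open>L\<close> vanishes on
      \<open>axis j 1\<close>, this gives \<open>L (axis k 1) <= 0\<close>.\<close>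
    moreover have "L (axis j 1 - axis k 1) \<ge> 0"
    proof (rule out)
      have q: "2 * p $ k > 0" using pos[of k] by simp
      show "eventually (\<lambda>\<tau>. x + \<tau> *\<^sub>R (axis j 1 - axis k 1) \<notin> E) (at_right 0)"
        using powr_sum_ge_1_near_0[OF s q] eventually_at_right_real[OF zero_less_one]
      proof eventually_elim
        case (elim \<tau>)
        define y where "y = x + \<tau> *\<^sub>R (axis j 1 - axis k 1)"
        have "norm (1 - \<tau> *\<^sub>R (1 :: complex)) = 1 - \<tau>"
          using norm_scaleR[of "1 - \<tau>" "1 :: complex"] elim by (simp add: scaleR_diff_left)
        then have "(\<Sum>i\<in>{j, k}. norm (y $ i) powr (2 * p $ i)) = \<tau> powr (2 * p $ j) + (1 - \<tau>) powr (2 * p $ k)"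
          using jk elim by (simp add: y_def x_def axis_def)
        moreover have "(\<Sum>i\<in>{j, k}. norm (y $ i) powr (2 * p $ i)) \<le> (\<Sum>i\<in>UNIV. norm (y $ i) powr (2 * p $ i))"
          by (rule sum_mono2) auto
        ultimately show ?case using elim(1) by (simp add: E_def complex_ellipsoid_def y_def)
      qed
    qed
    ultimately show ?thesis
      using L_other[OF jk, of 1] linear_diff[OF linL, of "axis j 1" "axis k 1"] linear_neg[OF linL, of "axis k 1"] by simp
  qed
  then have L_k: "L (axis k c) = 0" for c
  proof -
    have "axis k c = Re c *\<^sub>R axis k 1 + Im c *\<^sub>R (axis k \<i> :: complex ^ 'n)"
      by (simp add: vec_eq_iff axis_def complex_eq_iff)
    then show ?thesis
      using \<open>L (axis k 1) = 0\<close> L_im linear_add[OF linL] linear_scale[OF linL] by simp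
  qed
  have "L v = 0" for v
  proof -
    have "v = (\<Sum>i\<in>UNIV. axis i (v $ i))" by (simp add: vec_eq_iff axis_def)
    then have "L v = (\<Sum>i\<in>UNIV. L (axis i (v $ i)))" using linear_sum[OF linL] by metis
    also have "\<dots> = 0" by (rule sum.neutral) (metis L_other L_k)
    finally show ?thesis .
  qed
  then have "L = (\<lambda>_. 0)" by auto
  then show False using nz[OF U(2)] L by simp
qed

text \<open>The identity makes \<open>sqrt c * |G|\<close> equal to 1 on the circle, where
  \<open>G\<close> is rational and zero-free on the closed disc. The maximum principle for
  \<open>G\<close> and \<open>1 / G\<close> extends this to the disc, and \<open>G 0 = 1\<close>
  gives \<open>c = 1\<close>. The product of powers then has modulus 1, so it is constant.\<close>

lemma self_reciprocal_rigidity: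
  fixes a b :: "nat \<Rightarrow> complex" and c :: real
  assumes a: "\<And>k. k \<in> I \<Longrightarrow> norm (a k) \<le> 1" and b: "\<And>k. k \<in> I \<Longrightarrow> norm (b k) < 1" and I: "finite I"
    and c: "c \<ge> 0"
    and eq: "\<And>z. of_real c * (\<Prod>k\<in>I. (z - a k) * (1 - cnj (a k) * z)) = (\<Prod>k\<in>I. (z - b k) * (1 - cnj (b k) * z))"
  shows "c = 1"
    and "norm w < 1 \<Longrightarrow> (\<Prod>k\<in>I. ((1 - cnj (a k) * w) / (1 - cnj (b k) * w)) powr of_real s) = 1"
proof -
  have circ: "c * (\<Prod>k\<in>I. (norm (z - a k))\<^sup>2) = (\<Prod>k\<in>I. (norm (z - b k))\<^sup>2)" if z: "norm z = 1" for z
    using arg_cong[OF eq[of z], of norm] c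
    by (simp add: norm_mult circle_norm_reflect[OF z] flip: prod_norm power2_eq_square)
  have rhs: "(\<Prod>k\<in>I. (norm (z - b k))\<^sup>2) > 0" if z: "norm z = 1" for z
  proof (intro prod_pos)
    fix k assume "k \<in> I"
    then have "z \<noteq> b k" using b[of k] z by auto
    then show "0 < (norm (z - b k))\<^sup>2" by simp
  qed
  have c0: "c > 0" using circ[of 1] rhs[of 1] c by (cases "c = 0") auto
  \<comment> \<open>An \<open>a k\<close> on the circle would be a zero of the right-hand side,
    which has none there.\<close>
  have a1: "norm (a k) < 1" if k: "k \<in> I" for k
  proof (rule ccontr)
    assume "\<not> norm (a k) < 1"
    then have n: "norm (a k) = 1" using a[OF k] by simp
    have "(\<Prod>i\<in>I. (norm (a k - a i))\<^sup>2) = 0" using k I by auto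
    then show False using circ[OF n] rhs[OF n] by simp
  qed
  have nz: "1 - cnj (a k) * z \<noteq> 0" "1 - cnj (b k) * z \<noteq> 0" if "k \<in> I" "norm z \<le> 1" for k z
    using one_minus_cnj_mult_neq_0 a1[OF that(1)] b[OF that(1)] that(2) by auto
  define G where "G z = (\<Prod>k\<in>I. (1 - cnj (a k) * z) / (1 - cnj (b k) * z))" for z
  have G0: "G 0 = 1" by (simp add: G_def)
  have G_nz: "G z \<noteq> 0" if "norm z \<le> 1" for z using nz that I by (auto simp: G_def)
  have G_hol: "G holomorphic_on ball 0 1" unfolding G_def by (intro holomorphic_intros) (use nz in auto)
  have G_cont: "continuous_on (cball 0 1) G" unfolding G_def by (intro continuous_intros) (use nz in auto)
  have G_circ: "sqrt c * norm (G z) = 1" if z: "norm z = 1" for z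
  proof (rule power2_eq_imp_eq)
    have "norm (G z) = (\<Prod>k\<in>I. norm (z - a k)) / (\<Prod>k\<in>I. norm (z - b k))"
      by (simp add: G_def norm_divide circle_norm_reflect[OF z] flip: prod_norm prod_dividef)
    then have "(\<Prod>k\<in>I. (norm (z - a k))\<^sup>2) = (norm (G z))\<^sup>2 * (\<Prod>k\<in>I. (norm (z - b k))\<^sup>2)"
      using rhs[OF z] by (simp add: prod_power_distrib power_divide)
    then have "(c * (norm (G z))\<^sup>2) * (\<Prod>k\<in>I. (norm (z - b k))\<^sup>2) = (\<Prod>k\<in>I. (norm (z - b k))\<^sup>2)"
      using circ[OF z] by (simp add: mult.assoc)
    then have "c * (norm (G z))\<^sup>2 = 1" using rhs[OF z] by simp
    then show "(sqrt c * norm (G z))\<^sup>2 = 1\<^sup>2" using c by (simp add: power_mult_distrib)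
  qed (use c in auto)
  have G_disc: "sqrt c * norm (G w) = 1" if w: "norm w < 1" for w
  proof -
    have "norm (of_real (sqrt c) * G w) \<le> 1"
      by (rule circ_maximum_modulus[OF _ _ _ w])
        (use G_circ c in \<open>auto intro!: continuous_intros holomorphic_intros G_hol G_cont simp: norm_mult\<close>)
    moreover have "norm (1 / (of_real (sqrt c) * G w)) \<le> 1"
      by (rule circ_maximum_modulus[OF _ _ _ w])
        (use G_circ c0 G_nz in \<open>auto intro!: continuous_intros holomorphic_intros G_hol G_cont simp: norm_mult norm_divide\<close>)
    moreover have "sqrt c * norm (G w) > 0" using c0 G_nz w by simp
    ultimately show ?thesis using c by (simp add: norm_mult norm_divide)
  qed
  show c1: "c = 1" using G_disc[of 0] G0 by simp
  define K where "K z = (\<Prod>k\<in>I. ((1 - cnj (a k) * z) / (1 - cnj (b k) * z)) powr of_real s)" for z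
  have K_norm: "norm (K z) = 1" if "norm z < 1" for z
  proof -
    have "norm (K z) = norm (G z) powr s"
      unfolding K_def G_def prod_norm[symmetric] norm_powr_of_real by (rule prod_powr_distrib[symmetric])
    then show ?thesis using G_disc[OF that] c1 by simp
  qed
  have "K constant_on ball 0 1"
  proof (rule maximum_modulus_principle[where U = "ball 0 1" and \<xi> = 0])
    show "K holomorphic_on ball 0 1"
      unfolding K_def by (intro holomorphic_on_prod holomorphic_on_factor_powr) (use a b in \<open>auto simp: less_imp_le\<close>)
  qed (use K_norm in auto)
  then have "K w = K 0" if "norm w < 1" using that unfolding constant_on_def by force
  then show "(\<Prod>k\<in>I. ((1 - cnj (a k) * w) / (1 - cnj (b k) * w)) powr of_real s) = 1" if "norm w < 1"
    using that by (simp add: K_def)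
qed

text \<open>With one index the outer factors multiply to 1 for every exponent and
  \<open>norm (A i) = 1\<close>, so the same parameters serve for \<open>q\<close>.\<close>

lemma star_on_single_index:
  fixes p q :: "'n::finite \<Rightarrow> real" and i :: 'n
  assumes i: "UNIV = {i}" and p: "p i > 0" and F: "star_on m p UNIV F"
  shows "star_on m q UNIV F"
proof -
  obtain A \<alpha> \<alpha>0 r where A: "\<And>j. A j \<noteq> 0"
    and par: "\<forall>k\<in>{1..m-1}. norm (\<alpha>0 k) < 1 \<and> (\<forall>j. norm (\<alpha> k j) \<le> 1 \<and> r k j \<in> {0, 1::nat})"
    and eq: "\<And>z. complex_of_real (norm (A i) powr (2 * p i)) * (\<Prod>k=1..m-1. (z - \<alpha> k i) * (1 - cnj (\<alpha> k i) * z))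
            = (\<Prod>k=1..m-1. (z - \<alpha>0 k) * (1 - cnj (\<alpha>0 k) * z))"
    and F: "\<And>z. norm z < 1 \<Longrightarrow> F i z = A i * (\<Prod>k=1..m-1.
           ((z - \<alpha> k i) / (1 - cnj (\<alpha> k i) * z)) ^ r k i *
           ((1 - cnj (\<alpha> k i) * z) / (1 - cnj (\<alpha>0 k) * z)) powr complex_of_real (1 / p i))"
    using F unfolding star_on_def i by auto
  note rig = self_reciprocal_rigidity[where I = "{1..m-1}" and a = "\<lambda>k. \<alpha> k i" and b = \<alpha>0, OF _ _ _ _ eq]
  have c: "norm (A i) powr (2 * p i) = 1" by (rule rig(1)) (use par in auto)
  have K: "(\<Prod>k=1..m-1. ((1 - cnj (\<alpha> k i) * z) / (1 - cnj (\<alpha>0 k) * z)) powr complex_of_real s) = 1"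
    if "norm z < 1" for z s
    by (rule rig(2)) (use par that in auto)
  have "norm (A i) = (norm (A i) powr (2 * p i)) powr (1 / (2 * p i))" using p A by (simp add: powr_powr)
  then have A1: "norm (A i) = 1" unfolding c by simp
  have F': "F i z = A i * (\<Prod>k=1..m-1. ((z - \<alpha> k i) / (1 - cnj (\<alpha> k i) * z)) ^ r k i *
      ((1 - cnj (\<alpha> k i) * z) / (1 - cnj (\<alpha>0 k) * z)) powr complex_of_real (1 / q i))" if "norm z < 1" for z
    unfolding F[OF that] prod.distrib K[OF that] ..
  show ?thesis
    unfolding star_on_def i
    by (intro exI[of _ A] exI[of _ \<alpha>] exI[of _ \<alpha>0] exI[of _ r]) (use A par eq F' A1 in \<open>simp\<close>)
qed

lemma complex_ellipsoid_single_index: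
  fixes p q :: "real ^ 'n" and i :: 'n
  assumes i: "UNIV = {i}" and p: "p $ i > 0" and q: "q $ i > 0"
  shows "complex_ellipsoid p = complex_ellipsoid q"
proof -
  have "x powr s < 1 \<longleftrightarrow> x < 1" if "x \<ge> 0" "s > 0" for x s :: real
    using that powr_less_mono2[of s x 1] powr_mono2[of s 1 x] by fastforce
  then show ?thesis unfolding complex_ellipsoid_def i using p q by simp
qed

theorem proposition4p13:
  fixes p :: "real ^ 'n" and f :: "complex \<Rightarrow> complex ^ 'n" and m :: nat
  assumes p_pos: "\<forall>j. p $ j > 0"
    and p_class: "p \<in> exponents_S
                  \<or> (symmetric_exponent p \<and> convex (complex_ellipsoid p))
                  \<or> C2_smooth (complex_ellipsoid p)"
    and f_holo: "holomorphic_disc f (complex_ellipsoid p)"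
    and m_ge: "m \<ge> 2"
  shows "(weak_extremal m (complex_ellipsoid p) f \<longleftrightarrow> extremal m (complex_ellipsoid p) f)
       \<and> ((\<forall>j. \<exists>z\<in>ball 0 1. f z $ j \<noteq> 0) \<longrightarrow>
            (extremal m (complex_ellipsoid p) f \<longleftrightarrow> star_form m p f))"
proof (cases "\<exists>j k :: 'n. j \<noteq> k")
  case True
  then obtain j0 k0 :: 'n where jk: "j0 \<noteq> k0" by blast
  have "p $ j \<ge> 1 / 2" for j
    using p_class
  proof (elim disjE conjE)
    assume "p \<in> exponents_S"
    then show ?thesis by (rule exponents_S_ge_half)
  next
    assume "symmetric_exponent p" "convex (complex_ellipsoid p)"
    then show ?thesis using symmetric_convex_ge_half p_pos jk by blast
  next
    assume "C2_smooth (complex_ellipsoid p)"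
    moreover obtain k where "j \<noteq> k" using jk by metis
    ultimately show ?thesis using C2_smooth_ge_half p_pos by blast
  qed
  then show ?thesis using m_ge by (intro extremal_characterization f_holo) auto
next
  case False
  then obtain i :: 'n where i: "UNIV = {i}" by blast
  \<comment> \<open>With one index the ellipsoid is the unit disc for every positive exponent, so
    convexity and smoothness say nothing about \<open>p\<close>. The exponent \<open>1/2\<close> is
    substituted, for which the characterization is available.\<close>
  define h :: "real ^ 'n" where "h = (\<chi> j. 1 / 2)"
  have h: "h $ j = 1 / 2" for j by (simp add: h_def)
  have E: "complex_ellipsoid p = complex_ellipsoid h"
    by (rule complex_ellipsoid_single_index[OF i]) (use p_pos in \<open>auto simp: h_def\<close>)
  have "star_on m (\<lambda>j. p $ j) UNIV (\<lambda>j z. f z $ j) \<longleftrightarrow> star_on m (\<lambda>j. h $ j) UNIV (\<lambda>j z. f z $ j)"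
    by (intro iffI; erule star_on_single_index[OF i, rotated]) (use p_pos in \<open>auto simp: h_def\<close>)
  then have "star_form m p f \<longleftrightarrow> star_form m h f" unfolding star_form_iff_star_on E by simp
  then show ?thesis
    using extremal_characterization[of h m f] h m_ge f_holo unfolding E by simp
qed

end
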